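(* Let $\mathbb{K}$ be an algebraically closed field of characteristic zero, and let $f$ and $g$ be trinomials containing no linear terms. Assume that the trinomial hypersurface $\{f=0\}$ is rigid. Then the varieties $\{f=0\}$ and $\{g=0\}$ are isomorphic if and only if the trinomial $g$ is obtained from the trinomial $f$ by a permutation of variables, i.e. there is a bijection from the set of variables of $f$ to the set of variables of $g$ such that the induced isomorphism of polynomial rings sends $f$ to $g$.
   Context: An irreducible affine variety is rigid if it admits no nontrivial regular action of the additive group $(\mathbb{K},+)$. Trinomials: fix positive integers $n_0,n_1,n_2$, put $n=n_0+n_1+n_2$, and for each $i=0,1,2$ fix a tuple $l_i=(l_{i1},\dots,l_{in_i})\in\mathbb{Z}_{>0}^{n_i}$. Put $T_i^{l_i}:=T_{i1}^{l_{i1}}\cdots T_{in_i}^{l_{in_i}}\in\mathbb{K}[T_{ij};\ i=0,1,2,\ j=1,\dots,n_i]$. A trinomial is a polynomial $T_0^{l_0}+T_1^{l_1}+T_2^{l_2}$ in the variables $T_{ij}$; the corresponding trinomial hypersurface is its zero set in $\mathbb{K}^n$ (an irreducible normal affine variety of dimension $n-1$). It contains no linear term if $n_il_{i1}>1$ for $i=0,1,2$. The integers $n_0,n_1,n_2$ and the tuples $l_i$ may differ for $f$ and $g$. *)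

theory Defs
  imports
    "HOL-Library.Poly_Mapping"
    "HOL-Library.FuncSet"
    "HOL-Computational_Algebra.Polynomial"
begin

type_synonym ('v, 'a) mpoly = "('v \<Rightarrow>\<^sub>0 nat) \<Rightarrow>\<^sub>0 'a"

definition mpoly_const :: "'a::comm_ring_1 \<Rightarrow> ('v, 'a) mpoly" where
  "mpoly_const c = Poly_Mapping.single 0 c"

definition mpoly_var :: "'v \<Rightarrow> ('v, 'a::comm_ring_1) mpoly" where
  "mpoly_var v = Poly_Mapping.single (Poly_Mapping.single v 1) 1"

definition mpolys_over :: "'v set \<Rightarrow> ('v, 'a::comm_ring_1) mpoly set" where
  "mpolys_over V = {p. \<forall>m\<in>Poly_Mapping.keys p. Poly_Mapping.keys m \<subseteq> V}"

text \<open>The extension of a coefficient homomorphism \<open>h\<close> and an assignment \<open>s\<close> of the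
  variables to a ring homomorphism on polynomials.\<close>

definition mpoly_extend ::
    "('a::comm_ring_1 \<Rightarrow> 'b::comm_ring_1) \<Rightarrow> ('v \<Rightarrow> 'b) \<Rightarrow> ('v, 'a) mpoly \<Rightarrow> 'b" where
  "mpoly_extend h s p =
     (\<Sum>m\<in>Poly_Mapping.keys p. h (Poly_Mapping.lookup p m) *
        (\<Prod>v\<in>Poly_Mapping.keys m. s v ^ Poly_Mapping.lookup m v))"

definition mpoly_eval :: "('v, 'a::comm_ring_1) mpoly \<Rightarrow> ('v \<Rightarrow> 'a) \<Rightarrow> 'a" where
  "mpoly_eval p x = mpoly_extend (\<lambda>c. c) x p"

definition mpoly_rename ::
    "('v \<Rightarrow> 'w) \<Rightarrow> ('v, 'a::comm_ring_1) mpoly \<Rightarrow> ('w, 'a) mpoly" where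
  "mpoly_rename \<sigma> p = mpoly_extend mpoly_const (\<lambda>v. mpoly_var (\<sigma> v)) p"

text \<open>The affine space with coordinates indexed by \<open>V\<close>; points are \<open>undefined\<close> outside
  \<open>V\<close>, so that they are determined by their coordinates.\<close>

definition affine_space :: "'v set \<Rightarrow> ('v \<Rightarrow> 'a) set" where
  "affine_space V = V \<rightarrow>\<^sub>E UNIV"

definition zero_locus :: "'v set \<Rightarrow> ('v, 'a::comm_ring_1) mpoly \<Rightarrow> ('v \<Rightarrow> 'a) set" where
  "zero_locus V f = {x \<in> affine_space V. mpoly_eval f x = 0}"

text \<open>Below, \<open>X\<close> is a Zariski closed subset of \<open>affine_space V\<close>, and \<open>Y\<close> one of
  \<open>affine_space W\<close>.\<close>

definition regular_map ::
    "'v set \<Rightarrow> ('v \<Rightarrow> 'a::field) set \<Rightarrow> 'w set \<Rightarrow> ('w \<Rightarrow> 'a) set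
      \<Rightarrow> (('v \<Rightarrow> 'a) \<Rightarrow> ('w \<Rightarrow> 'a)) \<Rightarrow> bool" where
  "regular_map V X W Y \<phi> \<longleftrightarrow>
     (\<forall>x\<in>X. \<phi> x \<in> Y) \<and>
     (\<forall>w\<in>W. \<exists>p\<in>mpolys_over V. \<forall>x\<in>X. \<phi> x w = mpoly_eval p x)"

definition isomorphic_varieties ::
    "'v set \<Rightarrow> ('v \<Rightarrow> 'a::field) set \<Rightarrow> 'w set \<Rightarrow> ('w \<Rightarrow> 'a) set \<Rightarrow> bool" where
  "isomorphic_varieties V X W Y \<longleftrightarrow>
     (\<exists>\<phi> \<psi>. regular_map V X W Y \<phi> \<and> regular_map W Y V X \<psi> \<and>
        (\<forall>x\<in>X. \<psi> (\<phi> x) = x) \<and> (\<forall>y\<in>Y. \<phi> (\<psi> y) = y))"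

text \<open>The product of the affine line with \<open>X\<close> is a closed subset of the affine space with
  coordinates indexed by \<open>insert None (Some ` V)\<close>, where \<open>None\<close> is the coordinate on the
  line.\<close>

definition line_times :: "('v \<Rightarrow> 'a) set \<Rightarrow> ('v option \<Rightarrow> 'a) set" where
  "line_times X = {case_option t x | t x. x \<in> X}"

definition regular_Ga_action ::
    "'v set \<Rightarrow> ('v \<Rightarrow> 'a::field) set \<Rightarrow> ('a \<Rightarrow> ('v \<Rightarrow> 'a) \<Rightarrow> ('v \<Rightarrow> 'a)) \<Rightarrow> bool" where
  "regular_Ga_action V X \<alpha> \<longleftrightarrow>
     regular_map (insert None (Some ` V)) (line_times X) V X
       (\<lambda>y. \<alpha> (y None) (\<lambda>v. y (Some v))) \<and>
     (\<forall>x\<in>X. \<alpha> 0 x = x) \<and>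
     (\<forall>s t. \<forall>x\<in>X. \<alpha> (s + t) x = \<alpha> s (\<alpha> t x))"

text \<open>Rigidity is a notion for irreducible \<open>X\<close>; irreducibility is not part of the predicate.\<close>

definition rigid :: "'v set \<Rightarrow> ('v \<Rightarrow> 'a::field) set \<Rightarrow> bool" where
  "rigid V X \<longleftrightarrow>
     \<not> (\<exists>\<alpha>. regular_Ga_action V X \<alpha> \<and> (\<exists>t. \<exists>x\<in>X. \<alpha> t x \<noteq> x))"

text \<open>A trinomial is given by the block sizes \<open>n i\<close> and the exponents \<open>l i j\<close>; only the
  values at \<open>i < 3\<close> and \<open>1 \<le> j \<le> n i\<close> matter. The pair \<open>(i, j)\<close> stands for the
  variable \<open>T\<^sub>i\<^sub>j\<close>.\<close>

definition trinomial_data :: "(nat \<Rightarrow> nat) \<Rightarrow> (nat \<Rightarrow> nat \<Rightarrow> nat) \<Rightarrow> bool" where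
  "trinomial_data n l \<longleftrightarrow> (\<forall>i<3. n i > 0 \<and> (\<forall>j\<in>{1..n i}. l i j > 0))"

definition trinomial_vars :: "(nat \<Rightarrow> nat) \<Rightarrow> (nat \<times> nat) set" where
  "trinomial_vars n = (SIGMA i:{..<3}. {1..n i})"

definition trinomial ::
    "(nat \<Rightarrow> nat) \<Rightarrow> (nat \<Rightarrow> nat \<Rightarrow> nat) \<Rightarrow> (nat \<times> nat, 'a::comm_ring_1) mpoly" where
  "trinomial n l = (\<Sum>i<3. \<Prod>j=1..n i. mpoly_var (i, j) ^ l i j)"

definition no_linear_term :: "(nat \<Rightarrow> nat) \<Rightarrow> (nat \<Rightarrow> nat \<Rightarrow> nat) \<Rightarrow> bool" where
  "no_linear_term n l \<longleftrightarrow> (\<forall>i<3. n i * l i 1 > 1)"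

end

theory Submission
  imports
    Defs
    "HOL-Library.Product_Lexorder"
    "HOL-Computational_Algebra.Polynomial_FPS"
begin

text \<open>
  Derivations of \<open>K[X]\<close> are represented by polynomial vector fields modulo the polynomials
  vanishing on \<open>X\<close>. The torus of weights \<open>w\<close> with \<open>\<Sum>\<^sub>j l\<^sub>i\<^sub>j w\<^sub>i\<^sub>j\<close> independent of \<open>i\<close> acts on the
  trinomial hypersurface. An isomorphism carries the Euler derivations of the torus of \<open>g\<close> to
  locally finite derivations of \<open>K[X]\<close>, \<open>X = {f = 0}\<close>. With respect to any weight of the torus
  of \<open>f\<close>, the extreme components of nonzero degree of a locally finite derivation are locally
  nilpotent, hence zero by rigidity. So these derivations have degree zero for the whole torus
  of \<open>f\<close>, and comparing monomials they multiply each variable by a scalar, unless two blocks are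
  single squares; but \<open>x\<^sup>2 + y\<^sup>2 + h(z) = 0\<close> is not rigid. Therefore the two gradings
  correspond to each other and the isomorphism is given by homogeneous polynomials. Their linear
  parts are mutually inverse matrices, and since trinomials without linear terms vanish to second
  order at the origin, this yields a weight preserving bijection of the variables. The weights
  determine the blocks and the exponents up to a common factor, and the factor is 1 because
  \<open>f\<close> and \<open>g\<close> have the same weight.
\<close>

text \<open>The coordinate ring is never formed: functions on \<open>X\<close> are equal if
  \<open>vanishes X (p - q)\<close>. Nor is the ideal of a trinomial hypersurface determined in
  general. Its role is taken by a degree bound: a polynomial that vanishes on the hypersurface is
  zero once its degree in some variable \<open>v\<close> is below \<open>L v\<close>. Hence
  representatives with the weights of a variable are unique, and linear parts at the origin are well
  defined. Rigidity is assumed for one hypersurface only, so gradings are at first transported in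
  one direction; that every weight of the torus of \<open>f\<close> is reached follows later, once
  the exponents are known to be proportional. Two single squares are an obstacle because the
  rotation \<open>u -> v\<close>, \<open>v -> -u\<close> annihilates \<open>u^2 + v^2\<close> and
  has degree zero for the whole torus without being diagonal. For other exponents the corresponding
  terms cannot cancel. All comparisons use weights supported on one variable of each block.\<close>

abbreviation "keys \<equiv> Poly_Mapping.keys"
abbreviation "lookup \<equiv> Poly_Mapping.lookup"
abbreviation "single \<equiv> Poly_Mapping.single"

section \<open>Ring homomorphisms and induction on polynomials\<close>

locale comm_ring_hom =
  fixes h :: "'a::comm_ring_1 \<Rightarrow> 'b::comm_ring_1"
  assumes hom_one: "h 1 = 1"
    and hom_add: "h (x + y) = h x + h y"
    and hom_mult: "h (x * y) = h x * h y"
begin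

lemma hom_zero: "h 0 = 0"
  using hom_add[of 0 0] by simp

lemma hom_minus: "h (x - y) = h x - h y"
  using hom_add[of "x - y" y] by (simp add: algebra_simps)

lemma hom_sum: "h (sum g A) = (\<Sum>x\<in>A. h (g x))"
  by (induction A rule: infinite_finite_induct) (auto simp: hom_zero hom_add)

lemma hom_prod: "h (prod g A) = (\<Prod>x\<in>A. h (g x))"
  by (induction A rule: infinite_finite_induct) (auto simp: hom_one hom_mult)

lemma hom_power: "h (x ^ k) = h x ^ k"
  by (induction k) (auto simp: hom_one hom_mult)

end

lemma monomial_induct [consumes 1, case_names zero plus]:
  fixes m :: "'v \<Rightarrow>\<^sub>0 nat"
  assumes "keys m \<subseteq> V" "P 0"
    and step: "\<And>m v. P m \<Longrightarrow> keys m \<subseteq> V \<Longrightarrow> v \<in> V \<Longrightarrow> P (m + single v 1)"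
  shows "P m"
  using assms(1)
proof (induction "\<Sum>v\<in>keys m. lookup m v" arbitrary: m rule: less_induct)
  case less
  show ?case
  proof (cases "m = 0")
    case True
    then show ?thesis using assms(2) by simp
  next
    case False
    then have "keys m \<noteq> {}" by simp
    then obtain v where v: "v \<in> keys m" by blast
    define m' where "m' = m - single v 1"
    have m: "m = m' + single v 1"
      using v by (intro poly_mapping_eqI)
        (auto simp: m'_def lookup_add lookup_minus lookup_single when_def in_keys_iff)
    have sub: "keys m' \<subseteq> keys m"
      by (auto simp: m lookup_add in_keys_iff)
    have "(\<Sum>u\<in>keys m'. lookup m' u) = (\<Sum>u\<in>keys m. lookup m' u)"
      using sub by (intro sum.mono_neutral_left) (auto simp: in_keys_iff)
    also have "\<dots> < (\<Sum>u\<in>keys m. lookup m u)"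
      using v by (intro sum_strict_mono_ex1)
        (auto simp: m lookup_add lookup_single when_def intro!: bexI[of _ v])
    finally have "P m'" using less sub by blast
    then show ?thesis
      using step[of m' v] v sub less.prems unfolding m by blast
  qed
qed

lemma mpoly_sum_monomials:
  fixes p :: "('v, 'a::comm_ring_1) mpoly"
  shows   "p = (\<Sum>m\<in>keys p. single m (lookup p m))"
  by (intro poly_mapping_eqI)
    (auto simp: lookup_sum lookup_single when_def in_keys_iff sum.If_cases
      intro!: sum.neutral split: if_splits)

lemma mpoly_induct_single [case_names single add zero]:
  fixes p :: "('v, 'a::comm_ring_1) mpoly"
  assumes "\<And>m c. m \<in> keys p \<Longrightarrow> P (single m c)"
    and "\<And>p q. P p \<Longrightarrow> P q \<Longrightarrow> P (p + q)" and "P 0"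
  shows "P p"
proof -
  have "P (\<Sum>m\<in>A. single m (lookup p m))" if "A \<subseteq> keys p" for A
    using finite_subset[OF that] that
    by (induction A rule: finite_induct) (use assms in auto)
  then show ?thesis using mpoly_sum_monomials[of p] by (metis order_refl)
qed

lemma single_plus_var:
  "single (m + single v 1) c = single m c * (mpoly_var v :: ('v, 'a::comm_ring_1) mpoly)"
  by (simp add: mpoly_var_def mult_single)

text \<open>The \<open>var\<close> case multiplies by a single variable of \<open>V\<close>, so
  statements about homomorphisms and derivations reduce to their product rules, and only the images
  of variables in \<open>V\<close> matter.\<close>

lemma mpoly_over_induct [consumes 1, case_names const var add]:
  fixes p :: "('v, 'a::comm_ring_1) mpoly"
  assumes p: "p \<in> mpolys_over V"
    and const: "\<And>c. P (mpoly_const c)"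
    and var: "\<And>p v. P p \<Longrightarrow> p \<in> mpolys_over V \<Longrightarrow> v \<in> V \<Longrightarrow> P (p * mpoly_var v)"
    and add: "\<And>p q. P p \<Longrightarrow> P q \<Longrightarrow> P (p + q)"
  shows "P p"
proof (induction p rule: mpoly_induct_single)
  case (single m c)
  then have "keys m \<subseteq> V" using p by (auto simp: mpolys_over_def)
  then show ?case
  proof (induction m rule: monomial_induct)
    case zero
    then show ?case using const[of c] by (simp add: mpoly_const_def)
  next
    case (plus m v)
    then have "single m c \<in> mpolys_over V" by (auto simp: mpolys_over_def)
    then show ?case using var plus by (simp only: single_plus_var)
  qed
next
  case zero
  then show ?case using const[of 0] by (simp add: mpoly_const_def)
qed (use add in auto)

lemma mpoly_induct [case_names const var add]:
  fixes p :: "('v, 'a::comm_ring_1) mpoly"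
  assumes "\<And>c. P (mpoly_const c)"
    and "\<And>p v. P p \<Longrightarrow> P (p * mpoly_var v)"
    and "\<And>p q. P p \<Longrightarrow> P q \<Longrightarrow> P (p + q)"
  shows "P p"
  by (rule mpoly_over_induct[of p UNIV]) (use assms in \<open>auto simp: mpolys_over_def\<close>)

definition monomial_eval :: "('v \<Rightarrow> 'b::comm_ring_1) \<Rightarrow> ('v \<Rightarrow>\<^sub>0 nat) \<Rightarrow> 'b" where
  "monomial_eval s m = (\<Prod>v\<in>keys m. s v ^ lookup m v)"

lemma monomial_eval_superset:
  assumes "finite A" "keys m \<subseteq> A"
  shows "monomial_eval s m = (\<Prod>v\<in>A. s v ^ lookup m v)"
  unfolding monomial_eval_def
  using assms by (intro prod.mono_neutral_left) (auto simp: in_keys_iff)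

lemma monomial_eval_zero [simp]: "monomial_eval s 0 = 1"
  by (simp add: monomial_eval_def)

lemma monomial_eval_single [simp]: "monomial_eval s (single v k) = s v ^ k"
  by (cases "k = 0") (auto simp: monomial_eval_def)

lemma monomial_eval_add: "monomial_eval s (m + m') = monomial_eval s m * monomial_eval s m'"
proof -
  let ?A = "keys m \<union> keys m'"
  have "keys (m + m') \<subseteq> ?A" by (rule Poly_Mapping.keys_add)
  then have "monomial_eval s (m + m') = (\<Prod>v\<in>?A. s v ^ lookup (m + m') v)"
    by (intro monomial_eval_superset) auto
  also have "\<dots> = monomial_eval s m * monomial_eval s m'"
    by (simp add: monomial_eval_superset[of ?A] lookup_add power_add prod.distrib)
  finally show ?thesis .
qed

context comm_ring_hom
begin

lemma extend_superset:
  assumes "finite A" "keys p \<subseteq> A"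
  shows "mpoly_extend h s p = (\<Sum>m\<in>A. h (lookup p m) * monomial_eval s m)"
  unfolding mpoly_extend_def monomial_eval_def[symmetric]
  using assms by (intro sum.mono_neutral_left) (auto simp: in_keys_iff hom_zero)

lemma extend_add: "mpoly_extend h s (p + q) = mpoly_extend h s p + mpoly_extend h s q"
proof -
  let ?A = "keys p \<union> keys q"
  have "keys (p + q) \<subseteq> ?A" by (rule Poly_Mapping.keys_add)
  then show ?thesis
    by (simp add: extend_superset[of ?A] lookup_add hom_add algebra_simps sum.distrib)
qed

lemma extend_single: "mpoly_extend h s (single m c) = h c * monomial_eval s m"
  by (subst extend_superset[of "{m}"]) auto

lemma extend_zero: "mpoly_extend h s 0 = 0"
  by (simp add: mpoly_extend_def)

lemma extend_const [simp]: "mpoly_extend h s (mpoly_const c) = h c"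
  by (simp add: mpoly_const_def extend_single)

lemma extend_var [simp]: "mpoly_extend h s (mpoly_var v) = s v"
  by (simp add: mpoly_var_def extend_single hom_one)

lemma extend_mult: "mpoly_extend h s (p * q) = mpoly_extend h s p * mpoly_extend h s q"
proof (induction p rule: mpoly_induct_single)
  case (single m c)
  show ?case
  proof (induction q rule: mpoly_induct_single)
    case (single m' c')
    then show ?case
      by (simp add: mult_single extend_single hom_mult monomial_eval_add algebra_simps)
  qed (simp_all add: extend_zero extend_add distrib_left)
qed (simp_all add: extend_zero extend_add distrib_right)

lemma extend_one: "mpoly_extend h s 1 = 1"
proof -
  have "(1 :: ('c, 'a) mpoly) = mpoly_const 1" by (simp add: mpoly_const_def)
  then show ?thesis using extend_const[of s 1] by (simp add: hom_one)
qed

text \<open>Evaluation, substitution, first-order expansion and restriction to an orbit are all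
  instances, for different coefficient maps \<open>h\<close>.\<close>

lemma comm_ring_hom_extend: "comm_ring_hom (mpoly_extend h s)"
  by unfold_locales (rule extend_one extend_add extend_mult)+

end

lemma comm_ring_hom_ident: "comm_ring_hom (\<lambda>c. c)"
  by unfold_locales auto

lemma mpoly_const_simps:
  "mpoly_const (a + b) = mpoly_const a + mpoly_const b"
  "mpoly_const (a * b) = mpoly_const a * mpoly_const b"
  "mpoly_const 0 = 0" "mpoly_const 1 = 1"
  by (simp_all add: mpoly_const_def single_add mult_single)

lemma comm_ring_hom_mpoly_const: "comm_ring_hom mpoly_const"
  by unfold_locales (auto simp: mpoly_const_simps)

lemma lookup_const_mult: "lookup (mpoly_const c * p) m = c * lookup p m"
proof (induction p rule: mpoly_induct_single)
  case (single m' c')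
  then show ?case by (auto simp: mpoly_const_def mult_single lookup_single when_def)
qed (auto simp: distrib_left lookup_add)

lemma lookup_mult_var:
  fixes p :: "('v, 'a::comm_ring_1) mpoly"
  shows "lookup (p * mpoly_var v) m =
    (if lookup m v > 0 then lookup p (m - single v 1) else 0)"
proof (induction p rule: mpoly_induct_single)
  case (single m' c)
  have "m' + single v 1 = m \<longleftrightarrow> lookup m v > 0 \<and> m' = m - single v 1"
    by (auto simp: poly_mapping_eq_iff fun_eq_iff lookup_add lookup_minus lookup_single when_def)
  then show ?case
    unfolding single_plus_var[symmetric] by (auto simp: lookup_single when_def)
qed (auto simp: distrib_right lookup_add)

subsection \<open>Evaluation and substitution\<close>

interpretation eval: comm_ring_hom "\<lambda>p. mpoly_eval p x" for x :: "'v \<Rightarrow> 'a::comm_ring_1"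
  unfolding mpoly_eval_def
  by (rule comm_ring_hom.comm_ring_hom_extend[OF comm_ring_hom_ident])

lemma eval_const [simp]: "mpoly_eval (mpoly_const c) x = c"
  and eval_var [simp]: "mpoly_eval (mpoly_var v) x = x v"
  and eval_single: "mpoly_eval (single m c) x = c * monomial_eval x m"
  by (simp_all add: mpoly_eval_def comm_ring_hom.extend_const[OF comm_ring_hom_ident]
      comm_ring_hom.extend_var[OF comm_ring_hom_ident]
      comm_ring_hom.extend_single[OF comm_ring_hom_ident])

definition mpoly_subst ::
    "('v \<Rightarrow> ('w, 'a::comm_ring_1) mpoly) \<Rightarrow> ('v, 'a) mpoly \<Rightarrow> ('w, 'a) mpoly" where
  "mpoly_subst F = mpoly_extend mpoly_const F"

interpretation subst: comm_ring_hom "mpoly_subst F"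
  for F :: "'v \<Rightarrow> ('w, 'a::comm_ring_1) mpoly"
  unfolding mpoly_subst_def
  by (rule comm_ring_hom.comm_ring_hom_extend[OF comm_ring_hom_mpoly_const])

lemma subst_const [simp]: "mpoly_subst F (mpoly_const c) = mpoly_const c"
  and subst_var [simp]: "mpoly_subst F (mpoly_var v) = F v"
  by (simp_all add: mpoly_subst_def comm_ring_hom.extend_const[OF comm_ring_hom_mpoly_const]
      comm_ring_hom.extend_var[OF comm_ring_hom_mpoly_const])

lemma subst_mpoly_var: "mpoly_subst mpoly_var p = p"
  by (induction p rule: mpoly_induct) (auto simp: subst.hom_mult subst.hom_add)

lemma subst_subst: "mpoly_subst G (mpoly_subst F p) = mpoly_subst (\<lambda>v. mpoly_subst G (F v)) p"
  by (induction p rule: mpoly_induct) (auto simp: subst.hom_mult subst.hom_add)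

lemma subst_cong:
  "p \<in> mpolys_over V \<Longrightarrow> (\<And>v. v \<in> V \<Longrightarrow> F v = G v) \<Longrightarrow> mpoly_subst F p = mpoly_subst G p"
  by (induction p rule: mpoly_over_induct) (auto simp: subst.hom_mult subst.hom_add)

lemma eval_subst: "mpoly_eval (mpoly_subst F p) x = mpoly_eval p (\<lambda>v. mpoly_eval (F v) x)"
  by (induction p rule: mpoly_induct)
    (auto simp: subst.hom_mult subst.hom_add eval.hom_mult eval.hom_add)

lemma eval_cong:
  "p \<in> mpolys_over V \<Longrightarrow> (\<And>v. v \<in> V \<Longrightarrow> x v = y v) \<Longrightarrow> mpoly_eval p x = mpoly_eval p y"
  by (induction p rule: mpoly_over_induct) (auto simp: eval.hom_mult eval.hom_add)

lemma over_const [simp]: "mpoly_const c \<in> mpolys_over V"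
  and over_zero [simp]: "0 \<in> mpolys_over V"
  and over_one [simp]: "1 \<in> mpolys_over V"
  and over_var [simp]: "v \<in> V \<Longrightarrow> mpoly_var v \<in> mpolys_over V"
  by (auto simp: mpolys_over_def mpoly_const_def mpoly_var_def split: if_splits)

lemma over_add: "p \<in> mpolys_over V \<Longrightarrow> q \<in> mpolys_over V \<Longrightarrow> p + q \<in> mpolys_over V"
  using Poly_Mapping.keys_add[of p q] by (auto simp: mpolys_over_def)

lemma over_mult: "p \<in> mpolys_over V \<Longrightarrow> q \<in> mpolys_over V \<Longrightarrow> p * q \<in> mpolys_over V"
proof -
  assume pq: "p \<in> mpolys_over V" "q \<in> mpolys_over V"
  have "keys m \<subseteq> V" if m: "m \<in> keys (p * q)" for m
  proof -
    from m keys_mult[of p q] obtain a b where "a \<in> keys p" "b \<in> keys q" "m = a + b" by blast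
    then show ?thesis using pq Poly_Mapping.keys_add[of a b] unfolding mpolys_over_def by blast
  qed
  then show ?thesis by (auto simp: mpolys_over_def)
qed

lemma over_minus: "p \<in> mpolys_over V \<Longrightarrow> q \<in> mpolys_over V \<Longrightarrow> p - q \<in> mpolys_over V"
proof -
  assume "p \<in> mpolys_over V" "q \<in> mpolys_over V"
  moreover have "keys (p - q) \<subseteq> keys p \<union> keys q"
    by (auto simp: in_keys_iff lookup_minus)
  ultimately show ?thesis by (auto simp: mpolys_over_def)
qed

lemma over_sum: "(\<And>i. i \<in> A \<Longrightarrow> g i \<in> mpolys_over V) \<Longrightarrow> sum g A \<in> mpolys_over V"
  by (induction A rule: infinite_finite_induct) (auto intro: over_add)

lemma over_prod: "(\<And>i. i \<in> A \<Longrightarrow> g i \<in> mpolys_over V) \<Longrightarrow> prod g A \<in> mpolys_over V"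
  by (induction A rule: infinite_finite_induct) (auto intro: over_mult)

lemma over_power: "p \<in> mpolys_over V \<Longrightarrow> p ^ k \<in> mpolys_over V"
  by (induction k) (auto intro: over_mult)

lemma over_subst:
  "p \<in> mpolys_over V \<Longrightarrow> (\<And>v. v \<in> V \<Longrightarrow> F v \<in> mpolys_over W) \<Longrightarrow>
    mpoly_subst F p \<in> mpolys_over W"
  by (induction p rule: mpoly_over_induct)
    (auto simp: subst.hom_mult subst.hom_add intro: over_add over_mult)

subsection \<open>Derivations\<close>

text \<open>The first-order part of the substitution of \<open>v + \<epsilon> D v\<close> for \<open>v\<close>, where \<open>\<epsilon>\<^sup>2 = 0\<close>.\<close>

definition mpoly_dual :: "('v \<Rightarrow> ('v, 'a::comm_ring_1) mpoly) \<Rightarrow> ('v, 'a) mpoly \<Rightarrow> ('v, 'a) mpoly poly" where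
  "mpoly_dual D = mpoly_extend (\<lambda>c. [:mpoly_const c:]) (\<lambda>v. [:mpoly_var v, D v:])"

definition der :: "('v \<Rightarrow> ('v, 'a::comm_ring_1) mpoly) \<Rightarrow> ('v, 'a) mpoly \<Rightarrow> ('v, 'a) mpoly" where
  "der D p = coeff (mpoly_dual D p) 1"

lemma comm_ring_hom_const_poly: "comm_ring_hom (\<lambda>c. [:mpoly_const c:])"
  by unfold_locales (auto simp: mpoly_const_simps one_pCons)

interpretation dual: comm_ring_hom "mpoly_dual D"
  for D :: "'v \<Rightarrow> ('v, 'a::comm_ring_1) mpoly"
  unfolding mpoly_dual_def
  by (rule comm_ring_hom.comm_ring_hom_extend[OF comm_ring_hom_const_poly])

lemma dual_const: "mpoly_dual D (mpoly_const c) = [:mpoly_const c:]"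
  and dual_var: "mpoly_dual D (mpoly_var v) = [:mpoly_var v, D v:]"
  by (simp_all add: mpoly_dual_def comm_ring_hom.extend_const[OF comm_ring_hom_const_poly]
      comm_ring_hom.extend_var[OF comm_ring_hom_const_poly])

lemma coeff_dual_0: "coeff (mpoly_dual D p) 0 = p"
  by (induction p rule: mpoly_induct)
    (auto simp: dual.hom_mult dual.hom_add dual_const dual_var coeff_mult_0)

lemma der_const [simp]: "der D (mpoly_const c) = 0"
  and der_var [simp]: "der D (mpoly_var v) = D v"
  and der_add: "der D (p + q) = der D p + der D q"
  by (simp_all add: der_def dual_const dual_var dual.hom_add)

text \<open>The coefficient of degree 1 of a product involves only coefficients of degrees 0 and 1,
  so the square of epsilon need not be set to zero in the target ring.\<close>

lemma der_mult: "der D (p * q) = der D p * q + p * der D q"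
  by (simp add: der_def dual.hom_mult coeff_mult coeff_dual_0)

lemma der_zero [simp]: "der D 0 = 0"
  by (simp add: der_def dual.hom_zero)

lemma der_minus: "der D (p - q) = der D p - der D q"
  by (simp add: der_def dual.hom_minus)

lemma der_sum: "der D (sum g A) = (\<Sum>x\<in>A. der D (g x))"
  by (simp add: der_def dual.hom_sum coeff_sum)

lemma der_power: "der D (p ^ Suc k) = of_nat (Suc k) * p ^ k * der D p"
  by (induction k) (auto simp: der_mult algebra_simps)

lemma der_const_mult: "der D (mpoly_const c * p) = mpoly_const c * der D p"
  by (simp add: der_mult)

lemma der_over:
  "p \<in> mpolys_over V \<Longrightarrow> (\<And>v. v \<in> V \<Longrightarrow> D v \<in> mpolys_over V) \<Longrightarrow> der D p \<in> mpolys_over V"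
  by (induction p rule: mpoly_over_induct) (auto simp: der_mult der_add intro!: over_add over_mult)

lemma der_cong:
  "p \<in> mpolys_over V \<Longrightarrow> (\<And>v. v \<in> V \<Longrightarrow> D v = D' v) \<Longrightarrow> der D p = der D' p"
  by (induction p rule: mpoly_over_induct) (auto simp: der_mult der_add)

lemma der_field_add: "der (\<lambda>v. D v + D' v) p = der D p + der D' p"
  by (induction p rule: mpoly_induct) (auto simp: der_mult der_add algebra_simps)

text \<open>Differentiating a monomial replaces one factor \<open>v\<close> by a monomial of
  \<open>D v\<close>. Adding \<open>single v 1\<close> on the left avoids truncated subtraction of
  exponents.\<close>

lemma keys_der_single:
  assumes "m' \<in> keys (der D (single m c))"
  shows "\<exists>v\<in>keys m. \<exists>a\<in>keys (D v). m' + single v 1 = m + a"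
proof -
  have "\<forall>m'\<in>keys (der D (single m c)). \<exists>v\<in>keys m. \<exists>a\<in>keys (D v). m' + single v 1 = m + a"
    using subset_UNIV[of "keys m"]
  proof (induction m rule: monomial_induct)
    case zero
    have "der D (single 0 c) = 0" using der_const[of D c] by (simp add: mpoly_const_def)
    then show ?case by simp
  next
    case (plus m u)
    show ?case
    proof
      fix m' assume "m' \<in> keys (der D (single (m + single u 1) c))"
      then consider "m' \<in> keys (der D (single m c) * mpoly_var u)"
        | "m' \<in> keys (single m c * D u)"
        unfolding single_plus_var der_mult der_var
        using Poly_Mapping.keys_add[of "der D (single m c) * mpoly_var u" "single m c * D u"]
        by blast
      then show "\<exists>v\<in>keys (m + single u 1). \<exists>a\<in>keys (D v). m' + single v 1 = m + single u 1 + a"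
      proof cases
        case 1
        then obtain b where b: "b \<in> keys (der D (single m c))" "m' = b + single u 1"
          using keys_mult[of "der D (single m c)" "mpoly_var u"]
          by (auto simp: mpoly_var_def split: if_splits)
        with plus obtain v a where va: "v \<in> keys m" "a \<in> keys (D v)" "b + single v 1 = m + a"
          by blast
        have "m' + single v 1 = (b + single v 1) + single u 1"
          by (simp add: b(2) algebra_simps)
        also have "\<dots> = m + single u 1 + a" unfolding va(3) by (simp add: algebra_simps)
        finally have "m' + single v 1 = m + single u 1 + a" .
        moreover have "v \<in> keys (m + single u 1)" using va(1) by (auto simp: in_keys_iff lookup_add)
        ultimately show ?thesis using va by blast
      next
        case 2
        then obtain a where a: "a \<in> keys (D u)" "m' = m + a"
          using keys_mult[of "single m c" "D u"] by (auto split: if_splits)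
        then have "m' + single u 1 = m + single u 1 + a" by (simp add: algebra_simps)
        moreover have "u \<in> keys (m + single u 1)" by (auto simp: in_keys_iff lookup_add)
        ultimately show ?thesis using a by blast
      qed
    qed
  qed
  then show ?thesis using assms by blast
qed

lemma keys_der:
  assumes "m' \<in> keys (der D p)"
  shows "\<exists>m\<in>keys p. \<exists>v\<in>keys m. \<exists>a\<in>keys (D v). m' + single v 1 = m + a"
proof -
  have "der D p = (\<Sum>m\<in>keys p. der D (single m (lookup p m)))"
    by (subst mpoly_sum_monomials) (rule der_sum)
  then obtain m where "m \<in> keys p" "m' \<in> keys (der D (single m (lookup p m)))"
    using assms Poly_Mapping.keys_sum[of "\<lambda>m. der D (single m (lookup p m))" "keys p"] by auto
  then show ?thesis using keys_der_single by blast
qed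

subsection \<open>Weights and homogeneous components\<close>

text \<open>Selection by an arbitrary predicate covers components for one weight, components for a
  whole family of weights, and the parts of a vector field above or below a degree.\<close>

definition mrestrict ::
    "(('v \<Rightarrow>\<^sub>0 nat) \<Rightarrow> bool) \<Rightarrow> ('v, 'a::comm_ring_1) mpoly \<Rightarrow> ('v, 'a) mpoly" where
  "mrestrict Q p = (\<Sum>m\<in>{m\<in>keys p. Q m}. single m (lookup p m))"

lemma lookup_mrestrict: "lookup (mrestrict Q p) m = (if Q m then lookup p m else 0)"
proof -
  have "lookup (mrestrict Q p) m = (\<Sum>m'\<in>{m\<in>keys p. Q m}. if m' = m then lookup p m else 0)"
    by (auto simp: mrestrict_def lookup_sum lookup_single when_def intro!: sum.cong)
  also have "\<dots> = (if Q m then lookup p m else 0)"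
    by (simp add: sum.delta in_keys_iff)
  finally show ?thesis .
qed

lemma keys_mrestrict: "keys (mrestrict Q p) = {m \<in> keys p. Q m}"
  by (auto simp: in_keys_iff lookup_mrestrict split: if_splits)

lemma mrestrict_add: "mrestrict Q (p + q) = mrestrict Q p + mrestrict Q q"
  and mrestrict_minus: "mrestrict Q (p - q) = mrestrict Q p - mrestrict Q q"
  and mrestrict_zero: "mrestrict Q 0 = 0"
  and mrestrict_mrestrict: "mrestrict Q (mrestrict R p) = mrestrict (\<lambda>m. Q m \<and> R m) p"
  by (auto intro!: poly_mapping_eqI simp: lookup_mrestrict lookup_add lookup_minus)

lemma mrestrict_id: "(\<And>m. m \<in> keys p \<Longrightarrow> Q m) \<Longrightarrow> mrestrict Q p = p"
  by (rule poly_mapping_eqI)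
    (auto simp: lookup_mrestrict not_in_keys_iff_lookup_eq_zero[symmetric])

lemma mrestrict_none: "(\<And>m. m \<in> keys p \<Longrightarrow> \<not> Q m) \<Longrightarrow> mrestrict Q p = 0"
  by (rule poly_mapping_eqI)
    (auto simp: lookup_mrestrict not_in_keys_iff_lookup_eq_zero[symmetric])

lemma mrestrict_cong: "(\<And>m. m \<in> keys p \<Longrightarrow> Q m \<longleftrightarrow> R m) \<Longrightarrow> mrestrict Q p = mrestrict R p"
  by (rule poly_mapping_eqI)
    (auto simp: lookup_mrestrict not_in_keys_iff_lookup_eq_zero[symmetric])

lemma mrestrict_split: "mrestrict Q p + mrestrict (\<lambda>m. \<not> Q m) p = p"
  by (auto intro!: poly_mapping_eqI simp: lookup_mrestrict lookup_add)

lemma over_mrestrict: "p \<in> mpolys_over V \<Longrightarrow> mrestrict Q p \<in> mpolys_over V"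
  by (auto simp: mpolys_over_def keys_mrestrict)

lemma sum_mrestrict:
  "(\<Sum>k\<in>g ` keys p. mrestrict (\<lambda>m. g m = k) p) = p"
proof (rule poly_mapping_eqI)
  fix m
  have "lookup (\<Sum>k\<in>g ` keys p. mrestrict (\<lambda>m. g m = k) p) m
    = (\<Sum>k\<in>g ` keys p. if k = g m then lookup p m else 0)"
    by (auto simp: lookup_sum lookup_mrestrict intro!: sum.cong)
  also have "\<dots> = lookup p m"
    by (auto simp: sum.delta image_iff in_keys_iff)
  finally show "lookup (\<Sum>k\<in>g ` keys p. mrestrict (\<lambda>m. g m = k) p) m = lookup p m" .
qed

text \<open>Weights take values in \<open>nat\<close> for the torus, in \<open>int\<close> when a
  grading is reversed, and in the field when the entries are eigenvalues of a derivation.\<close>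

definition weight :: "('v \<Rightarrow> 'b::comm_semiring_1) \<Rightarrow> ('v \<Rightarrow>\<^sub>0 nat) \<Rightarrow> 'b" where
  "weight w m = (\<Sum>v\<in>keys m. w v * of_nat (lookup m v))"

lemma weight_superset:
  "finite A \<Longrightarrow> keys m \<subseteq> A \<Longrightarrow> weight w m = (\<Sum>v\<in>A. w v * of_nat (lookup m v))"
  unfolding weight_def by (intro sum.mono_neutral_left) (auto simp: in_keys_iff)

lemma weight_zero [simp]: "weight w 0 = 0"
  by (simp add: weight_def)

lemma weight_single [simp]: "weight w (single v k) = w v * of_nat k"
  by (cases "k = 0") (auto simp: weight_def)

lemma weight_add: "weight w (m + m') = weight w m + weight w m'"
proof -
  let ?A = "keys m \<union> keys m'"
  have "keys (m + m') \<subseteq> ?A" by (rule Poly_Mapping.keys_add)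
  then have "weight w (m + m') = (\<Sum>v\<in>?A. w v * of_nat (lookup (m + m') v))"
    by (intro weight_superset) auto
  also have "\<dots> = weight w m + weight w m'"
    by (simp add: weight_superset[of ?A] lookup_add distrib_left sum.distrib)
  finally show ?thesis .
qed

lemma weight_of_nat: "weight (\<lambda>v. of_nat (w v)) m = of_nat (weight w m)"
  by (simp add: weight_def)

lemma weight_indicator: "weight (\<lambda>u. if u = v then 1 else 0) m = of_nat (lookup m v)"
  by (subst weight_superset[of "insert v (keys m)"])
    (auto simp: if_distrib[where f = "\<lambda>x. x * _"] sum.delta cong: if_cong)

section \<open>Vanishing functions and their homogeneous components\<close>

definition vanishes :: "('v \<Rightarrow> 'a::comm_ring_1) set \<Rightarrow> ('v, 'a) mpoly \<Rightarrow> bool" where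
  "vanishes X p \<longleftrightarrow> (\<forall>x\<in>X. mpoly_eval p x = 0)"

lemma vanishes_zero [simp]: "vanishes X 0"
  by (simp add: vanishes_def eval.hom_zero)

lemma vanishes_add: "vanishes X p \<Longrightarrow> vanishes X q \<Longrightarrow> vanishes X (p + q)"
  and vanishes_minus: "vanishes X p \<Longrightarrow> vanishes X q \<Longrightarrow> vanishes X (p - q)"
  and vanishes_mult_left: "vanishes X q \<Longrightarrow> vanishes X (p * q)"
  and vanishes_mult_right: "vanishes X p \<Longrightarrow> vanishes X (p * q)"
  by (auto simp: vanishes_def eval.hom_add eval.hom_minus eval.hom_mult)

lemma vanishes_sum: "(\<And>i. i \<in> A \<Longrightarrow> vanishes X (g i)) \<Longrightarrow> vanishes X (sum g A)"
  by (induction A rule: infinite_finite_induct) (auto intro: vanishes_add)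

lemma vanishes_cong: "vanishes X (p - q) \<Longrightarrow> vanishes X p \<longleftrightarrow> vanishes X q"
  by (auto simp: vanishes_def eval.hom_minus)

lemma vanishes_trans: "vanishes X (p - q) \<Longrightarrow> vanishes X (q - r) \<Longrightarrow> vanishes X (p - r)"
  by (auto simp: vanishes_def eval.hom_minus)

lemma vanishes_sym: "vanishes X (p - q) \<Longrightarrow> vanishes X (q - p)"
  by (auto simp: vanishes_def eval.hom_minus)

text \<open>With exponents in \<open>nat\<close> the orbit of a point is a polynomial curve in
  \<open>s\<close>, defined also at \<open>s = 0\<close>.\<close>

definition weight_stable :: "('v \<Rightarrow> 'a::comm_ring_1) set \<Rightarrow> ('v \<Rightarrow> nat) \<Rightarrow> bool" where
  "weight_stable X w \<longleftrightarrow> (\<forall>x\<in>X. \<forall>s. (\<lambda>v. s ^ w v * x v) \<in> X)"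

lemma comm_ring_hom_pCons: "comm_ring_hom (\<lambda>c. [:c:])"
  by unfold_locales (auto simp: one_pCons)

interpretation torus: comm_ring_hom
    "mpoly_extend (\<lambda>c::'a::comm_ring_1. [:c:]) (s :: 'v \<Rightarrow> 'a poly)" for s
  by (rule comm_ring_hom.comm_ring_hom_extend[OF comm_ring_hom_pCons])

lemma poly_extend: "poly (mpoly_extend (\<lambda>c. [:c:]) u p) s = mpoly_eval p (\<lambda>v. poly (u v) s)"
  by (induction p rule: mpoly_induct)
    (auto simp: torus.hom_mult torus.hom_add eval.hom_mult eval.hom_add
      comm_ring_hom.extend_const[OF comm_ring_hom_pCons]
      comm_ring_hom.extend_var[OF comm_ring_hom_pCons])

lemma monomial_eval_monom:
  "monomial_eval (\<lambda>v. monom (x v) (w v)) m = monom (monomial_eval x m) (weight w m)"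
  using subset_UNIV[of "keys m"]
  by (induction m rule: monomial_induct)
    (auto simp: monomial_eval_add weight_add mult_monom)

text \<open>Along the curve with coordinates \<open>s ^ w v * x v\<close> a polynomial becomes a
  polynomial in \<open>s\<close>, whose coefficients are the values of its homogeneous components at
  \<open>x\<close>.\<close>

lemma coeff_extend_monom:
  fixes p :: "('v, 'a::comm_ring_1) mpoly"
  shows "coeff (mpoly_extend (\<lambda>c. [:c:]) (\<lambda>v. monom (x v) (w v)) p) k
    = mpoly_eval (mrestrict (\<lambda>m. weight w m = k) p) x"
proof (induction p rule: mpoly_induct_single)
  case (single m c)
  have "mrestrict (\<lambda>m. weight w m = k) (single m c) = (if weight w m = k then single m c else 0)"
    by (auto intro!: poly_mapping_eqI simp: lookup_mrestrict lookup_single when_def)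
  then show ?case
    by (auto simp: comm_ring_hom.extend_single[OF comm_ring_hom_pCons] monomial_eval_monom
        coeff_monom eval_single eval.hom_zero)
qed (auto simp: torus.hom_add mrestrict_add eval.hom_add torus.hom_zero mrestrict_zero eval.hom_zero)

text \<open>On an orbit curve the polynomial in \<open>s\<close> has every scalar as a root; the
  field being infinite, all its coefficients are zero.\<close>

lemma vanishes_component:
  fixes p :: "('v, 'a::field_char_0) mpoly"
  assumes "vanishes X p" "weight_stable X w"
  shows "vanishes X (mrestrict (\<lambda>m. weight w m = k) p)"
  unfolding vanishes_def
proof
  fix x assume x: "x \<in> X"
  let ?q = "mpoly_extend (\<lambda>c. [:c:]) (\<lambda>v. monom (x v) (w v)) p"
  have "poly ?q s = 0" for s
  proof -
    have "(\<lambda>v. s ^ w v * x v) \<in> X" using assms(2) x by (auto simp: weight_stable_def)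
    then show ?thesis
      using assms(1) by (simp add: poly_extend poly_monom vanishes_def mult.commute)
  qed
  then have "?q = 0" by (simp add: poly_all_0_iff_0[symmetric])
  then show "mpoly_eval (mrestrict (\<lambda>m. weight w m = k) p) x = 0"
    by (simp add: coeff_extend_monom[symmetric])
qed

text \<open>\<open>T\<close> may be infinite, but finitely many of its weights decide which
  monomials of \<open>p\<close> survive, and for these the components can be taken one after
  another.\<close>

lemma vanishes_multicomponent:
  fixes p :: "('v, 'a::field_char_0) mpoly"
  assumes "vanishes X p" "\<And>w. w \<in> T \<Longrightarrow> weight_stable X w"
  shows "vanishes X (mrestrict (\<lambda>m. \<forall>w\<in>T. weight w m = k w) p)"
proof -
  have fin: "vanishes X (mrestrict (\<lambda>m. \<forall>w\<in>S. weight w m = k w) p)" if "finite S" "S \<subseteq> T" for S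
    using that
  proof (induction S rule: finite_induct)
    case empty
    then show ?case using assms by (simp add: mrestrict_id)
  next
    case (insert w S)
    then have "vanishes X (mrestrict (\<lambda>m. weight w m = k w)
        (mrestrict (\<lambda>m. \<forall>w\<in>S. weight w m = k w) p))"
      using assms(2) by (intro vanishes_component) auto
    then show ?case by (simp add: mrestrict_mrestrict)
  qed
  \<comment> \<open>One weight of \<open>T\<close> that excludes the monomial
    \<open>m\<close>.\<close>
  define bad where "bad m = (SOME w. w \<in> T \<and> weight w m \<noteq> k w)" for m
  have bad: "bad m \<in> T \<and> weight (bad m) m \<noteq> k (bad m)" if "\<not> (\<forall>w\<in>T. weight w m = k w)" for m
    using someI_ex[of "\<lambda>w. w \<in> T \<and> weight w m \<noteq> k w"] that unfolding bad_def by blast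
  let ?S = "bad ` {m\<in>keys p. \<not> (\<forall>w\<in>T. weight w m = k w)}"
  have "mrestrict (\<lambda>m. \<forall>w\<in>T. weight w m = k w) p = mrestrict (\<lambda>m. \<forall>w\<in>?S. weight w m = k w) p"
    using bad by (intro mrestrict_cong) blast
  also have "vanishes X \<dots>"
    using bad by (intro fin) auto
  finally show ?thesis .
qed

lemma weight_stable_affine_space:
  assumes "\<And>v. v \<notin> V \<Longrightarrow> w v = 0"
  shows "weight_stable (affine_space V) w"
  using assms by (auto simp: weight_stable_def affine_space_def PiE_def extensional_def)

text \<open>The weights that count the occurrences of one coordinate together isolate a monomial,
  and a monomial has value 1 at the point whose coordinates are all 1.\<close>

lemma vanishes_affine_space:
  fixes p :: "('v, 'a::field_char_0) mpoly"
  assumes "vanishes (affine_space V) p" "p \<in> mpolys_over V"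
  shows "p = 0"
proof (rule ccontr)
  assume "p \<noteq> 0"
  then have "keys p \<noteq> {}" by simp
  then obtain m where m: "m \<in> keys p" by blast
  let ?w = "\<lambda>v u. if u = v then 1 else (0::nat)"
  have "vanishes (affine_space V) (mrestrict (\<lambda>m'. \<forall>w\<in>?w ` V. weight w m' = weight w m) p)"
    using assms(1) by (intro vanishes_multicomponent) (auto intro!: weight_stable_affine_space)
  also have "mrestrict (\<lambda>m'. \<forall>w\<in>?w ` V. weight w m' = weight w m) p = single m (lookup p m)"
  proof (rule poly_mapping_eqI)
    fix m'
    have "m' = m" if "m' \<in> keys p" "\<forall>v\<in>V. lookup m' v = lookup m v"
    proof (rule poly_mapping_eqI)
      fix v
      have "v \<notin> V \<Longrightarrow> lookup m' v = 0 \<and> lookup m v = 0"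
        using that(1) m assms(2) unfolding mpolys_over_def
        by (metis (mono_tags, lifting) in_keys_iff mem_Collect_eq subsetD)
      then show "lookup m' v = lookup m v" using that by (cases "v \<in> V") auto
    qed
    then show "lookup (mrestrict (\<lambda>m'. \<forall>w\<in>?w ` V. weight w m' = weight w m) p) m' =
        lookup (single m (lookup p m)) m'"
      by (auto simp: lookup_mrestrict weight_indicator lookup_single when_def in_keys_iff)
  qed
  finally have "vanishes (affine_space V) (single m (lookup p m))" .
  moreover have "(\<lambda>v\<in>V. 1) \<in> affine_space V" by (auto simp: affine_space_def)
  moreover have "monomial_eval (\<lambda>v\<in>V. 1) m = (1::'a)"
    using m assms(2) unfolding monomial_eval_def mpolys_over_def by (intro prod.neutral) auto
  ultimately have "lookup p m = 0" by (auto simp: vanishes_def eval_single)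
  then show False using m by (simp add: in_keys_iff)
qed

unbundle fps_syntax

subsection \<open>Locally nilpotent derivations and actions of the additive group\<close>

text \<open>The value of \<open>exp (t D) p\<close> at \<open>x\<close> as a formal power series in
  \<open>t\<close>; local nilpotency will turn it into a polynomial.\<close>

definition exp_series ::
    "('v \<Rightarrow> ('v, 'a::field_char_0) mpoly) \<Rightarrow> ('v \<Rightarrow> 'a) \<Rightarrow> ('v, 'a) mpoly \<Rightarrow> 'a fps" where
  "exp_series D x p = Abs_fps (\<lambda>k. mpoly_eval ((der D ^^ k) p) x / fact k)"

lemma funpow_der_add: "(der D ^^ k) (p + q) = (der D ^^ k) p + (der D ^^ k) q"
  by (induction k) (auto simp: der_add)

lemma funpow_der_zero: "(der D ^^ k) 0 = 0"
  by (induction k) auto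

lemma exp_series_add: "exp_series D x (p + q) = exp_series D x p + exp_series D x q"
  by (auto simp: exp_series_def fps_eq_iff funpow_der_add eval.hom_add add_divide_distrib)

lemma exp_series_const: "exp_series D x (mpoly_const c) = fps_const c"
proof -
  have "(der D ^^ k) (mpoly_const c) = (if k = 0 then mpoly_const c else 0)" for k
    by (cases k) (simp_all add: funpow_Suc_right funpow_der_zero del: funpow.simps)
  then show ?thesis by (auto simp: exp_series_def fps_eq_iff eval.hom_zero)
qed

lemma fps_deriv_exp_series: "fps_deriv (exp_series D x p) = exp_series D x (der D p)"
  by (auto simp: exp_series_def fps_eq_iff funpow_Suc_right simp del: funpow.simps of_nat_Suc)

text \<open>Both sides obey the same product rule under \<open>fps_deriv\<close>, so their
  coefficients agree by induction. This replaces the Leibniz formula for powers of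
  \<open>D\<close>.\<close>

lemma exp_series_mult: "exp_series D x (p * q) = exp_series D x p * exp_series D x q"
proof (rule fps_ext)
  fix k
  show "exp_series D x (p * q) $ k = (exp_series D x p * exp_series D x q) $ k"
  proof (induction k arbitrary: p q)
    case 0
    show ?case by (simp add: exp_series_def eval.hom_mult)
  next
    case (Suc k)
    have "of_nat (Suc k) * exp_series D x (p * q) $ Suc k = exp_series D x (der D (p * q)) $ k"
      by (simp add: fps_deriv_exp_series[symmetric])
    also have "\<dots> = (exp_series D x (der D p) * exp_series D x q
        + exp_series D x p * exp_series D x (der D q)) $ k"
      by (simp add: der_mult exp_series_add Suc)
    also have "\<dots> = fps_deriv (exp_series D x p * exp_series D x q) $ k"
      by (simp add: fps_deriv_exp_series[symmetric] algebra_simps)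
    also have "\<dots> = of_nat (Suc k) * (exp_series D x p * exp_series D x q) $ Suc k"
      by (simp only: fps_deriv_nth Suc_eq_plus1)
    finally show ?case by (simp del: of_nat_Suc)
  qed
qed

text \<open>This is \<open>exp (s D) exp (t D) = exp ((s + t) D)\<close>, with \<open>a k\<close>
  the value of the \<open>k\<close>-th iterate of \<open>D\<close>. Truncation is harmless, as the
  terms with \<open>j + k \<ge> N\<close> are zero.\<close>

lemma sum_exp_binomial:
  fixes a :: "nat \<Rightarrow> 'a::field_char_0"
  assumes "\<And>k. k \<ge> N \<Longrightarrow> a k = 0"
  shows "(\<Sum>j<N. s ^ j / fact j * (\<Sum>k<N. t ^ k / fact k * a (j + k)))
    = (\<Sum>k<N. (s + t) ^ k / fact k * a k)"
proof -
  let ?g = "\<lambda>j k. s ^ j / fact j * (t ^ k / fact k * a (j + k))"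
  have "(\<Sum>j<N. s ^ j / fact j * (\<Sum>k<N. t ^ k / fact k * a (j + k)))
    = (\<Sum>(j, k)\<in>{..<N} \<times> {..<N}. ?g j k)"
    by (simp add: sum_distrib_left sum.cartesian_product)
  also have "\<dots> = (\<Sum>(j, k)\<in>{(j, k). j + k < N}. ?g j k)"
  proof (rule sum.mono_neutral_right)
    show "\<forall>i\<in>{..<N} \<times> {..<N} - {(j, k). j + k < N}. (case i of (j, k) \<Rightarrow> ?g j k) = 0"
      using assms by auto (metis not_less)
  qed auto
  also have "\<dots> = (\<Sum>k<N. \<Sum>i\<le>k. ?g i (k - i))"
    by (rule sum.triangle_reindex)
  also have "\<dots> = (\<Sum>k<N. (s + t) ^ k / fact k * a k)"
  proof (rule sum.cong[OF refl])
    fix k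
    have "(s + t) ^ k / fact k * a k = (\<Sum>i\<le>k. of_nat (k choose i) * s ^ i * t ^ (k - i) / fact k * a k)"
      by (simp add: binomial_ring sum_divide_distrib sum_distrib_right)
    also have "\<dots> = (\<Sum>i\<le>k. ?g i (k - i))"
      by (rule sum.cong[OF refl]) (simp add: binomial_fact field_simps)
    finally show "(\<Sum>i\<le>k. ?g i (k - i)) = (s + t) ^ k / fact k * a k" by simp
  qed
  finally show ?thesis .
qed

text \<open>A derivation that is locally nilpotent on \<open>X\<close> integrates to the action
  \<open>exp (t D)\<close> of the additive group. Rigidity makes this action trivial, and its
  derivative at \<open>t = 0\<close> is \<open>D\<close>.\<close>

lemma rigid_lnd_trivial:
  fixes f :: "('v, 'a::field_char_0) mpoly"
  assumes rigid: "rigid V (zero_locus V f)"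
    and "finite V" and f: "f \<in> mpolys_over V"
    and D: "\<And>v. v \<in> V \<Longrightarrow> D v \<in> mpolys_over V"
    and pres: "\<And>p. p \<in> mpolys_over V \<Longrightarrow> vanishes (zero_locus V f) p \<Longrightarrow>
      vanishes (zero_locus V f) (der D p)"
    and nil: "\<And>v. v \<in> V \<Longrightarrow> \<exists>N. vanishes (zero_locus V f) ((der D ^^ N) (mpoly_var v))"
    and v: "v \<in> V"
  shows "vanishes (zero_locus V f) (D v)"
proof -
  define X where "X = zero_locus V f"
  have over: "(der D ^^ k) p \<in> mpolys_over V" if "p \<in> mpolys_over V" for k p
    using that D by (induction k) (auto intro: der_over)
  obtain N0 where N0: "\<And>v. v \<in> V \<Longrightarrow> vanishes X ((der D ^^ N0 v) (mpoly_var v))"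
    using nil unfolding X_def by metis
  define N where "N = Max (N0 ` V)"
  have N: "vanishes X ((der D ^^ k) (mpoly_var v))" if "k \<ge> N" "v \<in> V" for k v
  proof -
    have "N0 v \<le> N" unfolding N_def using that \<open>finite V\<close> by (intro Max_ge) auto
    with that(1) have "N0 v \<le> k" by simp
    then show ?thesis
    proof (induction k rule: dec_induct)
      case base
      then show ?case using N0 that by simp
    next
      case (step k)
      then show ?case using pres over that by (simp add: X_def)
    qed
  qed
  define a where "a x p k = mpoly_eval ((der D ^^ k) p) x" for x p k
  define \<alpha> where "\<alpha> t x = (\<lambda>v\<in>V. \<Sum>k<N. t ^ k / fact k * a x (mpoly_var v) k)" for t x
  \<comment> \<open>\<open>P x p\<close> is the function \<open>p\<close> along the orbit of
    \<open>x\<close>, as a polynomial in the time \<open>t\<close>.\<close>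
  define P where "P x = mpoly_extend (\<lambda>c. [:c:])
    (\<lambda>v. \<Sum>k<N. monom (a x (mpoly_var v) k / fact k) k)" for x
  interpret P: comm_ring_hom "P x" for x
    unfolding P_def by (rule torus.comm_ring_hom_axioms)
  have poly_P: "poly (P x p) t = mpoly_eval p (\<alpha> t x)" if "p \<in> mpolys_over V" for x p t
    unfolding P_def poly_extend
    by (rule eval_cong[OF that]) (auto simp: \<alpha>_def poly_sum poly_monom mult.commute)
  \<comment> \<open>Both sides are additive and multiplicative in \<open>p\<close>, so comparing
    them on constants and variables is enough.\<close>
  have "fps_of_poly (P x p) = exp_series D x p" if "p \<in> mpolys_over V" and x: "x \<in> X" for x p
    using that(1)
  proof (induction p rule: mpoly_over_induct)
    case (const c)
    then show ?case
      by (simp add: P_def comm_ring_hom.extend_const[OF comm_ring_hom_pCons] exp_series_const)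
  next
    case (var p v)
    have "fps_of_poly (P x (mpoly_var v)) = exp_series D x (mpoly_var v)"
    proof (rule fps_ext)
      fix k
      have "k \<ge> N \<Longrightarrow> a x (mpoly_var v) k = 0"
        using N[of k v] var x by (auto simp: vanishes_def a_def)
      then show "fps_of_poly (P x (mpoly_var v)) $ k = exp_series D x (mpoly_var v) $ k"
        by (auto simp: P_def comm_ring_hom.extend_var[OF comm_ring_hom_pCons] exp_series_def
            coeff_sum a_def[symmetric] sum.delta not_less)
    qed
    with var show ?case by (simp add: P.hom_mult fps_of_poly_mult exp_series_mult)
  next
    case (add p q)
    then show ?case by (simp add: P.hom_add fps_of_poly_add exp_series_add)
  qed
  then have coeff_P: "coeff (P x p) k = a x p k / fact k" if "p \<in> mpolys_over V" "x \<in> X" for x p k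
    using that by (metis (no_types, lifting) a_def exp_series_def fps_nth_Abs_fps fps_of_poly_nth)
  have in_X: "\<alpha> t x \<in> X" if x: "x \<in> X" for t x
  proof -
    have "a x f k = 0" for k
    proof -
      have "vanishes X f" by (simp add: vanishes_def X_def zero_locus_def)
      then have "vanishes X ((der D ^^ k) f)"
        using pres over[OF f] by (induction k) (auto simp: X_def)
      then show ?thesis using x by (simp add: a_def vanishes_def)
    qed
    then have "P x f = 0" using coeff_P[OF f x] by (intro poly_eqI) simp
    then have "mpoly_eval f (\<alpha> t x) = 0" using poly_P[OF f, of x t] by simp
    then show ?thesis by (auto simp: X_def zero_locus_def affine_space_def \<alpha>_def)
  qed
  have action_zero: "\<alpha> 0 x = x" if x: "x \<in> X" for x
  proof
    fix v
    show "\<alpha> 0 x v = x v"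
    proof (cases "v \<in> V")
      case True
      have "\<alpha> 0 x v = poly (P x (mpoly_var v)) 0" using poly_P[of "mpoly_var v"] True by simp
      also have "\<dots> = x v" using coeff_P[of "mpoly_var v" x 0] True x by (simp add: poly_0_coeff_0 a_def)
      finally show ?thesis .
    next
      case False
      then show ?thesis using x
        by (auto simp: \<alpha>_def X_def zero_locus_def affine_space_def PiE_def extensional_def)
    qed
  qed
  have action_add: "\<alpha> (s + t) x = \<alpha> s (\<alpha> t x)" if x: "x \<in> X" for s t x
  proof
    fix v
    show "\<alpha> (s + t) x v = \<alpha> s (\<alpha> t x) v"
    proof (cases "v \<in> V")
      case True
      let ?T = "mpoly_var v :: ('v, 'a) mpoly"
      have zero: "a x ?T k = 0" if "k \<ge> N" for k
        using N[OF that True] x by (simp add: vanishes_def a_def)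
      \<comment> \<open>Taylor expansion along the orbit: the \<open>j\<close>-th iterate at the
        point \<open>exp (t D) x\<close> is the exponential series that starts from the
        \<open>j\<close>-th iterate at \<open>x\<close>. This is the group law.\<close>
      have "a (\<alpha> t x) ?T j = (\<Sum>k<N. t ^ k / fact k * a x ?T (j + k))" for j
      proof -
        have o: "(der D ^^ j) ?T \<in> mpolys_over V" using over True by simp
        have c: "coeff (P x ((der D ^^ j) ?T)) k = a x ?T (j + k) / fact k" for k
          using coeff_P[OF o x, of k] by (simp add: a_def funpow_add[symmetric] add.commute flip: comp_apply[of "der D ^^ k"])
        have "a (\<alpha> t x) ?T j = poly (P x ((der D ^^ j) ?T)) t"
          using poly_P[OF o] by (simp add: a_def)
        also have "P x ((der D ^^ j) ?T) = (\<Sum>k<N. monom (a x ?T (j + k) / fact k) k)"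
          by (rule poly_eqI) (auto simp: c coeff_sum sum.delta not_less zero)
        finally show ?thesis by (simp add: poly_sum poly_monom mult.commute)
      qed
      then have "\<alpha> s (\<alpha> t x) v =
          (\<Sum>j<N. s ^ j / fact j * (\<Sum>k<N. t ^ k / fact k * a x ?T (j + k)))"
        using True by (simp add: \<alpha>_def)
      also have "\<dots> = \<alpha> (s + t) x v"
        using True sum_exp_binomial[of N "a x ?T"] zero by (simp add: \<alpha>_def)
      finally show ?thesis ..
    qed (simp add: \<alpha>_def)
  qed
  have "regular_map (insert None (Some ` V)) (line_times X) V X (\<lambda>y. \<alpha> (y None) (\<lambda>v. y (Some v)))"
    unfolding regular_map_def
  proof (intro conjI ballI)
    fix y assume "y \<in> line_times X"
    then show "\<alpha> (y None) (\<lambda>v. y (Some v)) \<in> X" by (auto simp: line_times_def in_X)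
  next
    fix u assume u: "u \<in> V"
    define p :: "('v option, 'a) mpoly" where
      "p = (\<Sum>k<N. mpoly_const (1 / fact k) * mpoly_var None ^ k
          * mpoly_subst (\<lambda>v. mpoly_var (Some v)) ((der D ^^ k) (mpoly_var u)))"
    show "\<exists>p\<in>mpolys_over (insert None (Some ` V)). \<forall>y\<in>line_times X.
        \<alpha> (y None) (\<lambda>v. y (Some v)) u = mpoly_eval p y"
    proof (intro bexI[of _ p] ballI)
      show "p \<in> mpolys_over (insert None (Some ` V))"
        unfolding p_def using over[of "mpoly_var u"] u
        by (intro over_sum over_mult over_power over_subst[where V = V]) auto
      show "\<alpha> (y None) (\<lambda>v. y (Some v)) u = mpoly_eval p y" for y
        using u by (simp add: \<alpha>_def p_def a_def eval.hom_sum eval.hom_mult eval.hom_power eval_subst)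
    qed
  qed
  then have "regular_Ga_action V X \<alpha>"
    using action_zero action_add by (auto simp: regular_Ga_action_def)
  with rigid have fixed: "\<alpha> t x = x" if "x \<in> X" for t x
    using that unfolding rigid_def X_def by blast
  \<comment> \<open>The orbit polynomial of \<open>v\<close> is constant, so its linear coefficient,
    which is the value of \<open>D v\<close>, is zero.\<close>
  have "mpoly_eval (D v) x = 0" if x: "x \<in> X" for x
  proof -
    have "poly (P x (mpoly_var v) - [:x v:]) t = 0" for t
      using poly_P[of "mpoly_var v" x t] v fixed[OF x] by simp
    then have "P x (mpoly_var v) - [:x v:] = 0" by (simp add: poly_all_0_iff_0[symmetric])
    then have "coeff (P x (mpoly_var v)) 1 = coeff [:x v:] 1" by simp
    then show ?thesis using coeff_P[of "mpoly_var v" x 1] v x by (simp add: a_def)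
  qed
  then show ?thesis by (auto simp: vanishes_def X_def)
qed

unbundle no fps_syntax

section \<open>Locally finite derivations on a rigid hypersurface\<close>

lemma vanishes_der:
  "p \<in> mpolys_over V \<Longrightarrow> (\<And>v. v \<in> V \<Longrightarrow> vanishes X (D v)) \<Longrightarrow> vanishes X (der D p)"
  by (induction p rule: mpoly_over_induct)
    (auto simp: der_mult der_add intro!: vanishes_add intro: vanishes_mult_left vanishes_mult_right)

text \<open>The family of weights is indexed because it will be applied to weights
  \<open>\<kappa> u\<close> with degrees that depend on \<open>u\<close>. Again only finitely many
  indices matter for the monomials of \<open>p\<close>.\<close>

lemma vanishes_homogeneous_part:
  fixes p :: "('v, 'a::field_char_0) mpoly" and w :: "'i \<Rightarrow> 'v \<Rightarrow> nat"
  assumes stable: "\<And>i. i \<in> T \<Longrightarrow> weight_stable X (w i)"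
    and hom: "\<And>i. i \<in> T \<Longrightarrow> vanishes X (p - mrestrict (\<lambda>m. weight (w i) m = k i) p)"
  shows "vanishes X (p - mrestrict (\<lambda>m. \<forall>i\<in>T. weight (w i) m = k i) p)"
proof -
  have fin: "vanishes X (p - mrestrict (\<lambda>m. \<forall>i\<in>S. weight (w i) m = k i) p)"
    if "finite S" "S \<subseteq> T" for S
    using that
  proof (induction S rule: finite_induct)
    case empty
    then show ?case by (simp add: mrestrict_id)
  next
    case (insert i S)
    let ?R = "mrestrict (\<lambda>m. weight (w i) m = k i)"
    let ?p = "mrestrict (\<lambda>m. \<forall>i\<in>S. weight (w i) m = k i) p"
    have "vanishes X (?R (p - ?p))"
      using insert stable by (intro vanishes_component) auto
    \<comment> \<open>The error of restricting by \<open>i\<close> and the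
      \<open>i\<close>-component of the earlier error add up to the error of restricting by
      both.\<close>
    then have "vanishes X (p - ?R p + ?R (p - ?p))"
      using insert hom by (intro vanishes_add) auto
    also have "p - ?R p + ?R (p - ?p) = p - mrestrict (\<lambda>m. \<forall>i\<in>insert i S. weight (w i) m = k i) p"
      by (simp add: mrestrict_minus mrestrict_mrestrict)
    finally show ?case .
  qed
  define bad where "bad m = (SOME i. i \<in> T \<and> weight (w i) m \<noteq> k i)" for m
  have bad: "bad m \<in> T \<and> weight (w (bad m)) m \<noteq> k (bad m)"
    if "\<not> (\<forall>i\<in>T. weight (w i) m = k i)" for m
    using someI_ex[of "\<lambda>i. i \<in> T \<and> weight (w i) m \<noteq> k i"] that unfolding bad_def by blast
  let ?S = "bad ` {m\<in>keys p. \<not> (\<forall>i\<in>T. weight (w i) m = k i)}"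
  have "mrestrict (\<lambda>m. \<forall>i\<in>T. weight (w i) m = k i) p = mrestrict (\<lambda>m. \<forall>i\<in>?S. weight (w i) m = k i) p"
    using bad by (intro mrestrict_cong) blast
  moreover have "vanishes X (p - mrestrict (\<lambda>m. \<forall>i\<in>?S. weight (w i) m = k i) p)"
    using bad by (intro fin) auto
  ultimately show ?thesis by simp
qed

lemma vanishes_off_component:
  assumes "\<And>k. k \<noteq> k0 \<Longrightarrow> vanishes X (mrestrict (\<lambda>m. weight w m = k) p)"
  shows "vanishes X (p - mrestrict (\<lambda>m. weight w m = k0) p)"
proof -
  let ?R = "mrestrict (\<lambda>m. weight w m \<noteq> k0) p"
  have "vanishes X (mrestrict (\<lambda>m. weight w m = k) ?R)" if "k \<in> weight w ` keys ?R" for k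
  proof -
    have k: "k \<noteq> k0" using that by (auto simp: keys_mrestrict)
    then have "mrestrict (\<lambda>m. weight w m = k) ?R = mrestrict (\<lambda>m. weight w m = k) p"
      unfolding mrestrict_mrestrict by (intro mrestrict_cong) auto
    then show ?thesis using assms[OF k] by simp
  qed
  then have "vanishes X (\<Sum>k\<in>weight w ` keys ?R. mrestrict (\<lambda>m. weight w m = k) ?R)"
    by (intro vanishes_sum)
  then have "vanishes X ?R" by (simp only: sum_mrestrict)
  also have "?R = p - mrestrict (\<lambda>m. weight w m = k0) p"
    by (rule poly_mapping_eqI) (auto simp: lookup_mrestrict lookup_minus)
  finally show ?thesis .
qed

lemma weight_keys_der:
  fixes w :: "'v \<Rightarrow> 'b::comm_ring_1"
  assumes "b \<in> keys (der D p)"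
  shows "\<exists>m\<in>keys p. \<exists>v\<in>keys m. \<exists>a\<in>keys (D v). weight w b = weight w m + (weight w a - w v)"
proof -
  obtain m v a where *: "m \<in> keys p" "v \<in> keys m" "a \<in> keys (D v)" "b + single v 1 = m + a"
    using keys_der[OF assms] by blast
  then have "weight w (b + single v 1) = weight w (m + a)" by simp
  then have "weight w b = weight w m + (weight w a - w v)"
    by (simp add: weight_add algebra_simps eq_diff_eq)
  with * show ?thesis by blast
qed

text \<open>The part of the vector field that does not raise the weight by \<open>e\<close> never
  leads from weight \<open>k\<close> to weight \<open>k + e\<close>.\<close>

lemma der_homogeneous_component:
  fixes w :: "'v \<Rightarrow> 'b::comm_ring_1"
  assumes "\<And>m. m \<in> keys p \<Longrightarrow> weight w m = k"
  shows "der (\<lambda>v. mrestrict (\<lambda>a. weight w a = w v + e) (D v)) p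
    = mrestrict (\<lambda>m. weight w m = k + e) (der D p)"
proof -
  let ?D1 = "\<lambda>v. mrestrict (\<lambda>a. weight w a = w v + e) (D v)"
  let ?D2 = "\<lambda>v. mrestrict (\<lambda>a. \<not> weight w a = w v + e) (D v)"
  have D: "der D p = der ?D1 p + der ?D2 p"
    unfolding der_field_add[symmetric] by (simp add: mrestrict_split)
  have 1: "weight w b = k + e" if "b \<in> keys (der ?D1 p)" for b
    using weight_keys_der[OF that, of w] assms by (auto simp: keys_mrestrict)
  have 2: "weight w b \<noteq> k + e" if b: "b \<in> keys (der ?D2 p)" for b
  proof -
    obtain m v a where "m \<in> keys p" "a \<in> keys (?D2 v)" "weight w b = weight w m + (weight w a - w v)"
      using weight_keys_der[OF b, of w] by blast
    moreover have "weight w a - w v \<noteq> e" if "weight w a \<noteq> w v + e"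
      using that by (metis add.commute diff_add_cancel)
    ultimately show ?thesis using assms by (simp add: keys_mrestrict)
  qed
  show ?thesis
    unfolding D mrestrict_add 
    using mrestrict_id[of "der ?D1 p" "\<lambda>m. weight w m = k + e", OF 1]
      mrestrict_none[of "der ?D2 p" "\<lambda>m. weight w m = k + e", OF 2] by simp
qed

text \<open>The top component of a locally finite derivation raises the weight as far as possible
  and is hence locally nilpotent.\<close>

lemma rigid_top_component:
  fixes f :: "('v, 'a::field_char_0) mpoly" and w :: "'v \<Rightarrow> int"
  assumes rigid: "rigid V (zero_locus V f)" and "finite V" and f: "f \<in> mpolys_over V"
    and D: "\<And>v. v \<in> V \<Longrightarrow> D v \<in> mpolys_over V"
    and pres: "\<And>p. p \<in> mpolys_over V \<Longrightarrow> vanishes (zero_locus V f) p \<Longrightarrow>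
      vanishes (zero_locus V f) (der D p)"
    and "finite K" and locfin: "\<And>v N. v \<in> V \<Longrightarrow>
      \<exists>q. keys q \<subseteq> K \<and> vanishes (zero_locus V f) ((der D ^^ N) (mpoly_var v) - q)"
    and comp: "\<And>p k. vanishes (zero_locus V f) p \<Longrightarrow>
      vanishes (zero_locus V f) (mrestrict (\<lambda>m. weight w m = k) p)"
    and v: "v \<in> V" and e: "e > 0"
  shows "vanishes (zero_locus V f) (mrestrict (\<lambda>a. weight w a = w v + e) (D v))"
proof (rule ccontr)
  assume nv: "\<not> ?thesis"
  define X where "X = zero_locus V f"
  define c where "c v e = mrestrict (\<lambda>a. weight w a = w v + e) (D v)" for v e
  \<comment> \<open>The positive degrees in which \<open>D\<close> is nonzero on \<open>X\<close>;
    there are finitely many, since each \<open>D v\<close> has finitely many monomials.\<close>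
  define bad where "bad = {e. e > 0 \<and> (\<exists>v\<in>V. \<not> vanishes X (c v e))}"
  have "bad \<subseteq> (\<Union>v\<in>V. (\<lambda>a. weight w a - w v) ` keys (D v))"
  proof
    fix e assume "e \<in> bad"
    then obtain v where "v \<in> V" "\<not> vanishes X (c v e)" by (auto simp: bad_def)
    moreover from this have "c v e \<noteq> 0" by (metis vanishes_zero)
    moreover from this have "keys (c v e) \<noteq> {}" by simp
    ultimately show "e \<in> (\<Union>v\<in>V. (\<lambda>a. weight w a - w v) ` keys (D v))"
      by (force simp: c_def keys_mrestrict)
  qed
  then have fin: "finite bad" using \<open>finite V\<close> by (rule finite_subset[OF _ finite_UN_I]) auto
  have ne: "bad \<noteq> {}" using nv v e by (auto simp: bad_def c_def X_def)
  define M where "M = Max bad"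
  have M: "M \<in> bad" using fin ne by (simp add: M_def)
  have above: "vanishes X (c v e)" if "v \<in> V" "e > M" for v e
    using that M Max_ge[OF fin, of e] by (force simp: bad_def M_def)
  define T where "T v = c v M" for v
  define L where "L v = mrestrict (\<lambda>a. weight w a < w v + M) (D v)" for v
  \<comment> \<open>The part above the maximal degree \<open>M\<close> may be nonzero as a
    polynomial, but it vanishes on \<open>X\<close>.\<close>
  define H where "H v = mrestrict (\<lambda>a. weight w a > w v + M) (D v)" for v
  have D_split: "D v = T v + L v + H v" for v
    by (rule poly_mapping_eqI) (auto simp: T_def L_def H_def c_def lookup_mrestrict lookup_add)
  have der_split: "der D p = der T p + der L p + der H p" for p
    unfolding der_field_add[symmetric] D_split[symmetric] by simp
  have T_over: "T v \<in> mpolys_over V" and L_over: "L v \<in> mpolys_over V" if "v \<in> V" for v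
    using D that by (auto simp: T_def L_def c_def intro: over_mrestrict)
  have H: "vanishes X (H v)" if "v \<in> V" for v
  proof -
    have "vanishes X (mrestrict (\<lambda>m. weight w m = k) (H v))" if "k \<in> weight w ` keys (H v)" for k
    proof -
      have "k > w v + M" using that by (auto simp: H_def keys_mrestrict)
      then have "mrestrict (\<lambda>m. weight w m = k) (H v) = c v (k - w v)"
        unfolding H_def c_def mrestrict_mrestrict by (intro mrestrict_cong) auto
      then show ?thesis using above[OF \<open>v \<in> V\<close>, of "k - w v"] \<open>k > w v + M\<close> by simp
    qed
    then have "vanishes X (\<Sum>k\<in>weight w ` keys (H v). mrestrict (\<lambda>m. weight w m = k) (H v))"
      by (intro vanishes_sum)
    then show ?thesis by (simp add: sum_mrestrict)
  qed
  \<comment> \<open>The components of a vanishing polynomial vanish, and on a homogeneous one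
    \<open>T\<close> acts as a component of \<open>D\<close>.\<close>
  have T_pres: "vanishes X (der T p)" if "p \<in> mpolys_over V" "vanishes X p" for p
  proof -
    have "vanishes X (der T (mrestrict (\<lambda>m. weight w m = k) p))" for k
    proof -
      have "der T (mrestrict (\<lambda>m. weight w m = k) p)
          = mrestrict (\<lambda>m. weight w m = k + M) (der D (mrestrict (\<lambda>m. weight w m = k) p))"
        unfolding T_def c_def by (rule der_homogeneous_component) (auto simp: keys_mrestrict)
      then show ?thesis
        using that comp pres by (simp add: X_def over_mrestrict)
    qed
    then have "vanishes X (\<Sum>k\<in>weight w ` keys p. der T (mrestrict (\<lambda>m. weight w m = k) p))"
      by (intro vanishes_sum)
    then show ?thesis by (simp add: der_sum[symmetric] sum_mrestrict)
  qed
  have T_nil: "\<exists>N. vanishes X ((der T ^^ N) (mpoly_var v))" if v: "v \<in> V" for v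
  proof -
    let ?t = "mpoly_var v :: ('v, 'a) mpoly"
    \<comment> \<open>Modulo \<open>X\<close>, the \<open>N\<close>-th iterate of \<open>D\<close>
      on \<open>v\<close> is that of \<open>T\<close>, of weight \<open>w v + N M\<close>, plus
      terms of smaller weight.\<close>
    have *: "\<exists>r\<in>mpolys_over V. vanishes X ((der D ^^ N) ?t - ((der T ^^ N) ?t + r)) \<and>
        (\<forall>a\<in>keys r. weight w a < w v + int N * M) \<and>
        (\<forall>a\<in>keys ((der T ^^ N) ?t). weight w a = w v + int N * M) \<and>
        (der T ^^ N) ?t \<in> mpolys_over V" for N
    proof (induction N)
      case 0
      have "weight w a = w v" if "a \<in> keys ?t" for a
        using that by (auto simp: mpoly_var_def split: if_splits)
      then show ?case using v by (intro bexI[of _ 0]) auto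
    next
      case (Suc N)
      let ?A = "(der T ^^ N) ?t"
      from Suc obtain r where r: "r \<in> mpolys_over V" "vanishes X ((der D ^^ N) ?t - (?A + r))"
        "\<And>a. a \<in> keys r \<Longrightarrow> weight w a < w v + int N * M"
        "\<And>a. a \<in> keys ?A \<Longrightarrow> weight w a = w v + int N * M" "?A \<in> mpolys_over V"
        by blast
      define r' where "r' = der L ?A + der T r + der L r"
      have o: "(der D ^^ N) ?t \<in> mpolys_over V"
        using v D by (induction N) (auto intro: der_over)
      have "vanishes X (der D ((der D ^^ N) ?t - (?A + r)))"
        unfolding X_def using r o by (intro pres over_minus over_add) (auto simp: X_def)
      moreover have "vanishes X (der H (?A + r))"
        using r H by (intro vanishes_der[where V = V]) (auto intro: over_add)
      ultimately have "vanishes X (der D ((der D ^^ N) ?t - (?A + r)) + der H (?A + r))"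
        by (rule vanishes_add)
      also have "der D ((der D ^^ N) ?t - (?A + r)) + der H (?A + r)
          = (der D ^^ Suc N) ?t - ((der T ^^ Suc N) ?t + r')"
        by (simp add: der_minus der_add der_split[of "?A"] der_split[of r] r'_def)
      finally have "vanishes X ((der D ^^ Suc N) ?t - ((der T ^^ Suc N) ?t + r'))" .
      moreover have "r' \<in> mpolys_over V"
        using r T_over L_over by (auto simp: r'_def intro!: over_add der_over)
      moreover have "weight w a < w v + int (Suc N) * M" if a: "a \<in> keys r'" for a
      proof -
        have "keys r' \<subseteq> keys (der L ?A) \<union> keys (der T r) \<union> keys (der L r)"
          unfolding r'_def using Poly_Mapping.keys_add[of "der L ?A" "der T r"]
            Poly_Mapping.keys_add[of "der L ?A + der T r" "der L r"] by blast
        then consider "a \<in> keys (der L ?A)" | "a \<in> keys (der T r)" | "a \<in> keys (der L r)"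
          using a by blast
        then show ?thesis
        proof cases
          case 1
          then show ?thesis using weight_keys_der[OF 1, of w] r(4)
            by (force simp: L_def keys_mrestrict algebra_simps)
        next
          case 2
          then show ?thesis using weight_keys_der[OF 2, of w] r(3)
            by (force simp: T_def c_def keys_mrestrict algebra_simps)
        next
          case 3
          then show ?thesis using weight_keys_der[OF 3, of w] r(3)
            by (force simp: L_def keys_mrestrict algebra_simps)
        qed
      qed
      moreover have "weight w a = w v + int (Suc N) * M" if "a \<in> keys ((der T ^^ Suc N) ?t)" for a
        using weight_keys_der[of a T ?A w] that r(4)
        by (force simp: T_def c_def keys_mrestrict algebra_simps)
      moreover have "(der T ^^ Suc N) ?t \<in> mpolys_over V"
        using r T_over by (auto intro: der_over)
      ultimately show ?case by blast
    qed
    define B where "B = Max (insert 0 (weight w ` K))"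
    have B: "weight w a \<le> B" if "a \<in> K" for a
      using that \<open>finite K\<close> by (auto simp: B_def)
    have "M > 0" using M by (simp add: bad_def)
    \<comment> \<open>Since \<open>M \<ge> 1\<close>, the weight \<open>w v + N M\<close> now
      exceeds every weight in \<open>K\<close>, so local finiteness leaves no room for the
      \<open>N\<close>-th iterate of \<open>T\<close>.\<close>
    define N where "N = nat (\<bar>B\<bar> + \<bar>w v\<bar> + 1)"
    have "int N * 1 \<le> int N * M" using \<open>M > 0\<close> by (intro mult_left_mono) auto
    then have N: "w v + int N * M > B"
      using abs_ge_self[of B] abs_ge_minus_self[of "w v"] by (simp only: N_def) linarith
    let ?A = "(der T ^^ N) ?t"
    let ?k = "w v + int N * M"
    obtain r where r: "vanishes X ((der D ^^ N) ?t - (?A + r))"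
        "\<And>a. a \<in> keys r \<Longrightarrow> weight w a < ?k" "\<And>a. a \<in> keys ?A \<Longrightarrow> weight w a = ?k"
      using *[of N] by blast
    obtain q where q: "keys q \<subseteq> K" "vanishes X ((der D ^^ N) ?t - q)"
      using locfin[OF v, of N] by (auto simp: X_def)
    have "vanishes X (?A + r - q)"
      using vanishes_trans[OF vanishes_sym[OF r(1)] q(2)] by simp
    then have "vanishes X (mrestrict (\<lambda>m. weight w m = ?k) (?A + r - q))"
      using comp by (simp add: X_def)
    also have "mrestrict (\<lambda>m. weight w m = ?k) (?A + r - q) = ?A"
    proof -
      have "mrestrict (\<lambda>m. weight w m = ?k) r = 0"
        by (rule mrestrict_none) (use r(2) in fastforce)
      moreover have "mrestrict (\<lambda>m. weight w m = ?k) q = 0"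
      proof (rule mrestrict_none)
        fix m assume "m \<in> keys q"
        then have "weight w m \<le> B" using q(1) B by blast
        then show "weight w m \<noteq> ?k" using N by linarith
      qed
      moreover have "mrestrict (\<lambda>m. weight w m = ?k) ?A = ?A" using r(3) by (rule mrestrict_id)
      ultimately show ?thesis by (simp only: mrestrict_add mrestrict_minus add_0_right diff_zero)
    qed
    finally show ?thesis by blast
  qed
  have "vanishes X (T v)" if "v \<in> V" for v
    unfolding X_def
    by (rule rigid_lnd_trivial[OF rigid \<open>finite V\<close> f T_over
          T_pres[unfolded X_def] T_nil[unfolded X_def] that])
  then show False using M by (auto simp: bad_def T_def)
qed

text \<open>The result on top components excludes the degrees above \<open>w v\<close>; applied to
  the negated weight it excludes those below, which is why it is stated for integer weights.\<close>

lemma rigid_locally_finite_homogeneous: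
  fixes f :: "('v, 'a::field_char_0) mpoly"
  assumes rigid: "rigid V (zero_locus V f)" and "finite V" and f: "f \<in> mpolys_over V"
    and D: "\<And>v. v \<in> V \<Longrightarrow> D v \<in> mpolys_over V"
    and pres: "\<And>p. p \<in> mpolys_over V \<Longrightarrow> vanishes (zero_locus V f) p \<Longrightarrow>
      vanishes (zero_locus V f) (der D p)"
    and "finite K" and locfin: "\<And>v N. v \<in> V \<Longrightarrow>
      \<exists>q. keys q \<subseteq> K \<and> vanishes (zero_locus V f) ((der D ^^ N) (mpoly_var v) - q)"
    and stable: "\<And>w. w \<in> T \<Longrightarrow> weight_stable (zero_locus V f) w"
    and v: "v \<in> V"
  shows "vanishes (zero_locus V f) (D v - mrestrict (\<lambda>a. \<forall>w\<in>T. weight w a = w v) (D v))"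
proof (rule vanishes_homogeneous_part[where w = "\<lambda>w. w", OF stable])
  fix w assume w: "w \<in> T"
  define X where "X = zero_locus V f"
  have pos: "vanishes X (mrestrict (\<lambda>a. weight w a = k) (D v))" if "k > w v" for k
  proof -
    have *: "vanishes X (mrestrict (\<lambda>m. weight (\<lambda>v. int (w v)) m = k) p)" if "vanishes X p" for p k
    proof (cases "k \<ge> 0")
      case True
      then show ?thesis
        using vanishes_component[OF that, of w "nat k"] stable[OF w]
        by (simp add: X_def weight_of_nat nat_eq_iff2 eq_commute[of _ k])
    next
      case False
      then have "mrestrict (\<lambda>m. weight (\<lambda>v. int (w v)) m = k) p = 0"
        by (intro mrestrict_none) (auto simp: weight_of_nat)
      then show ?thesis by simp
    qed
    have "vanishes (zero_locus V f) (mrestrict (\<lambda>a. weight (\<lambda>v. int (w v)) a =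
        int (w v) + (int k - int (w v))) (D v))"
      using rigid \<open>finite V\<close> f D pres \<open>finite K\<close> locfin * v that unfolding X_def
      by (intro rigid_top_component) auto
    then show ?thesis by (simp add: weight_of_nat X_def)
  qed
  have neg: "vanishes X (mrestrict (\<lambda>a. weight w a = k) (D v))" if "k < w v" for k
  proof -
    let ?w = "\<lambda>v. - int (w v)"
    have wt: "weight ?w m = - int (weight w m)" for m by (simp add: weight_def sum_negf)
    have *: "vanishes X (mrestrict (\<lambda>m. weight ?w m = k) p)" if "vanishes X p" for p k
    proof (cases "k \<le> 0")
      case True
      have "(- int n = k) = (n = nat (- k))" for n using True by auto
      then show ?thesis
        using vanishes_component[OF that, of w "nat (- k)"] stable[OF w] by (simp add: X_def wt)
    next
      case False
      then have "mrestrict (\<lambda>m. weight ?w m = k) p = 0"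
        by (intro mrestrict_none) (auto simp: wt)
      then show ?thesis by simp
    qed
    have "vanishes (zero_locus V f) (mrestrict (\<lambda>a. weight ?w a = ?w v + (int (w v) - int k)) (D v))"
      using rigid \<open>finite V\<close> f D pres \<open>finite K\<close> locfin * v that unfolding X_def
      by (intro rigid_top_component) auto
    then show ?thesis by (simp add: wt X_def)
  qed
  have "vanishes X (mrestrict (\<lambda>a. weight w a = k) (D v))" if "k \<noteq> w v" for k
    using pos[of k] neg[of k] that by (cases "k < w v") auto
  then show "vanishes (zero_locus V f) (D v - mrestrict (\<lambda>a. weight w a = w v) (D v))"
    unfolding X_def by (rule vanishes_off_component)
qed

subsection \<open>Euler derivations\<close>

text \<open>The infinitesimal generator of the torus with weights \<open>c\<close>. The entries lie
  in the coefficient ring, since they will also be eigenvalues that are not yet known to be natural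
  numbers.\<close>

definition euler :: "('v \<Rightarrow> 'a::comm_ring_1) \<Rightarrow> ('v, 'a) mpoly \<Rightarrow> ('v, 'a) mpoly" where
  "euler c = der (\<lambda>v. mpoly_const (c v) * mpoly_var v)"

lemma euler_single: "euler c (single m a) = mpoly_const (weight c m) * single m a"
  using subset_UNIV[of "keys m"]
proof (induction m rule: monomial_induct)
  case zero
  show ?case using der_const[of _ a] by (simp add: euler_def mpoly_const_def)
next
  case (plus m v)
  then show ?case
    unfolding single_plus_var euler_def
    by (simp add: der_mult weight_add mpoly_const_simps algebra_simps)
qed

lemma lookup_euler: "lookup (euler c p) m = weight c m * lookup p m"
proof (induction p rule: mpoly_induct_single)
  case (single m' a)
  then show ?case by (auto simp: euler_single lookup_const_mult lookup_single when_def)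
qed (auto simp: euler_def der_add lookup_add algebra_simps)

lemma keys_euler: "keys (euler c p) \<subseteq> keys p"
  by (auto simp: in_keys_iff lookup_euler)

lemma euler_over: "p \<in> mpolys_over V \<Longrightarrow> euler c p \<in> mpolys_over V"
  using keys_euler[of c p] by (auto simp: mpolys_over_def)

text \<open>On the component of weight \<open>k\<close> the Euler derivation is multiplication by
  \<open>k\<close>.\<close>

lemma vanishes_euler:
  fixes p :: "('v, 'a::field_char_0) mpoly"
  assumes "vanishes X p" "weight_stable X u"
  shows "vanishes X (euler (\<lambda>v. of_nat (u v)) p)"
proof -
  have "euler (\<lambda>v. of_nat (u v)) p =
      (\<Sum>k\<in>weight u ` keys p. euler (\<lambda>v. of_nat (u v)) (mrestrict (\<lambda>m. weight u m = k) p))"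
    unfolding euler_def der_sum[symmetric] sum_mrestrict ..
  also have "\<dots> = (\<Sum>k\<in>weight u ` keys p. mpoly_const (of_nat k) * mrestrict (\<lambda>m. weight u m = k) p)"
    by (intro sum.cong[OF refl] poly_mapping_eqI)
      (auto simp: lookup_euler weight_of_nat lookup_const_mult lookup_mrestrict)
  also have "vanishes X \<dots>"
    using assms by (intro vanishes_sum vanishes_mult_left vanishes_component)
  finally show ?thesis .
qed

subsection \<open>Isomorphisms of affine varieties\<close>

text \<open>\<open>F\<close> and \<open>G\<close> are polynomial representatives of the two
  pullbacks. They are inverse to each other only modulo vanishing polynomials, so that
  representatives can be exchanged later.\<close>

locale mpoly_iso =
  fixes V :: "'v set" and X :: "('v \<Rightarrow> 'a::field_char_0) set"
    and W :: "'w set" and Y :: "('w \<Rightarrow> 'a) set"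
    and F :: "'v \<Rightarrow> ('w, 'a) mpoly" and G :: "'w \<Rightarrow> ('v, 'a) mpoly"
  assumes finite_V: "finite V" and finite_W: "finite W"
    and F_over: "v \<in> V \<Longrightarrow> F v \<in> mpolys_over W"
    and G_over: "w \<in> W \<Longrightarrow> G w \<in> mpolys_over V"
    and F_pull: "p \<in> mpolys_over V \<Longrightarrow> vanishes X p \<Longrightarrow> vanishes Y (mpoly_subst F p)"
    and G_pull: "q \<in> mpolys_over W \<Longrightarrow> vanishes Y q \<Longrightarrow> vanishes X (mpoly_subst G q)"
    and GF: "p \<in> mpolys_over V \<Longrightarrow> vanishes X (mpoly_subst G (mpoly_subst F p) - p)"
    and FG: "q \<in> mpolys_over W \<Longrightarrow> vanishes Y (mpoly_subst F (mpoly_subst G q) - q)"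
begin

text \<open>The Euler derivation on \<open>Y\<close>, transported to \<open>X\<close> through the
  isomorphism and recorded by its values on the variables.\<close>

definition transfer_field :: "('w \<Rightarrow> nat) \<Rightarrow> 'v \<Rightarrow> ('v, 'a) mpoly" where
  "transfer_field u v = mpoly_subst G (euler (\<lambda>w. of_nat (u w)) (F v))"

lemma transfer_field_over: "v \<in> V \<Longrightarrow> transfer_field u v \<in> mpolys_over V"
  unfolding transfer_field_def by (intro over_subst[where V = W] euler_over F_over G_over)

text \<open>Conjugating a derivation by homomorphisms gives a derivation up to the failure of
  \<open>G\<close> after \<open>F\<close> to be the identity, which is invisible on
  \<open>X\<close>.\<close>

lemma der_transfer_field:
  assumes "p \<in> mpolys_over V"
  shows "vanishes X (der (transfer_field u) p -
    mpoly_subst G (euler (\<lambda>w. of_nat (u w)) (mpoly_subst F p)))"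
  using assms
proof (induction p rule: mpoly_over_induct)
  case (const c)
  then show ?case by (simp add: euler_def subst.hom_zero)
next
  case (var p v)
  define E :: "('w, 'a) mpoly \<Rightarrow> ('w, 'a) mpoly" where "E = euler (\<lambda>w. of_nat (u w))"
  let ?T = "mpoly_var v :: ('v, 'a) mpoly"
  let ?D = "transfer_field u"
  let ?S = "mpoly_subst G"
  \<comment> \<open>The summands are the induction hypothesis and the corrections for replacing the
    round trip of \<open>v\<close> by \<open>v\<close> and that of \<open>p\<close> by
    \<open>p\<close>.\<close>
  have "vanishes X ((der ?D p - ?S (E (mpoly_subst F p))) * ?T
      + ?S (E (mpoly_subst F p)) * (?T - ?S (F v)) + (p - ?S (mpoly_subst F p)) * ?D v)"
  proof -
    have "vanishes X (?T - ?S (F v))"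
      using GF[of ?T] var by (simp add: vanishes_sym)
    moreover have "vanishes X (p - ?S (mpoly_subst F p))"
      using GF[of p] var by (simp add: vanishes_sym)
    ultimately show ?thesis
      using var unfolding E_def
      by (intro vanishes_add vanishes_mult_right vanishes_mult_left[of X "?T - ?S (F v)"])
  qed
  also have "(der ?D p - ?S (E (mpoly_subst F p))) * ?T
      + ?S (E (mpoly_subst F p)) * (?T - ?S (F v)) + (p - ?S (mpoly_subst F p)) * ?D v
    = der ?D (p * ?T) - ?S (E (mpoly_subst F (p * ?T)))"
  proof -
    have "E (mpoly_subst F p * F v) = E (mpoly_subst F p) * F v + mpoly_subst F p * E (F v)"
      by (simp add: E_def euler_def der_mult)
    moreover have "?D v = ?S (E (F v))" by (simp add: transfer_field_def E_def)
    ultimately show ?thesis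
      by (simp add: der_mult subst.hom_mult subst.hom_add algebra_simps)
  qed
  finally show ?case by (simp add: E_def)
next
  case (add p q)
  have "vanishes X ((der (transfer_field u) p -
      mpoly_subst G (euler (\<lambda>w. of_nat (u w)) (mpoly_subst F p))) + (der (transfer_field u) q -
      mpoly_subst G (euler (\<lambda>w. of_nat (u w)) (mpoly_subst F q))))"
    using add by (rule vanishes_add)
  then show ?case
    by (simp add: der_add subst.hom_add euler_def algebra_simps)
qed

lemma transfer_field_pres:
  assumes "weight_stable Y u" "p \<in> mpolys_over V" "vanishes X p"
  shows "vanishes X (der (transfer_field u) p)"
proof -
  have "vanishes X (mpoly_subst G (euler (\<lambda>w. of_nat (u w)) (mpoly_subst F p)))"
    using assms by (intro G_pull vanishes_euler F_pull euler_over over_subst[OF _ F_over])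
  then show ?thesis using der_transfer_field[OF assms(2)] vanishes_cong by blast
qed

text \<open>Iterates of an Euler derivation on \<open>F v\<close> involve only monomials of
  \<open>F v\<close>; hence, modulo \<open>X\<close>, the iterates of the transported derivation
  stay in a finite-dimensional space.\<close>

lemma transfer_field_locally_finite:
  assumes "weight_stable Y u" and v: "v \<in> V"
  shows "vanishes X ((der (transfer_field u) ^^ N) (mpoly_var v) -
    mpoly_subst G ((euler (\<lambda>w. of_nat (u w)) ^^ N) (F v)))"
proof (induction N)
  case 0
  then show ?case using GF[of "mpoly_var v"] v by (simp add: vanishes_sym)
next
  case (Suc N)
  let ?E = "euler (\<lambda>w. of_nat (u w)) :: ('w, 'a) mpoly \<Rightarrow> _"
  let ?D = "der (transfer_field u)"
  let ?t = "(?D ^^ N) (mpoly_var v)" and ?q = "(?E ^^ N) (F v)"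
  have q: "?q \<in> mpolys_over W"
    using v by (induction N) (auto intro: F_over euler_over)
  then have s: "mpoly_subst G ?q \<in> mpolys_over V" by (rule over_subst[OF _ G_over])
  have t: "?t \<in> mpolys_over V"
    using v by (induction N) (auto intro: der_over transfer_field_over)
  have "vanishes X (?D ?t - ?D (mpoly_subst G ?q))"
    unfolding der_minus[symmetric] using Suc s t assms by (intro transfer_field_pres over_minus)
  moreover have "vanishes X (?D (mpoly_subst G ?q) -
      mpoly_subst G (?E (mpoly_subst F (mpoly_subst G ?q))))"
    by (rule der_transfer_field[OF s])
  moreover have "vanishes X (mpoly_subst G (?E (mpoly_subst F (mpoly_subst G ?q))) - mpoly_subst G (?E ?q))"
  proof -
    have "vanishes Y (?E (mpoly_subst F (mpoly_subst G ?q) - ?q))"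
      using FG[OF q] assms by (intro vanishes_euler)
    moreover have "?E (mpoly_subst F (mpoly_subst G ?q) - ?q) \<in> mpolys_over W"
      using q s F_over by (intro euler_over over_minus over_subst[OF s])
    ultimately have "vanishes X (mpoly_subst G (?E (mpoly_subst F (mpoly_subst G ?q) - ?q)))"
      by (intro G_pull)
    then show ?thesis by (simp add: euler_def der_minus subst.hom_minus)
  qed
  ultimately have "vanishes X (?D ?t - mpoly_subst G (?E ?q))"
    by (blast intro: vanishes_trans)
  then show ?case by simp
qed

lemma transfer_field_homogeneous:
  assumes X: "X = zero_locus V f" and f: "f \<in> mpolys_over V" and rigid: "rigid V X"
    and u: "weight_stable Y u" and T: "\<And>w. w \<in> T \<Longrightarrow> weight_stable X w" and v: "v \<in> V"
  shows "vanishes X (transfer_field u v -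
    mrestrict (\<lambda>a. \<forall>w\<in>T. weight w a = w v) (transfer_field u v))"
proof -
  \<comment> \<open>The monomials that arise from substituting \<open>G\<close> into the monomials
    of all \<open>F v\<close>; they contain the supports of all iterates.\<close>
  define K where "K = (\<Union>v\<in>V. \<Union>m\<in>keys (F v). keys (mpoly_subst G (single m 1)))"
  have K: "keys (mpoly_subst G q) \<subseteq> K" if "keys q \<subseteq> keys (F v)" "v \<in> V" for q v
  proof -
    have "mpoly_subst G q = (\<Sum>m\<in>keys q. mpoly_subst G (mpoly_const (lookup q m) * single m 1))"
      by (subst mpoly_sum_monomials) (simp add: subst.hom_sum mpoly_const_def mult_single)
    then have "keys (mpoly_subst G q) \<subseteq>
        (\<Union>m\<in>keys q. keys (mpoly_subst G (mpoly_const (lookup q m) * single m 1)))"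
      using Poly_Mapping.keys_sum[of "\<lambda>m. mpoly_subst G (mpoly_const (lookup q m) * single m 1)" "keys q"]
      by simp
    also have "\<dots> \<subseteq> (\<Union>m\<in>keys q. keys (mpoly_subst G (single m 1)))"
      by (auto simp: subst.hom_mult in_keys_iff lookup_const_mult)
    also have "\<dots> \<subseteq> K" using that by (auto simp: K_def)
    finally show ?thesis .
  qed
  show ?thesis
    unfolding X
  proof (rule rigid_locally_finite_homogeneous)
    show "finite K" using finite_V by (simp add: K_def)
    fix v N assume v: "v \<in> V"
    have "keys ((euler c ^^ N) (F v)) \<subseteq> keys (F v)" for c
    proof (induction N)
      case (Suc N)
      then show ?case using keys_euler[of c "(euler c ^^ N) (F v)"] by simp
    qed simp
    then show "\<exists>q. keys q \<subseteq> K \<and>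
        vanishes (zero_locus V f) ((der (transfer_field u) ^^ N) (mpoly_var v) - q)"
      using transfer_field_locally_finite[OF u v, of N] K v unfolding X by blast
  qed (use assms transfer_field_over transfer_field_pres finite_V in auto)
qed

end

subsection \<open>Trinomials\<close>

definition block_exp :: "(nat \<times> nat) set \<Rightarrow> (nat \<times> nat \<Rightarrow> nat) \<Rightarrow> nat \<Rightarrow> (nat \<times> nat) \<Rightarrow>\<^sub>0 nat" where
  "block_exp V L i = (\<Sum>v\<in>{v\<in>V. fst v = i}. single v (L v))"

definition tri :: "(nat \<times> nat) set \<Rightarrow> (nat \<times> nat \<Rightarrow> nat) \<Rightarrow> (nat \<times> nat, 'a::comm_ring_1) mpoly" where
  "tri V L = (\<Sum>i<3. single (block_exp V L i) 1)"

definition tri_locus :: "(nat \<times> nat) set \<Rightarrow> (nat \<times> nat \<Rightarrow> nat) \<Rightarrow> (nat \<times> nat \<Rightarrow> 'a::comm_ring_1) set" where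
  "tri_locus V L = zero_locus V (tri V L)"

text \<open>Weights are 0 outside \<open>V\<close> because the torus has to fix the coordinates
  there, which are \<open>undefined\<close>.\<close>

definition tri_weights :: "(nat \<times> nat) set \<Rightarrow> (nat \<times> nat \<Rightarrow> nat) \<Rightarrow> (nat \<times> nat \<Rightarrow> nat) set" where
  "tri_weights V L = {w. (\<forall>v. v \<notin> V \<longrightarrow> w v = 0) \<and> (\<exists>d. \<forall>i<3. weight w (block_exp V L i) = d)}"

lemma lookup_single_mult:
  fixes p :: "('v, 'a::comm_ring_1) mpoly"
  shows "lookup (single m c * p) (m + a) = c * lookup p a"
proof (induction p rule: mpoly_induct_single)
  case (single m' c')
  then show ?case by (auto simp: mult_single lookup_single when_def)
qed (auto simp: lookup_add distrib_left)

lemma weight_field_add: "weight (\<lambda>v. w v + w' v) m = weight w m + weight w' m"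
  by (simp add: weight_def distrib_right sum.distrib)

lemma weight_indicator_const: "weight (\<lambda>u. if u = v then c else 0) m = c * of_nat (lookup m v)"
  by (subst weight_superset[of "insert v (keys m)"])
    (auto simp: if_distrib[where f = "\<lambda>x. x * _"] sum.delta cong: if_cong)

lemma monomial_eval_scale:
  "monomial_eval (\<lambda>v. s ^ w v * x v) m = s ^ weight w m * monomial_eval x m"
  using subset_UNIV[of "keys m"]
  by (induction m rule: monomial_induct)
    (auto simp: monomial_eval_add weight_add power_add mult_ac)

text \<open>The polynomial \<open>t^n - c\<close> has no root in common with its derivative, as
  \<open>c \<noteq> 0\<close> and the characteristic is zero.\<close>

lemma card_nth_roots:
  fixes c :: "'a::{alg_closed_field, field_char_0}"
  assumes "c \<noteq> 0" "n > 0"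
  shows "card {t. t ^ n = c} = n"
proof -
  let ?p = "monom 1 n + [:-c:]"
  have deg: "degree ?p = n"
    using assms by (subst degree_add_eq_left) (auto simp: degree_monom_eq)
  then have "?p \<noteq> 0" using assms by (metis degree_0 less_irrefl)
  then obtain A where A: "size A = n" "?p = smult (lead_coeff ?p) (\<Prod>x\<in>#A. [:-x, 1:])"
    using alg_closed_imp_factorization[of ?p] deg by metis
  have roots: "poly ?p t = 0 \<longleftrightarrow> t ^ n = c" for t by (simp add: poly_monom)
  have "rsquarefree ?p"
    using assms by (auto simp: rsquarefree_roots pderiv_add pderiv_monom pderiv_pCons poly_monom)
  have "proots ?p = proots (smult (lead_coeff ?p) (\<Prod>x\<in>#A. [:-x, 1:]))"
    using A(2) by (rule arg_cong)
  also have "\<dots> = proots (\<Prod>x\<in>#A. [:-x, 1:])"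
    by (rule proots_smult[OF leading_coeff_neq_0[OF \<open>?p \<noteq> 0\<close>]])
  also have "\<dots> = A"
  proof -
    have "0 \<notin># image_mset (\<lambda>x. [:-x, 1:]) A" by auto
    from proots_prod_mset[OF this] show ?thesis
      by (simp add: image_mset.compositionality comp_def)
  qed
  finally have "proots ?p = A" .
  then have "set_mset A = {t. t ^ n = c}"
    using set_count_proots[OF \<open>?p \<noteq> 0\<close>] unfolding roots by simp
  moreover have "count A t = 1" if "t \<in># A" for t
    using \<open>rsquarefree ?p\<close> \<open>?p \<noteq> 0\<close> \<open>proots ?p = A\<close> that rsquarefree_root_order[of ?p t]
      set_count_proots[OF \<open>?p \<noteq> 0\<close>] count_proots[of ?p t] by auto
  ultimately show ?thesis using A(1) by (simp add: size_multiset_overloaded_eq)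
qed

text \<open>The absence of linear terms concerns only blocks with one variable, since a product of
  several variables is never linear.\<close>

locale trinomial_setup =
  fixes V :: "(nat \<times> nat) set" and L :: "nat \<times> nat \<Rightarrow> nat"
  assumes finite_V: "finite V" and blocks: "fst ` V = {..<3}"
    and L_pos: "v \<in> V \<Longrightarrow> L v > 0"
    and nonlinear: "v \<in> V \<Longrightarrow> (\<And>u. u \<in> V \<Longrightarrow> fst u = fst v \<Longrightarrow> u = v) \<Longrightarrow> L v \<ge> 2"
begin

abbreviation "\<mu> \<equiv> block_exp V L"

lemma fst_less: "v \<in> V \<Longrightarrow> fst v < 3"
  using blocks by auto

lemma block_nonempty: "i < 3 \<Longrightarrow> \<exists>v\<in>V. fst v = i"
  using blocks by (metis image_iff lessThan_iff)

lemma other_blocks: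
  assumes "v \<in> V"
  obtains x y where "x \<in> V" "y \<in> V" "fst x \<noteq> fst v" "fst y \<noteq> fst v" "fst x \<noteq> fst y"
proof -
  define i j where "i = (if fst v = 0 then 1 else 0 :: nat)" and "j = (if fst v = 2 then 1 else 2 :: nat)"
  have "i < 3" "j < 3" "i \<noteq> fst v" "j \<noteq> fst v" "i \<noteq> j"
    by (auto simp: i_def j_def)
  then show ?thesis using that block_nonempty by metis
qed

lemma lookup_block_exp: "lookup (\<mu> i) v = (if v \<in> V \<and> fst v = i then L v else 0)"
  using finite_V by (simp add: block_exp_def lookup_sum lookup_single when_def sum.delta' cong: if_cong)

lemma keys_block_exp: "keys (\<mu> i) = {v \<in> V. fst v = i}"
  using L_pos by (auto simp: in_keys_iff lookup_block_exp split: if_splits)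

lemma block_exp_inj: "i < 3 \<Longrightarrow> \<mu> i = \<mu> j \<longleftrightarrow> i = j"
proof
  assume "i < 3" "\<mu> i = \<mu> j"
  moreover from \<open>i < 3\<close> obtain v where "v \<in> V" "fst v = i" using block_nonempty by blast
  ultimately show "i = j" using keys_block_exp[of i] keys_block_exp[of j] by auto
qed auto

lemma lookup_tri: "lookup (tri V L) m = (if \<exists>i<3. m = \<mu> i then 1 else 0)"
proof (cases "\<exists>i<3. m = \<mu> i")
  case True
  then obtain i where i: "i < 3" "m = \<mu> i" by blast
  then have "lookup (tri V L :: (_, 'a) mpoly) m = (\<Sum>j<3. if j = i then 1 else 0)"
    unfolding tri_def lookup_sum lookup_single
    by (intro sum.cong) (auto simp: block_exp_inj when_def)
  then show ?thesis using i by (auto simp: sum.delta)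
qed (auto simp: tri_def lookup_sum lookup_single when_def intro!: sum.neutral)

lemma keys_tri: "m \<in> keys (tri V L :: (_, 'a::comm_ring_1) mpoly) \<Longrightarrow> \<exists>i<3. m = \<mu> i"
  by (auto simp: in_keys_iff lookup_tri split: if_splits)

lemma tri_over: "tri V L \<in> mpolys_over V"
  using keys_tri keys_block_exp unfolding mpolys_over_def by fastforce

lemma eval_tri: "mpoly_eval (tri V L) x = (\<Sum>i<3. monomial_eval x (\<mu> i))"
  by (simp add: tri_def eval.hom_sum eval_single)

lemma vanishes_tri: "vanishes (tri_locus V L) (tri V L)"
  by (simp add: vanishes_def tri_locus_def zero_locus_def)

lemma tri_weights_stable:
  assumes "w \<in> tri_weights V L"
  shows "weight_stable (tri_locus V L :: (_ \<Rightarrow> 'a::comm_ring_1) set) w"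
  unfolding weight_stable_def
proof (intro ballI allI)
  fix x :: "nat \<times> nat \<Rightarrow> 'a" and s assume x: "x \<in> tri_locus V L"
  obtain d where d: "\<And>i. i < 3 \<Longrightarrow> weight w (\<mu> i) = d" and w: "\<And>v. v \<notin> V \<Longrightarrow> w v = 0"
    using assms unfolding tri_weights_def by blast
  have "mpoly_eval (tri V L) (\<lambda>v. s ^ w v * x v) = (\<Sum>i<3. s ^ d * monomial_eval x (\<mu> i))"
    by (simp add: eval_tri monomial_eval_scale d)
  also have "\<dots> = s ^ d * mpoly_eval (tri V L) x"
    by (simp add: eval_tri sum_distrib_left)
  also have "\<dots> = 0" using x by (simp add: tri_locus_def zero_locus_def)
  finally show "(\<lambda>v. s ^ w v * x v) \<in> tri_locus V L"
    using x w by (auto simp: tri_locus_def zero_locus_def affine_space_def PiE_def extensional_def)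
qed

text \<open>At a point where the coefficients of \<open>a t\<^sup>n + b\<close> do not vanish, the fibre over the
  coordinates other than \<open>v\<close> has \<open>L v\<close> points, more than \<open>p\<close> can have zeros.\<close>

lemma vanishes_low_degree:
  fixes p :: "(nat \<times> nat, 'a::{alg_closed_field, field_char_0}) mpoly"
  assumes p: "p \<in> mpolys_over V" and van: "vanishes (tri_locus V L) p" and v: "v \<in> V"
    and low: "\<And>m. m \<in> keys p \<Longrightarrow> lookup m v < L v"
  shows "p = 0"
proof -
  \<comment> \<open>Where \<open>A\<close> and \<open>b\<close> are nonzero, the equation in the
    coordinate \<open>t\<close> of \<open>v\<close> is \<open>a * t ^ L v + b = 0\<close> with both
    coefficients nonzero.\<close>
  define A :: "(nat \<times> nat, 'a) mpoly" where "A = (\<Prod>u\<in>V - {v}. mpoly_var u)"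
  define b :: "(nat \<times> nat, 'a) mpoly" where "b = (\<Sum>i\<in>{..<3} - {fst v}. single (\<mu> i) 1)"
  have zero: "mpoly_eval p x = 0"
    if x: "x \<in> affine_space V" and "mpoly_eval A x \<noteq> 0" "mpoly_eval b x \<noteq> 0" for x
  proof -
    define Q where "Q = mpoly_extend (\<lambda>c. [:c:]) (\<lambda>u. if u = v then [:0, 1:] else [:x u:]) p"
    define a where "a = (\<Prod>u\<in>{u\<in>V. fst u = fst v} - {v}. x u ^ L u)"
    have poly_Q: "poly Q t = mpoly_eval p (x(v := t))" for t
      unfolding Q_def poly_extend by (rule arg_cong[where f = "mpoly_eval p"]) auto
    have "degree Q < L v"
    proof -
      have "degree (mpoly_extend (\<lambda>c. [:c:]) (\<lambda>u. if u = v then [:0, 1:] else [:x u:]) (single m c))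
          \<le> lookup m v" for m c
      proof -
        have "degree (monomial_eval (\<lambda>u. if u = v then [:0, 1:] else [:x u:]) m) \<le> lookup m v"
          using subset_UNIV[of "keys m"]
        proof (induction m rule: monomial_induct)
          case (plus m u)
          then show ?case
            by (auto simp: monomial_eval_add lookup_add lookup_single when_def simp del: mult_pCons_right
                intro!: order.trans[OF degree_mult_le])
        qed auto
        then show ?thesis
          by (simp add: comm_ring_hom.extend_single[OF comm_ring_hom_pCons])
      qed
      note * = this
      have "Q = (\<Sum>m\<in>keys p. mpoly_extend (\<lambda>c. [:c:])
          (\<lambda>u. if u = v then [:0, 1:] else [:x u:]) (single m (lookup p m)))"
        unfolding Q_def by (subst mpoly_sum_monomials) (rule torus.hom_sum)
      also have "degree \<dots> \<le> L v - 1"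
      proof (rule degree_sum_le)
        fix m assume "m \<in> keys p"
        then have "lookup m v \<le> L v - 1" using low[of m] by simp
        then show "degree (mpoly_extend (\<lambda>c. [:c:])
            (\<lambda>u. if u = v then [:0, 1:] else [:x u:]) (single m (lookup p m))) \<le> L v - 1"
          using *[of m "lookup p m"] by linarith
      qed simp
      finally have "degree Q \<le> L v - 1" .
      then show ?thesis using L_pos[OF v] by simp
    qed
    have a: "a \<noteq> 0"
    proof -
      have "x u \<noteq> 0" if "u \<in> V - {v}" for u
        using \<open>mpoly_eval A x \<noteq> 0\<close> that finite_V by (auto simp: A_def eval.hom_prod)
      then show ?thesis using finite_V by (auto simp: a_def)
    qed
    have "mpoly_eval (tri V L) (x(v := t)) = a * t ^ L v + mpoly_eval b x" for t
    proof -
      have "mpoly_eval (tri V L) (x(v := t)) =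
          monomial_eval (x(v := t)) (\<mu> (fst v)) + (\<Sum>i\<in>{..<3} - {fst v}. monomial_eval (x(v := t)) (\<mu> i))"
        unfolding eval_tri using fst_less[OF v] by (intro sum.remove) auto
      also have "monomial_eval (x(v := t)) (\<mu> (fst v)) = a * t ^ L v"
      proof -
        have "monomial_eval (x(v := t)) (\<mu> (fst v)) =
            (\<Prod>u\<in>{u\<in>V. fst u = fst v}. (x(v := t)) u ^ L u)"
          unfolding monomial_eval_def keys_block_exp by (intro prod.cong) (auto simp: lookup_block_exp)
        also have "\<dots> = (x(v := t)) v ^ L v * (\<Prod>u\<in>{u\<in>V. fst u = fst v} - {v}. (x(v := t)) u ^ L u)"
          using v finite_V by (intro prod.remove) auto
        also have "(\<Prod>u\<in>{u\<in>V. fst u = fst v} - {v}. (x(v := t)) u ^ L u) = a"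
          unfolding a_def by (intro prod.cong) auto
        finally have "monomial_eval (x(v := t)) (\<mu> (fst v)) = (x(v := t)) v ^ L v * a" .
        then show ?thesis by (simp only: fun_upd_same mult.commute)
      qed
      also have "(\<Sum>i\<in>{..<3} - {fst v}. monomial_eval (x(v := t)) (\<mu> i)) = mpoly_eval b x"
        unfolding b_def eval.hom_sum eval_single
        by (intro sum.cong) (auto simp: monomial_eval_def keys_block_exp intro!: prod.cong)
      finally show ?thesis .
    qed
    moreover have "x(v := t) \<in> affine_space V" for t
      using x v by (auto simp: affine_space_def PiE_def extensional_def)
    ultimately have root: "poly Q t = 0" if "t ^ L v = - mpoly_eval b x / a" for t
      using van that a by (auto simp: poly_Q vanishes_def tri_locus_def zero_locus_def)
    have "Q = 0"
    proof (rule ccontr)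
      assume "Q \<noteq> 0"
      then have "card {t. t ^ L v = - mpoly_eval b x / a} \<le> card {t. poly Q t = 0}"
        using root by (intro card_mono poly_roots_finite) auto
      also have "\<dots> \<le> degree Q" using \<open>Q \<noteq> 0\<close> by (rule card_poly_roots_bound)
      also have "\<dots> < L v" by fact
      also have "L v = card {t. t ^ L v = - mpoly_eval b x / a}"
        using a \<open>mpoly_eval b x \<noteq> 0\<close> L_pos[OF v] by (subst card_nth_roots) auto
      finally show False by simp
    qed
    then show ?thesis using poly_Q[of "x v"] by simp
  qed
  \<comment> \<open>The factors \<open>A\<close> and \<open>b\<close> take care of the exceptional
    points. They are nonzero polynomials, and polynomials in linearly ordered variables have no zero
    divisors.\<close>
  have "vanishes (affine_space V) (A * b * p)"
    using zero by (auto simp: vanishes_def eval.hom_mult)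
  moreover have "b \<in> mpolys_over V"
    unfolding b_def by (intro over_sum) (auto simp: mpolys_over_def keys_block_exp)
  ultimately have "A * b * p = 0"
    using p unfolding A_def by (intro vanishes_affine_space) (auto intro!: over_mult over_prod)
  moreover have "A \<noteq> 0"
  proof -
    have "(mpoly_var u :: (nat \<times> nat, 'a) mpoly) \<noteq> 0" for u
      using lookup_single_eq[of "single u 1" "1::'a"] by (metis mpoly_var_def lookup_zero zero_neq_one)
    then show ?thesis using finite_V by (simp add: A_def)
  qed
  moreover have "b \<noteq> 0"
  proof -
    obtain x where x: "x \<in> V" "fst x \<noteq> fst v" using other_blocks[OF v] by blast
    have "lookup b (\<mu> (fst x)) = (\<Sum>i\<in>{..<3} - {fst v}. if i = fst x then 1 else 0)"
      unfolding b_def lookup_sum lookup_single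
      using fst_less[OF x(1)] by (intro sum.cong) (auto simp: block_exp_inj when_def)
    also have "\<dots> = 1" using x fst_less by (auto simp: sum.delta)
    finally show ?thesis by auto
  qed
  ultimately show ?thesis by simp
qed

text \<open>For one variable from each block, each entry is the product of the other two exponents.
  All three monomials then have weight \<open>L x * L y * L z\<close>, without any division.\<close>

definition transversal_weight :: "nat \<times> nat \<Rightarrow> nat \<times> nat \<Rightarrow> nat \<times> nat \<Rightarrow> nat \<times> nat \<Rightarrow> nat" where
  "transversal_weight x y z = (\<lambda>v. (if v = x then L y * L z else 0) +
    ((if v = y then L x * L z else 0) + (if v = z then L x * L y else 0)))"

lemma weight_transversal: "weight (transversal_weight x y z) a =
    L y * L z * lookup a x + (L x * L z * lookup a y + L x * L y * lookup a z)"
  unfolding transversal_weight_def weight_field_add weight_indicator_const by simp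

lemma transversal_weight_in:
  assumes "x \<in> V" "y \<in> V" "z \<in> V" "fst x \<noteq> fst y" "fst x \<noteq> fst z" "fst y \<noteq> fst z"
  shows "transversal_weight x y z \<in> tri_weights V L"
proof -
  have "weight (transversal_weight x y z) (\<mu> i) = L x * L y * L z" if "i < 3" for i
  proof -
    have "i = fst x \<or> i = fst y \<or> i = fst z"
      using that assms fst_less[OF assms(1)] fst_less[OF assms(2)] fst_less[OF assms(3)] by linarith
    then show ?thesis using assms by (auto simp: weight_transversal lookup_block_exp)
  qed
  moreover have "transversal_weight x y z v = 0" if "v \<notin> V" for v
    using that assms by (auto simp: transversal_weight_def)
  ultimately show ?thesis by (auto simp: tri_weights_def)
qed

text \<open>If \<open>x \<noteq> u\<close> shares the block of \<open>u\<close>, transversals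
  through \<open>x\<close> have weight 0 at \<open>u\<close>, so \<open>a\<close> contains no
  variable but \<open>u\<close> and is \<open>u\<close> itself. If \<open>u\<close> is alone, a
  transversal \<open>u\<close>, \<open>y\<close>, \<open>z\<close> has weight
  \<open>L y * L z\<close> at \<open>u\<close>; a factor \<open>u\<close> in \<open>a\<close> would
  exhaust it, and otherwise the term of \<open>y\<close> gives the bound.\<close>

lemma monomial_weight_cases:
  assumes u: "u \<in> V" and a: "keys a \<subseteq> V" "\<And>w. w \<in> tri_weights V L \<Longrightarrow> weight w a = w u"
    and ne: "a \<noteq> single u 1"
  shows "\<And>x. x \<in> V \<Longrightarrow> fst x = fst u \<Longrightarrow> x = u"
    and "lookup a u = 0"
    and "\<And>x. x \<in> V \<Longrightarrow> x \<noteq> u \<Longrightarrow> lookup a x * L u \<le> L x"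
proof -
  have rel: "L y * L z * lookup a x + (L x * L z * lookup a y + L x * L y * lookup a z)
      = transversal_weight x y z u"
    if "x \<in> V" "y \<in> V" "z \<in> V" "fst x \<noteq> fst y" "fst x \<noteq> fst z" "fst y \<noteq> fst z" for x y z
    using a(2)[OF transversal_weight_in[OF that]] by (simp add: weight_transversal)
  have rel_u: "L y * L z * lookup a u + (L u * L z * lookup a y + L u * L y * lookup a z) = L y * L z"
    if "y \<in> V" "z \<in> V" "fst u \<noteq> fst y" "fst u \<noteq> fst z" "fst y \<noteq> fst z" for y z
    using rel[OF u that] that by (auto simp: transversal_weight_def)
  have eq_single: "a = single u 1" if "\<And>x. x \<in> V \<Longrightarrow> x \<noteq> u \<Longrightarrow> lookup a x = 0" "lookup a u = 1"
  proof (rule poly_mapping_eqI)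
    fix x
    have "x \<notin> V \<Longrightarrow> lookup a x = 0" using a(1) by (auto simp: in_keys_iff)
    then show "lookup a x = lookup (single u 1) x"
      using that by (cases "x = u"; cases "x \<in> V") (auto simp: lookup_single)
  qed
  obtain y0 z0 where yz0: "y0 \<in> V" "z0 \<in> V" "fst y0 \<noteq> fst u" "fst z0 \<noteq> fst u" "fst y0 \<noteq> fst z0"
    using other_blocks[OF u] by metis
  have third: "\<exists>z\<in>V. fst u \<noteq> fst z \<and> fst y \<noteq> fst z" if "y \<in> V" "fst y \<noteq> fst u" for y
    using yz0 that by (cases "fst y = fst y0") metis+
  show uniq: "x = u" if x: "x \<in> V" "fst x = fst u" for x
  proof (rule ccontr)
    assume "x \<noteq> u"
    have zero: "lookup a x' = 0 \<and> lookup a y = 0"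
      if H: "x' \<in> V" "x' \<noteq> u" "fst x' = fst u" "y \<in> V" "fst y \<noteq> fst u" for x' y
    proof -
      obtain z where z: "z \<in> V" "fst u \<noteq> fst z" "fst y \<noteq> fst z" using third[OF H(4,5)] by blast
      have "L y * L z * lookup a x' + (L x' * L z * lookup a y + L x' * L y * lookup a z) = 0"
        using rel[of x' y z] H z by (auto simp: transversal_weight_def)
      then show ?thesis using L_pos[of x'] L_pos[of y] L_pos[of z] H z by auto
    qed
    have *: "lookup a x' = 0" if "x' \<in> V" "x' \<noteq> u" for x'
      using zero[of x' y0] zero[of x x'] that x \<open>x \<noteq> u\<close> yz0 by (cases "fst x' = fst u") auto
    then have "lookup a y0 = 0" "lookup a z0 = 0" using yz0 by metis+
    then have "lookup a u = 1"
      using rel_u[of y0 z0] yz0 L_pos[of y0] L_pos[of z0] by auto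
    with * eq_single ne show False by blast
  qed
  show a0: "lookup a u = 0"
  proof (rule ccontr)
    assume nz: "lookup a u \<noteq> 0"
    have *: "lookup a y = 0 \<and> lookup a u = 1" if H: "y \<in> V" "fst y \<noteq> fst u" for y
    proof -
      obtain z where z: "z \<in> V" "fst u \<noteq> fst z" "fst y \<noteq> fst z" using third[OF H] by blast
      have r: "L y * L z * lookup a u + (L u * L z * lookup a y + L u * L y * lookup a z) = L y * L z"
        using rel_u[of y z] H z by auto
      have pos: "L y > 0" "L z > 0" "L u > 0" using L_pos H z u by auto
      have "L y * L z * 1 \<le> L y * L z * lookup a u" using nz by (intro mult_left_mono) auto
      with r have "L y * L z * lookup a u = L y * L z" "L u * L z * lookup a y = 0" by linarith+
      then show ?thesis using pos by simp
    qed
    have "lookup a x = 0" if "x \<in> V" "x \<noteq> u" for x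
      using *[of x] uniq[of x] that by blast
    moreover have "lookup a u = 1" using * yz0 by blast
    ultimately show False using eq_single ne by blast
  qed
  show "lookup a y * L u \<le> L y" if y: "y \<in> V" "y \<noteq> u" for y
  proof -
    have "fst y \<noteq> fst u" using uniq[of y] y by auto
    then obtain z where z: "z \<in> V" "fst u \<noteq> fst z" "fst y \<noteq> fst z"
      using third[OF y(1)] by blast
    have "L u * L z * lookup a y \<le> L y * L z"
      using rel_u[OF y(1) z(1) not_sym[OF \<open>fst y \<noteq> fst u\<close>] z(2,3)] by linarith
    then have "L z * (lookup a y * L u) \<le> L z * L y" by (simp add: mult_ac)
    then show ?thesis using L_pos[OF z(1)] by (simp only: nat_mult_le_cancel1)
  qed
qed

text \<open>Either \<open>u\<close> is alone in its block and has degree at most 1 <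
  \<open>L u\<close> in \<open>p\<close>, or \<open>p\<close> is a scalar multiple of
  \<open>u\<close> and does not contain the variables of another block. In both cases the degree
  bound for vanishing polynomials applies.\<close>

lemma vanishes_variable_weight:
  fixes p :: "(nat \<times> nat, 'a::{alg_closed_field, field_char_0}) mpoly"
  assumes p: "p \<in> mpolys_over V" and van: "vanishes (tri_locus V L) p" and u: "u \<in> V"
    and hom: "\<And>a w. a \<in> keys p \<Longrightarrow> w \<in> tri_weights V L \<Longrightarrow> weight w a = w u"
  shows "p = 0"
proof -
  have keys: "keys a \<subseteq> V" if "a \<in> keys p" for a using p that by (auto simp: mpolys_over_def)
  show ?thesis
  proof (cases "\<forall>x\<in>V. fst x = fst u \<longrightarrow> x = u")
    case True
    show ?thesis
    proof (rule vanishes_low_degree[OF p van u])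
      fix a assume a: "a \<in> keys p"
      have "lookup a u \<le> 1"
        using monomial_weight_cases(2)[OF u keys[OF a] hom[OF a]] by (cases "a = single u 1") auto
      moreover have "L u \<ge> 2" using True by (intro nonlinear u) auto
      ultimately show "lookup a u < L u" by simp
    qed
  next
    case False
    obtain y where y: "y \<in> V" "fst y \<noteq> fst u" using other_blocks[OF u] by metis
    show ?thesis
    proof (rule vanishes_low_degree[OF p van y(1)])
      fix a assume a: "a \<in> keys p"
      have "a = single u 1"
        using monomial_weight_cases(1)[OF u keys[OF a] hom[OF a]] False by blast
      then show "lookup a y < L y" using y L_pos by (auto simp: lookup_single when_def)
    qed
  qed
qed

text \<open>The component of \<open>p\<close> with the weights of \<open>u\<close> also vanishes,
  hence is zero, and it contains the linear term in \<open>u\<close>. So functions on the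
  hypersurface have well-defined linear parts at the origin.\<close>

lemma vanishes_linear_coeff:
  fixes p :: "(nat \<times> nat, 'a::{alg_closed_field, field_char_0}) mpoly"
  assumes p: "p \<in> mpolys_over V" and van: "vanishes (tri_locus V L) p" and u: "u \<in> V"
  shows "lookup p (single u 1) = 0"
proof -
  let ?q = "mrestrict (\<lambda>a. \<forall>w\<in>tri_weights V L. weight w a = w u) p"
  have "?q = 0"
    using p u by (intro vanishes_variable_weight[of _ u] over_mrestrict
        vanishes_multicomponent van tri_weights_stable) (auto simp: keys_mrestrict)
  then have "lookup ?q (single u 1) = 0" by simp
  then show ?thesis by (simp add: lookup_mrestrict)
qed

end

section \<open>Derivations of degree zero on a rigid trinomial hypersurface\<close>

lemma der_field_mult: "der (\<lambda>v. E v * g) p = der E p * g"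
  by (induction p rule: mpoly_induct) (auto simp: der_mult der_add algebra_simps)

lemma single_var_power: "single (single v k) 1 = (mpoly_var v :: ('v, 'a::comm_ring_1) mpoly) ^ k"
proof (induction k)
  case (Suc k)
  have "single v (Suc k) = single v k + single v (1::nat)" by (simp add: single_add[symmetric])
  then have "single (single v (Suc k)) (1::'a) = single (single v k) 1 * mpoly_var v"
    by (simp only: single_plus_var)
  then show ?case using Suc by (simp add: mult.commute)
qed simp

lemma mpoly_const_uminus: "mpoly_const (- c) = - mpoly_const c"
  by (simp add: mpoly_const_def single_uminus)

lemma mpoly_const_of_nat: "mpoly_const (of_nat k) = of_nat k"
  by (induction k) (auto simp: mpoly_const_simps)

text \<open>The Leibniz formula has two terms if \<open>D\<close> annihilates \<open>q\<close> in
  two steps; this propagates nilpotency from variables to products.\<close>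

lemma funpow_der_mult_linear:
  assumes "der D (der D q) = 0"
  shows "(der D ^^ Suc k) (p * q) = (der D ^^ Suc k) p * q + of_nat (Suc k) * (der D ^^ k) p * der D q"
proof (induction k)
  case 0
  show ?case by (simp add: der_mult)
next
  case (Suc k)
  let ?n = "of_nat (Suc k) :: ('a, 'b) mpoly"
  have n: "der D (?n * r) = ?n * der D r" for r
    unfolding mpoly_const_of_nat[symmetric] by (rule der_const_mult)
  have "(der D ^^ Suc (Suc k)) (p * q) = der D ((der D ^^ Suc k) p * q + ?n * (der D ^^ k) p * der D q)"
    unfolding Suc[symmetric] by simp
  also have "\<dots> = (der D ^^ Suc (Suc k)) p * q + (der D ^^ Suc k) p * der D q
      + ?n * ((der D ^^ Suc k) p * der D q)"
    using n[of "(der D ^^ k) p * der D q"] assms by (simp add: der_mult der_add mult.assoc)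
  finally show ?case by (simp add: algebra_simps)
qed

context trinomial_setup
begin

text \<open>In \<open>x = u + \<iota> v\<close> and \<open>y = u - \<iota> v\<close> the equation is
  \<open>x y + M = 0\<close>, with \<open>M\<close> the third monomial. The derivation
  \<open>x d/dz - (dM/dz) d/dy\<close> annihilates it and is locally nilpotent: \<open>x\<close>
  goes to 0, \<open>z\<close> to \<open>x\<close>, and \<open>y\<close> to a polynomial in the block
  of \<open>z\<close>.\<close>

lemma rigid_no_two_squares:
  assumes rigid: "rigid V (tri_locus V L :: (nat \<times> nat \<Rightarrow> 'a::{alg_closed_field, field_char_0}) set)"
    and u: "u \<in> V" "\<And>x. x \<in> V \<Longrightarrow> fst x = fst u \<Longrightarrow> x = u" "L u = 2"
    and v: "v \<in> V" "\<And>x. x \<in> V \<Longrightarrow> fst x = fst v \<Longrightarrow> x = v" "L v = 2"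
    and "u \<noteq> v"
  shows False
proof -
  have uv: "fst u \<noteq> fst v" using u v \<open>u \<noteq> v\<close> by metis
  obtain z where z: "z \<in> V" "fst z \<noteq> fst u" "fst z \<noteq> fst v"
    using other_blocks[OF u(1)] by metis
  obtain \<iota> :: 'a where \<iota>: "\<iota> ^ 2 = -1" using nth_root_exists[of 2 "-1"] by auto
  define c :: "(nat \<times> nat, 'a) mpoly" where "c = mpoly_const \<iota>"
  have "c * c = mpoly_const (-1)" using \<iota> by (simp add: c_def mpoly_const_simps[symmetric] power2_eq_square)
  then have cc: "c * c = -1" "c * (c * t) = - t" for t
    by (simp_all add: mpoly_const_uminus mpoly_const_simps mult.assoc[symmetric])
  define M :: "(nat \<times> nat, 'a) mpoly" where "M = single (\<mu> (fst z)) 1"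
  \<comment> \<open>\<open>der E\<close> is the partial derivative with respect to \<open>z\<close>,
    so \<open>H\<close> below is that of \<open>M\<close>.\<close>
  define E :: "nat \<times> nat \<Rightarrow> (nat \<times> nat, 'a) mpoly" where "E x = (if x = z then 1 else 0)" for x
  define H where "H = der E M"
  define B where "B = {x\<in>V. fst x = fst z}"
  let ?u = "mpoly_var u :: (nat \<times> nat, 'a) mpoly" and ?v = "mpoly_var v :: (nat \<times> nat, 'a) mpoly"
  \<comment> \<open>This is \<open>-2 \<iota>\<close> times the derivation
    \<open>x d/dz - (dM/dz) d/dy\<close>, written in the coordinates \<open>u\<close> and
    \<open>v\<close>.\<close>
  define D where "D x = (if x = z then -2 * c * (?u + c * ?v) else if x = u then c * H
      else if x = v then - H else 0)" for x
  have "x \<in> V \<and> fst x = fst u \<longleftrightarrow> x = u" "x \<in> V \<and> fst x = fst v \<longleftrightarrow> x = v" for x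
    using u v by metis+
  then have "\<mu> (fst u) = single u 2" "\<mu> (fst v) = single v 2"
    using u(3) v(3) by (auto intro!: poly_mapping_eqI simp: lookup_block_exp lookup_single when_def)
  then have sq: "single (\<mu> (fst u)) 1 = ?u ^ 2" "single (\<mu> (fst v)) 1 = ?v ^ 2"
    by (simp_all add: single_var_power)
  have "{..<3} = {fst u, fst v, fst z}"
    using fst_less[OF u(1)] fst_less[OF v(1)] fst_less[OF z(1)] uv z by auto
  then have tri: "tri V L = ?u ^ 2 + (?v ^ 2 + M)"
    using uv z by (simp add: tri_def M_def sq add.assoc)
  have M: "M \<in> mpolys_over B" by (auto simp: M_def B_def mpolys_over_def keys_block_exp)
  have H: "H \<in> mpolys_over B" unfolding H_def using M by (rule der_over) (auto simp: E_def)
  have mono: "p \<in> mpolys_over V" if "p \<in> mpolys_over B" for p :: "(nat \<times> nat, 'a) mpoly"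
    using that by (auto simp: mpolys_over_def B_def)
  have c_over: "c \<in> mpolys_over S" for S by (simp add: c_def)
  have D_over: "D x \<in> mpolys_over V" if "x \<in> V" for x
  proof -
    have "0 - H \<in> mpolys_over V" "(0 - c - c) * (?u + c * ?v) \<in> mpolys_over V" "c * H \<in> mpolys_over V"
      using mono[OF H] u v c_over by (intro over_add over_mult over_minus; simp)+
    moreover have "(0 - c - c) * (?u + c * ?v) = -2 * c * (?u + c * ?v)" by (simp add: algebra_simps)
    ultimately show ?thesis by (simp add: D_def)
  qed
  have D_uv: "der D ?u = c * H" "der D ?v = - H" using uv z by (auto simp: D_def)
  have D_c: "der D (c * p) = c * der D p" for p unfolding c_def by (rule der_const_mult)
  have D_Dz: "der D (D z) = 0"
  proof -
    have "der D (?u + c * ?v) = 0" by (simp add: der_add D_c D_uv del: der_var)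
    moreover have "D z = c * (0 - (?u + c * ?v) - (?u + c * ?v))" by (simp add: D_def algebra_simps)
    ultimately show ?thesis by (simp only: D_c der_minus der_zero diff_zero mult_zero_right)
  qed
  have "der D M = der (\<lambda>x. E x * D z) M"
    using uv z by (intro der_cong[OF M]) (auto simp: E_def D_def B_def)
  then have D_M: "der D M = H * D z" by (simp add: der_field_mult H_def)
  have "der D (tri V L) = 2 * (c * H * ?u) - 2 * (H * ?v) + H * D z"
    unfolding tri power2_eq_square by (simp add: der_add der_mult D_M D_uv algebra_simps del: der_var)
  also have "\<dots> = 0" by (simp add: D_def algebra_simps cc)
  finally have D_tri: "der D (tri V L) = 0" .
  \<comment> \<open>The trinomial is monic of degree 2 in \<open>u\<close>, so division leaves
    degree at most 1 in \<open>u\<close>. A vanishing remainder of this degree is zero, so all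
    vanishing polynomials are multiples of \<open>tri V L\<close>.\<close>
  have division: "\<exists>q r0 r1. r0 \<in> mpolys_over (V - {u}) \<and> r1 \<in> mpolys_over (V - {u}) \<and>
      p = q * tri V L + r0 + r1 * ?u" if "p \<in> mpolys_over V" for p :: "(nat \<times> nat, 'a) mpoly"
    using that
  proof (induction p rule: mpoly_over_induct)
    case (const a)
    show ?case by (rule exI[of _ 0], rule exI[of _ "mpoly_const a"], rule exI[of _ 0]) simp
  next
    case (var p x)
    then obtain q r0 r1 where p: "r0 \<in> mpolys_over (V - {u})" "r1 \<in> mpolys_over (V - {u})"
      "p = q * tri V L + r0 + r1 * ?u" by blast
    show ?case
    proof (cases "x = u")
      case True
      have "?v ^ 2 + M \<in> mpolys_over (V - {u})"
      proof (intro over_add over_power over_var)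
        have "B \<subseteq> V - {u}" using z by (auto simp: B_def)
        then show "M \<in> mpolys_over (V - {u})" using M by (auto simp: mpolys_over_def)
      qed (use v \<open>u \<noteq> v\<close> in auto)
      then have "(0 - r1) * (?v ^ 2 + M) \<in> mpolys_over (V - {u})"
        using p by (intro over_mult over_minus) auto
      moreover have "p * mpoly_var x = (q * ?u + r1) * tri V L + (0 - r1) * (?v ^ 2 + M) + r0 * ?u"
      proof -
        have uu: "?u * ?u = tri V L - (?v ^ 2 + M)" by (simp add: tri power2_eq_square)
        have "p * mpoly_var x = q * ?u * tri V L + r0 * ?u + r1 * (?u * ?u)"
          unfolding p(3) True by (simp add: algebra_simps)
        then show ?thesis unfolding uu by (simp add: algebra_simps)
      qed
      ultimately show ?thesis using p(1) by blast
    next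
      case False
      have "p * mpoly_var x = (q * mpoly_var x) * tri V L + r0 * mpoly_var x + (r1 * mpoly_var x) * ?u"
        unfolding p(3) by (simp add: algebra_simps)
      moreover have "r0 * mpoly_var x \<in> mpolys_over (V - {u})" "r1 * mpoly_var x \<in> mpolys_over (V - {u})"
        using p False var by (auto intro: over_mult)
      ultimately show ?thesis by blast
    qed
  next
    case (add p p')
    then obtain q r0 r1 q' r0' r1' where p: "r0 \<in> mpolys_over (V - {u})" "r1 \<in> mpolys_over (V - {u})"
      "p = q * tri V L + r0 + r1 * ?u" "r0' \<in> mpolys_over (V - {u})" "r1' \<in> mpolys_over (V - {u})"
      "p' = q' * tri V L + r0' + r1' * ?u" by metis
    have "p + p' = (q + q') * tri V L + (r0 + r0') + (r1 + r1') * ?u"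
      unfolding p(3,6) by (simp add: algebra_simps)
    then show ?case using p over_add by blast
  qed
  have pres: "vanishes (tri_locus V L) (der D p)"
    if p: "p \<in> mpolys_over V" "vanishes (tri_locus V L) p" for p :: "(nat \<times> nat, 'a) mpoly"
  proof -
    obtain q r0 r1 where r: "r0 \<in> mpolys_over (V - {u})" "r1 \<in> mpolys_over (V - {u})"
      "p = q * tri V L + r0 + r1 * ?u" using division p by blast
    have "r0 + r1 * ?u = 0"
    proof (rule vanishes_low_degree)
      have "r0 + r1 * ?u = p - q * tri V L" using r(3) by simp
      then show "vanishes (tri_locus V L) (r0 + r1 * ?u)"
        using vanishes_minus[OF p(2) vanishes_mult_left[OF vanishes_tri]] by simp
      have "r0 \<in> mpolys_over V" "r1 \<in> mpolys_over V" using r by (auto simp: mpolys_over_def)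
      then show "r0 + r1 * ?u \<in> mpolys_over V" using u by (intro over_add over_mult) auto
      show "u \<in> V" by fact
      fix m assume "m \<in> keys (r0 + r1 * ?u)"
      then consider "m \<in> keys r0" | "m \<in> keys (r1 * ?u)"
        using Poly_Mapping.keys_add[of r0 "r1 * ?u"] by blast
      then have "lookup m u \<le> 1"
      proof cases
        case 1
        then have "u \<notin> keys m" using r(1) by (auto simp: mpolys_over_def)
        then show ?thesis by (simp add: in_keys_iff)
      next
        case 2
        then have "m - single u 1 \<in> keys r1"
          by (auto simp: in_keys_iff lookup_mult_var split: if_splits)
        then have "u \<notin> keys (m - single u 1)" using r(2) by (auto simp: mpolys_over_def)
        then show ?thesis by (simp add: in_keys_iff lookup_minus)
      qed
      then show "lookup m u < L u" using u by simp
    qed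
    then have "p = q * tri V L" using r(3) by (simp add: add.assoc)
    then have "der D p = der D q * tri V L" by (simp add: der_mult D_tri)
    then show ?thesis using vanishes_mult_left[OF vanishes_tri] by simp
  qed
  \<comment> \<open>In the block of \<open>z\<close> only \<open>z\<close> is moved, and two steps
    annihilate it.. no variable there needs more.\<close>
  have nil_B: "\<exists>N. (der D ^^ N) p = 0" if "p \<in> mpolys_over B" for p :: "(nat \<times> nat, 'a) mpoly"
    using that
  proof (induction p rule: mpoly_over_induct)
    case (const a)
    show ?case by (rule exI[of _ 1]) simp
  next
    case (var p x)
    then obtain N where N: "(der D ^^ N) p = 0" by blast
    have "der D (der D (mpoly_var x)) = 0"
      using var D_Dz z by (cases "x = z") (auto simp: D_def B_def)
    from funpow_der_mult_linear[OF this, of N p] have "(der D ^^ Suc N) (p * mpoly_var x) = 0"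
      using N by simp
    then show ?case by blast
  next
    case (add p q)
    then obtain N N' where "(der D ^^ N) p = 0" "(der D ^^ N') q = 0" by blast
    then have "(der D ^^ (N' + N)) p = 0" "(der D ^^ (N + N')) q = 0"
      by (simp_all only: funpow_add comp_apply funpow_der_zero)
    then have "(der D ^^ (N + N')) (p + q) = 0" by (simp add: funpow_der_add add.commute)
    then show ?case by blast
  qed
  have nil: "\<exists>N. vanishes (tri_locus V L) ((der D ^^ N) (mpoly_var x))" if "x \<in> V" for x
  proof -
    have "\<exists>N. (der D ^^ N) (D x) = 0"
    proof (cases "x = z")
      case True
      show ?thesis by (rule exI[of _ 1]) (simp add: True D_Dz)
    next
      case False
      have "c * H \<in> mpolys_over B" "0 - H \<in> mpolys_over B"
        using H c_over by (intro over_mult over_minus; simp)+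
      then have "D x \<in> mpolys_over B" using False by (auto simp: D_def)
      then show ?thesis by (rule nil_B)
    qed
    then obtain N where "(der D ^^ Suc N) (mpoly_var x) = 0"
      by (auto simp: funpow_Suc_right simp del: funpow.simps)
    then show ?thesis by (metis vanishes_zero)
  qed
  have "vanishes (tri_locus V L) (D z)"
    unfolding tri_locus_def
    by (rule rigid_lnd_trivial[OF rigid[unfolded tri_locus_def] finite_V tri_over D_over
        pres[unfolded tri_locus_def] nil[unfolded tri_locus_def] z(1)])
  \<comment> \<open>This contradicts the definition of \<open>D z\<close>, where \<open>u\<close>
    has the coefficient \<open>-2 \<iota>\<close>.\<close>
  then have "lookup (D z) (single u 1) = 0"
    by (rule vanishes_linear_coeff[OF D_over[OF z(1)] _ u(1)])
  moreover have "D z = mpoly_const (- 2 * \<iota>) * ?u + mpoly_const 2 * ?v"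
  proof -
    have "mpoly_const (- 2 * \<iota>) = - c - c"
    proof -
      have "mpoly_const (0 - \<iota> - \<iota>) = 0 - c - c"
        by (simp only: c_def comm_ring_hom.hom_minus[OF comm_ring_hom_mpoly_const] mpoly_const_simps)
      then show ?thesis by simp
    qed
    moreover have "(mpoly_const 2 :: (nat \<times> nat, 'a) mpoly) = 1 + 1"
      by (metis mpoly_const_simps(1,4) one_add_one)
    ultimately show ?thesis by (simp add: D_def algebra_simps cc)
  qed
  moreover have "single v (1::nat) \<noteq> single u 1"
    using \<open>u \<noteq> v\<close> by (metis lookup_single_eq lookup_single_not_eq zero_neq_one)
  ultimately have "\<iota> = 0"
    by (simp add: lookup_add lookup_const_mult mpoly_var_def lookup_single_not_eq)
  then show False using \<iota> by simp
qed

text \<open>Let \<open>h\<close> be the nondiagonal part of \<open>D\<close>. A monomial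
  \<open>a\<close> of \<open>h v\<close> contributes \<open>v^(L v - 1) a\<close> to the image of
  the trinomial. It could only cancel against a term from another one-variable block, and the bounds
  on exponents then force two squares.\<close>

lemma homogeneous_derivation_diagonal:
  fixes D :: "nat \<times> nat \<Rightarrow> (nat \<times> nat, 'a::{alg_closed_field, field_char_0}) mpoly"
  assumes no_squares: "\<And>u v. u \<in> V \<Longrightarrow> v \<in> V \<Longrightarrow> u \<noteq> v \<Longrightarrow> L u = 2 \<Longrightarrow> L v = 2 \<Longrightarrow>
      (\<And>x. x \<in> V \<Longrightarrow> fst x = fst u \<Longrightarrow> x = u) \<Longrightarrow>
      (\<And>x. x \<in> V \<Longrightarrow> fst x = fst v \<Longrightarrow> x = v) \<Longrightarrow> False"
    and D: "\<And>v. v \<in> V \<Longrightarrow> D v \<in> mpolys_over V"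
    and hom: "\<And>v a w. v \<in> V \<Longrightarrow> a \<in> keys (D v) \<Longrightarrow> w \<in> tri_weights V L \<Longrightarrow> weight w a = w v"
    and van: "vanishes (tri_locus V L) (der D (tri V L))"
  obtains c d where "\<And>v. v \<in> V \<Longrightarrow> D v = mpoly_const (c v) * mpoly_var v"
    and "\<And>i. i < 3 \<Longrightarrow> weight c (\<mu> i) = d"
proof -
  define c where "c v = lookup (D v) (single v 1)" for v
  define h where "h v = D v - mpoly_const (c v) * mpoly_var v" for v
  have h_lookup: "lookup (h v) a = (if a = single v 1 then 0 else lookup (D v) a)" for v a
    by (auto simp: h_def c_def lookup_minus lookup_const_mult mpoly_var_def lookup_single when_def)
  have h_keys: "keys a \<subseteq> V" "a \<noteq> single v 1" "\<And>w. w \<in> tri_weights V L \<Longrightarrow> weight w a = w v"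
    if "v \<in> V" "a \<in> keys (h v)" for v a
  proof -
    have "a \<in> keys (D v)" "a \<noteq> single v 1"
      using that(2) by (auto simp: in_keys_iff h_lookup split: if_splits)
    then show "keys a \<subseteq> V" "a \<noteq> single v 1" "\<And>w. w \<in> tri_weights V L \<Longrightarrow> weight w a = w v"
      using D[OF that(1)] hom[OF that(1)] by (auto simp: mpolys_over_def)
  qed
  have h_single: "x = v" if "v \<in> V" "a \<in> keys (h v)" "x \<in> V" "fst x = fst v" for v a x
    using monomial_weight_cases(1)[OF that(1) h_keys(1,3,2)[OF that(1,2)]] that by blast
  have h_zero: "lookup a v = 0" if "v \<in> V" "a \<in> keys (h v)" for v a
    using monomial_weight_cases(2)[OF that(1) h_keys(1,3,2)[OF that]] by blast
  have h_le: "lookup a x * L v \<le> L x" if "v \<in> V" "a \<in> keys (h v)" "x \<in> V" "x \<noteq> v" for v a x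
    using monomial_weight_cases(3)[OF that(1) h_keys(1,3,2)[OF that(1,2)]] that by blast
  have h_two: "L v \<ge> 2" if "v \<in> V" "a \<in> keys (h v)" for v a
    using nonlinear[OF that(1)] h_single[OF that] by blast
  have h_over: "h v \<in> mpolys_over V" if "v \<in> V" for v
    unfolding h_def using D that by (intro over_minus over_mult) auto
  let ?e = "\<lambda>i. mpoly_const (weight c (\<mu> i)) * single (\<mu> i) (1::'a)"
  have S: "der D (tri V L) = (\<Sum>i<3. ?e i) + der h (tri V L)"
  proof -
    have "der D (tri V L) = der (\<lambda>v. mpoly_const (c v) * mpoly_var v + h v) (tri V L)"
      by (simp add: h_def)
    also have "\<dots> = euler c (tri V L) + der h (tri V L)"
      by (simp only: der_field_add euler_def)
    also have "euler c (tri V L) = (\<Sum>i<3. ?e i)"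
      unfolding tri_def euler_single[symmetric] unfolding euler_def der_sum ..
    finally show ?thesis .
  qed
  \<comment> \<open>Subtracting this multiple of the trinomial removes the diagonal contribution of
    the block of \<open>v\<close>, where \<open>v\<close> has degree \<open>L v\<close>.\<close>
  define S' where "S' v = der D (tri V L) - mpoly_const (weight c (\<mu> (fst v))) * tri V L"
    for v :: "nat \<times> nat"
  have S'_eq: "S' v = (\<Sum>i<3. mpoly_const (weight c (\<mu> i) - weight c (\<mu> (fst v))) * single (\<mu> i) 1)
      + der h (tri V L)" for v
  proof -
    have "(\<Sum>i<3. mpoly_const (weight c (\<mu> i) - weight c (\<mu> (fst v))) * single (\<mu> i) 1)
        = (\<Sum>i<3. ?e i) - mpoly_const (weight c (\<mu> (fst v))) * tri V L"
      by (simp add: tri_def sum_distrib_left sum_subtractf[symmetric] left_diff_distrib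
          comm_ring_hom.hom_minus[OF comm_ring_hom_mpoly_const])
    then show ?thesis unfolding S'_def S by simp
  qed
  have S'_over: "S' v \<in> mpolys_over V" for v
    unfolding S'_def using D tri_over by (intro over_minus over_mult der_over) auto
  have S'_van: "vanishes (tri_locus V L) (S' v)" for v
    unfolding S'_def by (intro vanishes_minus van vanishes_mult_left vanishes_tri)
  have lookup_S': "lookup (S' v) b = (\<Sum>i<3. if b = \<mu> i then weight c (\<mu> i) - weight c (\<mu> (fst v)) else 0)
      + lookup (der h (tri V L)) b" for v b
    unfolding S'_eq lookup_add lookup_sum lookup_const_mult
    by (auto simp: lookup_single when_def intro!: sum.cong)
  have keys_S': "(\<exists>i<3. i \<noteq> fst v \<and> b = \<mu> i) \<or> b \<in> keys (der h (tri V L))"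
    if "b \<in> keys (S' v)" for v b
  proof (rule ccontr)
    assume neg: "\<not> ?thesis"
    then have "(\<Sum>i<3. if b = \<mu> i then weight c (\<mu> i) - weight c (\<mu> (fst v)) else 0) = 0"
      by (intro sum.neutral) auto
    then show False using neg that unfolding in_keys_iff lookup_S' by simp
  qed
  have keys_dh: "\<exists>x a. x \<in> V \<and> fst x = i \<and> a \<in> keys (h x) \<and> b + single x 1 = \<mu> i + a"
    if "b \<in> keys (der h (single (\<mu> i) 1))" for b i
    using keys_der_single[OF that] by (auto simp: keys_block_exp)
  have keys_dh_tri: "\<exists>x a. x \<in> V \<and> a \<in> keys (h x) \<and> b + single x 1 = \<mu> (fst x) + a"
    if "b \<in> keys (der h (tri V L))" for b
  proof -
    from that obtain i where "b \<in> keys (der h (single (\<mu> i) 1))"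
      unfolding tri_def der_sum
      using Poly_Mapping.keys_sum[of "\<lambda>i. der h (single (\<mu> i) 1)" "{..<3}"] by blast
    then show ?thesis using keys_dh by blast
  qed
  have h0: "h v = 0" if v: "v \<in> V" for v
  proof (rule ccontr)
    assume "h v \<noteq> 0"
    then have "keys (h v) \<noteq> {}" by simp
    then obtain a where a: "a \<in> keys (h v)" by blast
    have two: "L v \<ge> 2" using h_two[OF v a] .
    have mu_v: "\<mu> (fst v) = single v (L v)"
    proof -
      have "x \<in> V \<and> fst x = fst v \<longleftrightarrow> x = v" for x using h_single[OF v a] v by metis
      then show ?thesis
        by (auto intro!: poly_mapping_eqI simp: lookup_block_exp lookup_single when_def)
    qed
    \<comment> \<open>Differentiating \<open>v\<close> lowers its exponent by one. Differentiating
      another \<open>x\<close> leaves in \<open>v\<close> only the exponent that comes from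
      \<open>h x\<close>, which is at most \<open>L v / L x\<close>.\<close>
    have exp_v: "(x = v \<and> lookup b v = L v - 1) \<or> (x \<noteq> v \<and> lookup b v * L x \<le> L v \<and> L x \<ge> 2)"
      if x: "x \<in> V" "a' \<in> keys (h x)" "b + single x 1 = \<mu> (fst x) + a'" for x a' b
    proof (cases "x = v")
      case True
      have "lookup b v + 1 = L v"
        using arg_cong[OF x(3), of "\<lambda>m. lookup m v"] h_zero[OF x(1,2)] True v
        by (simp add: lookup_add lookup_block_exp)
      then show ?thesis using True by simp
    next
      case False
      have "fst x \<noteq> fst v" using h_single[OF v a x(1)] False by blast
      then have "lookup b v = lookup a' v"
        using arg_cong[OF x(3), of "\<lambda>m. lookup m v"] False
        by (simp add: lookup_add lookup_block_exp lookup_single)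
      then show ?thesis using h_le[OF x(1,2) v] h_two[OF x(1,2)] False by simp
    qed
    have "S' v = 0"
    proof (rule vanishes_low_degree[OF S'_over S'_van v])
      fix b assume "b \<in> keys (S' v)"
      then consider i where "i \<noteq> fst v" "b = \<mu> i" | "b \<in> keys (der h (tri V L))"
        using keys_S' by blast
      then show "lookup b v < L v"
      proof cases
        case 1
        then show ?thesis using two by (simp add: lookup_block_exp)
      next
        case 2
        then obtain x a' where x: "x \<in> V" "a' \<in> keys (h x)" "b + single x 1 = \<mu> (fst x) + a'"
          using keys_dh_tri by blast
        from exp_v[OF this] show ?thesis
        proof
          assume "x \<noteq> v \<and> lookup b v * L x \<le> L v \<and> L x \<ge> 2"
          then have "lookup b v * 2 \<le> lookup b v * L x" "lookup b v * L x \<le> L v" by auto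
          then show ?thesis using two by linarith
        qed (use two in auto)
      qed
    qed
    \<comment> \<open>The term that \<open>a\<close> produces when one factor \<open>v\<close> of
      its block is differentiated. Its coefficient will be \<open>L v\<close> times that of
      \<open>a\<close> in \<open>h v\<close>.\<close>
    define b where "b = single v (L v - 1) + a"
    have b_v: "lookup b v = L v - 1" using h_zero[OF v a] by (simp add: b_def lookup_add)
    have "b \<noteq> \<mu> i" for i
      using arg_cong[of b "\<mu> i" "\<lambda>m. lookup m v"] b_v two h_zero[OF v a]
      by (auto simp: lookup_block_exp split: if_splits)
    then have "0 = lookup (der h (tri V L)) b"
      using lookup_S'[of v b] \<open>S' v = 0\<close> by simp
    also have "\<dots> = (\<Sum>i<3. lookup (der h (single (\<mu> i) 1)) b)"
      by (simp add: tri_def der_sum lookup_sum)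
    also have "\<dots> = (\<Sum>i<3. if i = fst v then lookup (der h (single (\<mu> i) 1)) b else 0)"
    proof (intro sum.cong refl)
      fix i assume "i \<in> {..<3::nat}"
      have "lookup (der h (single (\<mu> i) 1)) b = 0" if "i \<noteq> fst v"
      proof (rule ccontr)
        assume "lookup (der h (single (\<mu> i) 1)) b \<noteq> 0"
        then obtain x a' where x: "x \<in> V" "fst x = i" "a' \<in> keys (h x)" "b + single x 1 = \<mu> (fst x) + a'"
          using keys_dh[of b i] by (auto simp: in_keys_iff)
        then have "x \<noteq> v" using that by auto
        then have le: "(L v - 1) * L x \<le> L v" and "L x \<ge> 2"
          using exp_v[OF x(1,3,4)] b_v by auto
        \<comment> \<open>With both exponents at least 2, the bound
          \<open>(L v - 1) * L x \<le> L v\<close> leaves only \<open>L v = L x = 2\<close>.\<close>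
        then have "(L v - 1) * 2 \<le> L v" using mult_le_mono2[of 2 "L x" "L v - 1"] by linarith
        then have "L v = 2" using two by linarith
        then have "L x = 2" using le \<open>L x \<ge> 2\<close> by simp
        show False
          using no_squares[OF x(1) v \<open>x \<noteq> v\<close> \<open>L x = 2\<close> \<open>L v = 2\<close>] h_single[OF x(1,3)] h_single[OF v a]
          by blast
      qed
      then show "lookup (der h (single (\<mu> i) 1)) b =
          (if i = fst v then lookup (der h (single (\<mu> i) 1)) b else 0)" by simp
    qed
    also have "\<dots> = lookup (der h (single (\<mu> (fst v)) 1)) b"
      using fst_less[OF v] by (simp add: sum.delta)
    also have "der h (single (\<mu> (fst v)) 1) =
        mpoly_const (of_nat (L v)) * (single (single v (L v - 1)) 1 * h v)"
    proof -
      obtain k where k: "L v = Suc k" using two by (cases "L v") auto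
      show ?thesis
        unfolding mu_v single_var_power k der_power der_var mpoly_const_of_nat by (simp add: mult.assoc)
    qed
    also have "lookup \<dots> b = of_nat (L v) * lookup (h v) a"
      unfolding b_def lookup_const_mult lookup_single_mult by simp
    finally show False using two a by (simp add: in_keys_iff)
  qed
  have dh0: "der h (tri V L) = 0"
  proof -
    have "der h (tri V L) = der (\<lambda>_. 0) (tri V L)" using h0 by (intro der_cong[OF tri_over])
    also have "\<dots> = 0" using der_field_mult[of "\<lambda>_. 0" 0 "tri V L"] by simp
    finally show ?thesis .
  qed
  \<comment> \<open>As \<open>h\<close> is zero, removing the monomial of block 0 leaves a
    combination of the two others. It vanishes on the hypersurface and does not involve block 0, so
    it is zero.\<close>
  have "weight c (\<mu> i) = weight c (\<mu> 0)" if "i < 3" for i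
  proof (cases "i = 0")
    case False
    obtain v where v: "v \<in> V" "fst v = 0" using block_nonempty[of 0] by auto
    have "S' v = 0"
    proof (rule vanishes_low_degree[OF S'_over S'_van v(1)])
      fix b assume "b \<in> keys (S' v)"
      then obtain j where "j \<noteq> fst v" "b = \<mu> j" 
        using keys_S'[of b v] unfolding dh0 by auto
      then show "lookup b v < L v" using L_pos[OF v(1)] by (simp add: lookup_block_exp)
    qed
    then have "0 = lookup (S' v) (\<mu> i)" by simp
    also have "\<dots> = (\<Sum>j<3. if j = i then weight c (\<mu> j) - weight c (\<mu> (fst v)) else 0)"
      unfolding lookup_S' dh0 using that by (simp add: block_exp_inj eq_commute[of i] cong: if_cong)
    also have "\<dots> = weight c (\<mu> i) - weight c (\<mu> 0)" using that v by (simp add: sum.delta)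
    finally show ?thesis by simp
  qed simp
  moreover have "D v = mpoly_const (c v) * mpoly_var v" if "v \<in> V" for v
    using h0[OF that] by (simp add: h_def)
  ultimately show ?thesis using that by blast
qed

text \<open>The transported derivation is congruent to its part of degree zero for the whole torus
  of \<open>V\<close>. This part still maps the trinomial to a vanishing polynomial, so it is
  diagonal.\<close>

lemma transfer_field_diagonal:
  fixes Y :: "('w \<Rightarrow> 'a::{alg_closed_field, field_char_0}) set"
  assumes iso: "mpoly_iso V (tri_locus V L) W Y F G" and rigid: "rigid V (tri_locus V L :: (_ \<Rightarrow> 'a) set)"
    and u: "weight_stable Y u"
  obtains c d where "\<And>v. v \<in> V \<Longrightarrow> vanishes (tri_locus V L)
      (mpoly_subst G (euler (\<lambda>w. of_nat (u w)) (F v)) - mpoly_const (c v) * mpoly_var v)"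
    and "\<And>i. i < 3 \<Longrightarrow> weight c (\<mu> i) = d"
proof -
  interpret mpoly_iso V "tri_locus V L" W Y F G by (fact iso)
  let ?T = "transfer_field u"
  define D where "D v = mrestrict (\<lambda>a. \<forall>w\<in>tri_weights V L. weight w a = w v) (?T v)" for v
  have eq: "vanishes (tri_locus V L) (?T v - D v)" if "v \<in> V" for v
    unfolding D_def
    by (rule transfer_field_homogeneous[OF tri_locus_def tri_over rigid u tri_weights_stable that])
  have D_over: "D v \<in> mpolys_over V" if "v \<in> V" for v
    unfolding D_def using that by (intro over_mrestrict transfer_field_over)
  have diff: "vanishes (tri_locus V L) (der (\<lambda>v. ?T v - D v) (tri V L))"
    using eq by (intro vanishes_der[OF tri_over])
  have "der ?T (tri V L) = der (\<lambda>v. D v + (?T v - D v)) (tri V L)" by simp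
  also have "\<dots> = der D (tri V L) + der (\<lambda>v. ?T v - D v) (tri V L)"
    by (rule der_field_add)
  finally have eq': "der D (tri V L) = der ?T (tri V L) - der (\<lambda>v. ?T v - D v) (tri V L)"
    by simp
  have van: "vanishes (tri_locus V L) (der D (tri V L))"
    unfolding eq' by (intro vanishes_minus diff transfer_field_pres[OF u tri_over vanishes_tri])
  obtain c d where c: "\<And>v. v \<in> V \<Longrightarrow> D v = mpoly_const (c v) * mpoly_var v"
    and d: "\<And>i. i < 3 \<Longrightarrow> weight c (\<mu> i) = d"
  proof (rule homogeneous_derivation_diagonal[OF _ D_over _ van])
    fix u v assume "u \<in> V" "v \<in> V" "u \<noteq> v" "L u = 2" "L v = 2"
      "\<And>x. x \<in> V \<Longrightarrow> fst x = fst u \<Longrightarrow> x = u" "\<And>x. x \<in> V \<Longrightarrow> fst x = fst v \<Longrightarrow> x = v"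
    then show False using rigid_no_two_squares[OF rigid] by blast
  qed (auto simp: D_def keys_mrestrict)
  show ?thesis
  proof (rule that)
    fix v assume "v \<in> V"
    then show "vanishes (tri_locus V L)
      (mpoly_subst G (euler (\<lambda>w. of_nat (u w)) (F v)) - mpoly_const (c v) * mpoly_var v)"
      using eq c by (simp add: transfer_field_def)
  qed (rule d)
qed

end

subsection \<open>Comparison of the gradings\<close>

lemma vanishes_const_mult:
  fixes p :: "('v, 'a::field) mpoly"
  shows "vanishes X (mpoly_const c * p) \<Longrightarrow> c \<noteq> 0 \<Longrightarrow> vanishes X p"
  by (auto simp: vanishes_def eval.hom_mult)

text \<open>The component of weight \<open>k\<close> of the assumed relation is \<open>k - c\<close>
  times that of \<open>p\<close>.\<close>

lemma vanishes_euler_eigenvector: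
  fixes p :: "('v, 'a::field_char_0) mpoly"
  assumes "vanishes X (euler (\<lambda>v. of_nat (u v)) p - mpoly_const c * p)" "weight_stable X u"
    and "of_nat k \<noteq> c"
  shows "vanishes X (mrestrict (\<lambda>m. weight u m = k) p)"
proof -
  have "vanishes X (mrestrict (\<lambda>m. weight u m = k) (euler (\<lambda>v. of_nat (u v)) p - mpoly_const c * p))"
    using assms by (intro vanishes_component)
  also have "mrestrict (\<lambda>m. weight u m = k) (euler (\<lambda>v. of_nat (u v)) p - mpoly_const c * p)
      = mpoly_const (of_nat k - c) * mrestrict (\<lambda>m. weight u m = k) p"
    by (rule poly_mapping_eqI)
      (auto simp: lookup_mrestrict lookup_minus lookup_euler lookup_const_mult weight_of_nat left_diff_distrib)
  finally show ?thesis by (rule vanishes_const_mult) (use assms(3) in simp)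
qed

lemma weight_cong: "(\<And>v. v \<in> keys m \<Longrightarrow> w v = w' v) \<Longrightarrow> weight w m = weight w' m"
  by (simp add: weight_def)

lemma vanishes_subst_cong:
  assumes "p \<in> mpolys_over V" "\<And>v. v \<in> V \<Longrightarrow> vanishes Y (F v - F' v)"
  shows "vanishes Y (mpoly_subst F p - mpoly_subst F' p)"
  using assms(1)
proof (induction p rule: mpoly_over_induct)
  case (var p v)
  have "vanishes Y ((mpoly_subst F p - mpoly_subst F' p) * F v + mpoly_subst F' p * (F v - F' v))"
    using var assms(2) by (intro vanishes_add vanishes_mult_right vanishes_mult_left[of _ "F v - F' v"])
  then show ?case by (simp add: subst.hom_mult algebra_simps)
next
  case (add p q)
  then have "vanishes Y (mpoly_subst F p - mpoly_subst F' p + (mpoly_subst F q - mpoly_subst F' q))"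
    by (rule vanishes_add)
  then show ?case by (simp add: subst.hom_add algebra_simps)
qed simp

text \<open>Only the classes of \<open>F\<close> and \<open>G\<close> modulo vanishing polynomials
  matter, as substitution respects them.\<close>

lemma (in mpoly_iso) replace:
  assumes F': "\<And>v. v \<in> V \<Longrightarrow> F' v \<in> mpolys_over W" "\<And>v. v \<in> V \<Longrightarrow> vanishes Y (F v - F' v)"
    and G': "\<And>w. w \<in> W \<Longrightarrow> G' w \<in> mpolys_over V" "\<And>w. w \<in> W \<Longrightarrow> vanishes X (G w - G' w)"
  shows "mpoly_iso V X W Y F' G'"
proof -
  have F'_pull: "vanishes Y (mpoly_subst F' p)" if "p \<in> mpolys_over V" "vanishes X p" for p
    using vanishes_cong[OF vanishes_subst_cong[of p V Y F F', OF that(1) F'(2)]] F_pull that by blast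
  have G'_pull: "vanishes X (mpoly_subst G' q)" if "q \<in> mpolys_over W" "vanishes Y q" for q
    using vanishes_cong[OF vanishes_subst_cong[of q W X G G', OF that(1) G'(2)]] G_pull that by blast
  have GF': "vanishes X (mpoly_subst G' (mpoly_subst F' p) - p)" if p: "p \<in> mpolys_over V" for p
  proof -
    have o: "mpoly_subst F p \<in> mpolys_over W" "mpoly_subst F' p \<in> mpolys_over W"
      using p F_over F'(1) by (auto intro: over_subst)
    have "vanishes X (mpoly_subst G' (mpoly_subst F' p - mpoly_subst F p))"
      using o vanishes_sym[OF vanishes_subst_cong[of p V Y F F', OF p F'(2)]] by (intro G'_pull over_minus)
    then have "vanishes X (mpoly_subst G' (mpoly_subst F' p) - mpoly_subst G' (mpoly_subst F p))"
      by (simp add: subst.hom_minus)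
    moreover have "vanishes X (mpoly_subst G' (mpoly_subst F p) - mpoly_subst G (mpoly_subst F p))"
      using vanishes_sym[OF vanishes_subst_cong[of _ W X G G', OF o(1) G'(2)]] by blast
    ultimately show ?thesis using GF[OF p] vanishes_trans by blast
  qed
  have FG': "vanishes Y (mpoly_subst F' (mpoly_subst G' q) - q)" if q: "q \<in> mpolys_over W" for q
  proof -
    have o: "mpoly_subst G q \<in> mpolys_over V" "mpoly_subst G' q \<in> mpolys_over V"
      using q G_over G'(1) by (auto intro: over_subst)
    have "vanishes Y (mpoly_subst F' (mpoly_subst G' q - mpoly_subst G q))"
      using o vanishes_sym[OF vanishes_subst_cong[of q W X G G', OF q G'(2)]] by (intro F'_pull over_minus)
    then have "vanishes Y (mpoly_subst F' (mpoly_subst G' q) - mpoly_subst F' (mpoly_subst G q))"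
      by (simp add: subst.hom_minus)
    moreover have "vanishes Y (mpoly_subst F' (mpoly_subst G q) - mpoly_subst F (mpoly_subst G q))"
      using vanishes_sym[OF vanishes_subst_cong[of _ V Y F F', OF o(1) F'(2)]] by blast
    ultimately show ?thesis using FG[OF q] vanishes_trans by blast
  qed
  show ?thesis
    by unfold_locales (fact finite_V finite_W F'(1) G'(1) F'_pull G'_pull GF' FG')+
qed

section \<open>Linear parts and weights under substitution\<close>

lemma single_Suc_ne_zero [simp]: "single v (Suc k) \<noteq> 0"
  by (metis lookup_single_eq lookup_zero nat.distinct(1))

lemma lookup_var_zero_exp [simp]: "lookup (mpoly_var v :: ('v, 'a::comm_ring_1) mpoly) 0 = 0"
  by (simp add: mpoly_var_def lookup_single)

lemma lookup_mult_zero_exp: "lookup (p * q) 0 = lookup p 0 * lookup q 0"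
  for p q :: "('v, 'a::comm_ring_1) mpoly"
proof (induction q rule: mpoly_induct)
  case (const c)
  show ?case by (simp add: mult.commute[of p] lookup_const_mult) (simp add: mpoly_const_def)
next
  case (var q v)
  then show ?case by (simp add: mult.assoc[symmetric] lookup_mult_var)
qed (simp add: distrib_left lookup_add)

lemma lookup_mult_linear:
  fixes p q :: "('v, 'a::comm_ring_1) mpoly"
  shows "lookup (p * q) (single v 1) =
    lookup p 0 * lookup q (single v 1) + lookup p (single v 1) * lookup q 0"
proof (induction q rule: mpoly_induct)
  case (const c)
  show ?case by (simp add: mult.commute[of p] lookup_const_mult)
      (simp add: mpoly_const_def lookup_single when_def)
next
  case (var q u)
  then show ?case
    by (simp add: mult.assoc[symmetric] lookup_mult_var lookup_mult_zero_exp lookup_single when_def)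
qed (simp add: distrib_left lookup_add algebra_simps)

text \<open>The chain rule at the origin: as \<open>G\<close> has no constant terms, linear parts
  multiply like matrices.\<close>

lemma linear_coeff_subst:
  assumes p: "p \<in> mpolys_over W" and "finite W" and G: "\<And>w. w \<in> W \<Longrightarrow> lookup (G w) 0 = 0"
  shows "lookup (mpoly_subst G p) 0 = lookup p 0 \<and> lookup (mpoly_subst G p) (single v 1) =
    (\<Sum>w\<in>W. lookup p (single w 1) * lookup (G w) (single v 1))"
  using p
proof (induction p rule: mpoly_over_induct)
  case (const c)
  show ?case unfolding subst_const by (simp add: mpoly_const_def lookup_single when_def)
next
  case (var p w)
  have "(\<Sum>u\<in>W. lookup (p * mpoly_var w) (single u 1) * lookup (G u) (single v 1))
      = (\<Sum>u\<in>W. if u = w then lookup p 0 * lookup (G w) (single v 1) else 0)"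
    by (intro sum.cong) (auto simp: lookup_mult_var lookup_single when_def)
  also have "\<dots> = lookup p 0 * lookup (G w) (single v 1)"
    using var(3) \<open>finite W\<close> by (simp add: sum.delta)
  also have "\<dots> = lookup (mpoly_subst G (p * mpoly_var w)) (single v 1)"
    unfolding subst.hom_mult subst_var lookup_mult_linear using var G by simp
  finally show ?case
    using G[OF var(3)] by (simp add: subst.hom_mult lookup_mult_zero_exp)
next
  case (add p q)
  then show ?case by (simp add: subst.hom_add lookup_add distrib_right sum.distrib)
qed

lemma weight_keys_subst:
  assumes p: "p \<in> mpolys_over V" and F: "\<And>v a. v \<in> V \<Longrightarrow> a \<in> keys (F v) \<Longrightarrow> weight u a = k v"
    and b: "b \<in> keys (mpoly_subst F p)"
  shows "\<exists>m\<in>keys p. weight u b = weight k m"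
proof -
  have single: "\<forall>b\<in>keys (mpoly_subst F (single m c)). weight u b = weight k m" if "keys m \<subseteq> V" for m c
    using that
  proof (induction m rule: monomial_induct)
    case zero
    show ?case using subst_const[of F c] by (auto simp: mpoly_const_def split: if_splits)
  next
    case (plus m v)
    show ?case
    proof
      fix b assume "b \<in> keys (mpoly_subst F (single (m + single v 1) c))"
      then have "b \<in> keys (mpoly_subst F (single m c) * F v)"
        unfolding single_plus_var by (simp add: subst.hom_mult)
      then obtain b' a where "b' \<in> keys (mpoly_subst F (single m c))" "a \<in> keys (F v)" "b = b' + a"
        using keys_mult[of "mpoly_subst F (single m c)" "F v"] by blast
      then show "weight u b = weight k (m + single v 1)"
        using plus F by (simp add: weight_add)
    qed
  qed
  have "mpoly_subst F p = (\<Sum>m\<in>keys p. mpoly_subst F (single m (lookup p m)))"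
    by (subst mpoly_sum_monomials) (rule subst.hom_sum)
  then obtain m where m: "m \<in> keys p" "b \<in> keys (mpoly_subst F (single m (lookup p m)))"
    using b Poly_Mapping.keys_sum[of "\<lambda>m. mpoly_subst F (single m (lookup p m))" "keys p"] by auto
  moreover have "keys m \<subseteq> V" using p m by (auto simp: mpolys_over_def)
  ultimately show ?thesis using single by blast
qed

lemma bij_betw_fibres:
  assumes "finite V" "finite W"
    and card: "\<And>t. card {v\<in>V. p v = t} = card {w\<in>W. q w = t}"
  shows "\<exists>\<sigma>. bij_betw \<sigma> V W \<and> (\<forall>v\<in>V. q (\<sigma> v) = p v)"
proof -
  have "\<exists>h. bij_betw h {v\<in>V. p v = t} {w\<in>W. q w = t}" for t
    using assms by (intro finite_same_card_bij) auto
  then obtain h where h: "\<And>t. bij_betw (h t) {v\<in>V. p v = t} {w\<in>W. q w = t}" by metis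
  define \<sigma> where "\<sigma> v = h (p v) v" for v
  have in_W: "\<sigma> v \<in> W \<and> q (\<sigma> v) = p v" if "v \<in> V" for v
    using bij_betwE[OF h[of "p v"]] that by (auto simp: \<sigma>_def)
  have "bij_betw \<sigma> V W"
  proof (rule bij_betwI')
    fix v v' assume "v \<in> V" "v' \<in> V"
    moreover from this have "\<sigma> v = \<sigma> v' \<Longrightarrow> p v = p v'" using in_W by metis
    ultimately show "\<sigma> v = \<sigma> v' \<longleftrightarrow> v = v'"
      using bij_betw_imp_inj_on[OF h[of "p v"]] by (auto simp: \<sigma>_def inj_on_def)
  next
    fix w assume "w \<in> W"
    then have "w \<in> h (q w) ` {v\<in>V. p v = q w}"
      using bij_betw_imp_surj_on[OF h[of "q w"]] by auto
    then show "\<exists>v\<in>V. w = \<sigma> v" by (auto simp: \<sigma>_def intro!: bexI)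
  qed (use in_W in auto)
  then show ?thesis using in_W by blast
qed

section \<open>Gradings under an isomorphism of trinomial hypersurfaces\<close>

locale trinomial_iso = mpoly_iso V X W Y F G + source: trinomial_setup V L + target: trinomial_setup W L'
  for V :: "(nat \<times> nat) set" and X :: "(nat \<times> nat \<Rightarrow> 'a::{alg_closed_field, field_char_0}) set"
    and W :: "(nat \<times> nat) set" and Y :: "(nat \<times> nat \<Rightarrow> 'a) set" and F G L L' +
  assumes X: "X = tri_locus V L" and Y: "Y = tri_locus W L'"
begin

text \<open>The transported Euler derivation multiplies each variable \<open>v\<close> by a scalar.
  This scalar is the weight of the function \<open>F v\<close> on \<open>Y\<close>, hence a natural
  number, and these numbers form a weight of the torus of \<open>V\<close>.\<close>

lemma transferred_weight:
  assumes rigid: "rigid V X" and u: "u \<in> tri_weights W L'"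
  shows "\<exists>k\<in>tri_weights V L.
    (\<forall>v\<in>V. vanishes Y (F v - mrestrict (\<lambda>a. weight u a = k v) (F v))) \<and>
    (\<forall>w\<in>W. vanishes X (G w - mrestrict (\<lambda>a. weight k a = u w) (G w)))"
proof -
  have stable: "weight_stable Y u" unfolding Y by (rule target.tri_weights_stable[OF u])
  let ?E = "euler (\<lambda>w. of_nat (u w)) :: (nat \<times> nat, 'a) mpoly \<Rightarrow> _"
  obtain c d where c: "\<And>v. v \<in> V \<Longrightarrow> vanishes X
      (mpoly_subst G (?E (F v)) - mpoly_const (c v) * mpoly_var v)"
    and d: "\<And>i. i < 3 \<Longrightarrow> weight c (block_exp V L i) = d"
    using source.transfer_field_diagonal[OF mpoly_iso_axioms[unfolded X] rigid[unfolded X] stable]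
    unfolding X by metis
  have eigen: "vanishes Y (?E (F v) - mpoly_const (c v) * F v)" if v: "v \<in> V" for v
  proof -
    have E: "?E (F v) \<in> mpolys_over W" by (intro euler_over F_over v)
    have "vanishes Y (mpoly_subst F (mpoly_subst G (?E (F v)) - mpoly_const (c v) * mpoly_var v))"
      using v E G_over by (intro F_pull c over_minus over_mult over_subst[OF E]) auto
    then have "vanishes Y (mpoly_subst F (mpoly_subst G (?E (F v))) - mpoly_const (c v) * F v)"
      by (simp add: subst.hom_minus subst.hom_mult)
    then show ?thesis using FG[OF E] vanishes_sym vanishes_trans by blast
  qed
  \<comment> \<open>An eigenvalue that is not a natural number would make all components of
    \<open>F v\<close> vanish. Then the variable \<open>v\<close> would vanish on \<open>X\<close>,
    against its linear coefficient.\<close>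
  have nat: "\<exists>k. c v = of_nat k" if v: "v \<in> V" for v
  proof (rule ccontr)
    assume "\<nexists>k. c v = of_nat k"
    then have "vanishes Y (mrestrict (\<lambda>m. weight u m = k) (F v))" for k
      using vanishes_euler_eigenvector[OF eigen[OF v] stable, of k] by metis
    then have "vanishes Y (\<Sum>k\<in>weight u ` keys (F v). mrestrict (\<lambda>m. weight u m = k) (F v))"
      by (intro vanishes_sum)
    then have "vanishes Y (F v)" by (simp only: sum_mrestrict)
    then have "vanishes X (mpoly_subst G (F v))" by (intro G_pull F_over v)
    then have "vanishes X (mpoly_var v)"
      using vanishes_cong[OF GF[of "mpoly_var v"]] v by simp
    then have "lookup (mpoly_var v :: (nat \<times> nat, 'a) mpoly) (single v 1) = 0"
      using v unfolding X by (intro source.vanishes_linear_coeff) auto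
    then show False by (simp add: mpoly_var_def)
  qed
  define k where "k v = (if v \<in> V then SOME k. c v = of_nat k else 0)" for v
  have k: "c v = of_nat (k v)" if "v \<in> V" for v
    using someI_ex[OF nat[OF that]] that by (simp add: k_def)
  have wc: "weight c m = of_nat (weight k m)" if "keys m \<subseteq> V" for m
    unfolding weight_of_nat[symmetric] using k that by (intro weight_cong) auto
  have k_in: "k \<in> tri_weights V L"
  proof -
    have "weight k (block_exp V L i) = weight k (block_exp V L 0)" if "i < 3" for i
    proof -
      have "(of_nat (weight k (block_exp V L i)) :: 'a) = of_nat (weight k (block_exp V L 0))"
        using d[OF that] d[of 0] by (simp add: wc[symmetric] source.keys_block_exp)
      then show ?thesis by (simp only: of_nat_eq_iff)
    qed
    moreover have "\<forall>v. v \<notin> V \<longrightarrow> k v = 0" by (simp add: k_def)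
    ultimately show ?thesis unfolding tri_weights_def by blast
  qed
  have stable': "weight_stable X k" unfolding X by (rule source.tri_weights_stable[OF k_in])
  have "vanishes Y (F v - mrestrict (\<lambda>a. weight u a = k v) (F v))" if "v \<in> V" for v
    using vanishes_euler_eigenvector[OF eigen[OF that] stable] k[OF that]
    by (intro vanishes_off_component) auto
  \<comment> \<open>On \<open>X\<close> the transported derivation is the Euler derivation of
    \<open>k\<close>, and \<open>G w\<close> is an eigenvector of it with eigenvalue
    \<open>u w\<close>.\<close>
  moreover have "vanishes X (G w - mrestrict (\<lambda>a. weight k a = u w) (G w))" if w: "w \<in> W" for w
  proof -
    let ?T = "transfer_field u"
    let ?C = "\<lambda>v. mpoly_const (of_nat (k v)) * mpoly_var v :: (nat \<times> nat, 'a) mpoly"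
    have Gw: "G w \<in> mpolys_over V" using w by (rule G_over)
    have "vanishes X (der (\<lambda>v. ?T v - ?C v) (G w))"
      using c k by (intro vanishes_der[OF Gw]) (simp add: transfer_field_def)
    moreover have "der ?T (G w) = der ?C (G w) + der (\<lambda>v. ?T v - ?C v) (G w)"
      unfolding der_field_add[symmetric] by simp
    ultimately have "vanishes X (der ?T (G w) - der ?C (G w))" by simp
    then have 1: "vanishes X (der ?C (G w) - der ?T (G w))" by (rule vanishes_sym)
    have 2: "vanishes X (der ?T (G w) - mpoly_subst G (?E (mpoly_subst F (G w))))"
      by (rule der_transfer_field[OF Gw])
    have 3: "vanishes X (mpoly_subst G (?E (mpoly_subst F (G w))) - mpoly_const (of_nat (u w)) * G w)"
    proof -
      have "vanishes Y (?E (mpoly_subst F (G w) - mpoly_var w))"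
        using FG[of "mpoly_var w"] w stable by (intro vanishes_euler) auto
      moreover have "?E (mpoly_subst F (G w) - mpoly_var w) \<in> mpolys_over W"
        using w by (intro euler_over over_minus over_subst[OF Gw] F_over) auto
      ultimately have "vanishes X (mpoly_subst G (?E (mpoly_subst F (G w) - mpoly_var w)))"
        by (intro G_pull)
      then show ?thesis
        by (simp add: euler_def der_minus subst.hom_minus subst.hom_mult)
    qed
    have "vanishes X (euler (\<lambda>v. of_nat (k v)) (G w) - mpoly_const (of_nat (u w)) * G w)"
      using vanishes_trans[OF vanishes_trans[OF 1 2] 3] by (simp add: euler_def)
    from vanishes_euler_eigenvector[OF this stable'] show ?thesis
      by (intro vanishes_off_component) auto
  qed
  ultimately show ?thesis using k_in by blast
qed

end

text \<open>The torus of the second trinomial acts through that of the first: the weight \<open>u\<close> on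
  \<open>W\<close> corresponds to \<open>\<kappa> u\<close> on \<open>V\<close>.\<close>

locale graded_trinomial_iso = trinomial_iso +
  fixes \<kappa>
  assumes \<kappa>: "u \<in> tri_weights W L' \<Longrightarrow> \<kappa> u \<in> tri_weights V L"
    and F_hom: "v \<in> V \<Longrightarrow> a \<in> keys (F v) \<Longrightarrow> u \<in> tri_weights W L' \<Longrightarrow> weight u a = \<kappa> u v"
    and G_hom: "w \<in> W \<Longrightarrow> b \<in> keys (G w) \<Longrightarrow> u \<in> tri_weights W L' \<Longrightarrow> weight (\<kappa> u) b = u w"

lemma (in trinomial_iso) graded:
  assumes rigid: "rigid V X"
  obtains F' G' \<kappa> where "graded_trinomial_iso V X W Y F' G' L L' \<kappa>"
proof -
  let ?T = "tri_weights W L'"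
  obtain \<kappa> where \<kappa>: "\<And>u. u \<in> ?T \<Longrightarrow> \<kappa> u \<in> tri_weights V L"
    and F: "\<And>u v. u \<in> ?T \<Longrightarrow> v \<in> V \<Longrightarrow>
      vanishes Y (F v - mrestrict (\<lambda>a. weight u a = \<kappa> u v) (F v))"
    and G: "\<And>u w. u \<in> ?T \<Longrightarrow> w \<in> W \<Longrightarrow>
      vanishes X (G w - mrestrict (\<lambda>a. weight (\<kappa> u) a = u w) (G w))"
    using transferred_weight[OF rigid] by metis
  define F' where "F' v = mrestrict (\<lambda>a. \<forall>u\<in>?T. weight u a = \<kappa> u v) (F v)" for v
  define G' where "G' w = mrestrict (\<lambda>a. \<forall>u\<in>?T. weight (\<kappa> u) a = u w) (G w)" for w
  have "vanishes Y (F v - F' v)" if "v \<in> V" for v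
    unfolding F'_def
  proof (rule vanishes_homogeneous_part)
    show "weight_stable Y u" if "u \<in> ?T" for u
      unfolding Y by (rule target.tri_weights_stable[OF that])
  qed (rule F[OF _ that])
  moreover have "vanishes X (G w - G' w)" if "w \<in> W" for w
    unfolding G'_def
  proof (rule vanishes_homogeneous_part)
    show "weight_stable X (\<kappa> u)" if "u \<in> ?T" for u
      unfolding X by (rule source.tri_weights_stable[OF \<kappa>[OF that]])
  qed (rule G[OF _ that])
  ultimately have "mpoly_iso V X W Y F' G'"
    by (intro replace) (auto simp: F'_def G'_def intro!: over_mrestrict F_over G_over)
  then have "graded_trinomial_iso V X W Y F' G' L L' \<kappa>"
    using \<kappa> X Y source.trinomial_setup_axioms target.trinomial_setup_axioms
    by (auto simp: graded_trinomial_iso_def trinomial_iso_def trinomial_iso_axioms_def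
        graded_trinomial_iso_axioms_def F'_def G'_def keys_mrestrict)
  then show ?thesis by (rule that)
qed

context graded_trinomial_iso
begin

text \<open>A transversal through \<open>w\<close> has a positive entry at \<open>w\<close> and so
  detects \<open>w\<close> in every monomial.\<close>

lemma positive_weight:
  assumes "w \<in> W"
  obtains u where "u \<in> tri_weights W L'" "\<And>a. weight u a = 0 \<Longrightarrow> lookup a w = 0" "u w > 0"
proof -
  obtain y z where yz: "y \<in> W" "z \<in> W" "fst y \<noteq> fst w" "fst z \<noteq> fst w" "fst y \<noteq> fst z"
    using target.other_blocks[OF assms] by metis
  let ?u = "target.transversal_weight w y z"
  have pos: "L' y > 0" "L' z > 0" using yz target.L_pos by auto
  show ?thesis
  proof (rule that)
    show "?u \<in> tri_weights W L'"
      using yz assms by (intro target.transversal_weight_in) auto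
    show "lookup a w = 0" if "weight ?u a = 0" for a
      using that pos by (simp add: target.weight_transversal)
    show "?u w > 0" using pos by (simp add: target.transversal_weight_def)
  qed
qed

lemma G_zero_exp: "lookup (G w) 0 = 0" if w: "w \<in> W"
proof (rule ccontr)
  assume "lookup (G w) 0 \<noteq> 0"
  then have "0 \<in> keys (G w)" by (simp add: in_keys_iff)
  moreover obtain u where "u \<in> tri_weights W L'" "u w > 0" using positive_weight[OF w] by metis
  ultimately show False using G_hom[OF w, of 0 u] by simp
qed

text \<open>Unlike the weight \<open>u w\<close> of \<open>G w\<close>, the weight
  \<open>\<kappa> u v\<close> of \<open>F v\<close> might be 0. But a constant term would force this
  for all \<open>u\<close>, so \<open>F v\<close> would be constant, and \<open>v\<close> constant
  on \<open>X\<close>.\<close>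

lemma F_zero_exp: "lookup (F v) 0 = 0" if v: "v \<in> V"
proof (rule ccontr)
  assume "lookup (F v) 0 \<noteq> 0"
  then have z: "0 \<in> keys (F v)" by (simp add: in_keys_iff)
  have "a = 0" if a: "a \<in> keys (F v)" for a
  proof -
    have "keys a = {}"
    proof (rule ccontr)
      assume "keys a \<noteq> {}"
      then obtain w where w: "w \<in> keys a" by blast
      have "keys a \<subseteq> W" using F_over[OF v] a by (auto simp: mpolys_over_def)
      then have "w \<in> W" using w by blast
      then obtain u where u: "u \<in> tri_weights W L'" "\<And>a. weight u a = 0 \<Longrightarrow> lookup a w = 0"
        using positive_weight by metis
      have "weight u a = weight u 0" using F_hom[OF v a u(1)] F_hom[OF v z u(1)] by simp
      then show False using u(2)[of a] w by (simp add: in_keys_iff)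
    qed
    then show ?thesis by simp
  qed
  then have "F v = mpoly_const (lookup (F v) 0)"
    by (intro poly_mapping_eqI) (auto simp: mpoly_const_def lookup_single when_def in_keys_iff)
  then have "mpoly_subst G (F v) = mpoly_const (lookup (F v) 0)" by (metis subst_const)
  then have "vanishes X (mpoly_const (lookup (F v) 0) - mpoly_var v)"
    using GF[of "mpoly_var v"] v by simp
  then have "lookup (mpoly_const (lookup (F v) 0) - mpoly_var v) (single v 1) = 0"
    using v unfolding X by (intro source.vanishes_linear_coeff over_minus) auto
  then show False
    by (simp add: lookup_minus mpoly_const_def mpoly_var_def lookup_single when_def)
qed

abbreviation "A v w \<equiv> lookup (F v) (single w 1)"
abbreviation "B w v \<equiv> lookup (G w) (single v 1)"

text \<open>The matrices \<open>A\<close> and \<open>B\<close> are the linear parts of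
  \<open>F\<close> and \<open>G\<close> at the origin. The round trip is the identity on
  \<open>X\<close>, and linear coefficients do not see vanishing polynomials.\<close>

lemma AB: "(\<Sum>w\<in>W. A v w * B w v') = (if v = v' then 1 else 0)" if "v \<in> V" "v' \<in> V"
proof -
  have F: "F v \<in> mpolys_over W" using that by (intro F_over)
  have "lookup (mpoly_subst G (F v) - mpoly_var v) (single v' 1) = 0"
    using GF[of "mpoly_var v"] that over_subst[OF F G_over]
    unfolding X by (intro source.vanishes_linear_coeff over_minus) auto
  then have "lookup (mpoly_subst G (F v)) (single v' 1) = lookup (mpoly_var v) (single v' 1)"
    by (simp add: lookup_minus)
  also have "lookup (mpoly_var v) (single v' 1) = (if v = v' then 1 else 0 :: 'a)"
    by (auto simp: mpoly_var_def lookup_single when_def) (metis lookup_single_eq lookup_single_not_eq zero_neq_one One_nat_def)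
  finally show ?thesis
    using linear_coeff_subst[OF F finite_W G_zero_exp, where v = v'] by simp
qed

lemma BA: "(\<Sum>v\<in>V. B w v * A v w') = (if w = w' then 1 else 0)" if "w \<in> W" "w' \<in> W"
proof -
  have G: "G w \<in> mpolys_over V" using that by (intro G_over)
  have "lookup (mpoly_subst F (G w) - mpoly_var w) (single w' 1) = 0"
    using FG[of "mpoly_var w"] that over_subst[OF G F_over]
    unfolding Y by (intro target.vanishes_linear_coeff over_minus) auto
  then have "lookup (mpoly_subst F (G w)) (single w' 1) = lookup (mpoly_var w) (single w' 1)"
    by (simp add: lookup_minus)
  also have "lookup (mpoly_var w) (single w' 1) = (if w = w' then 1 else 0 :: 'a)"
    by (auto simp: mpoly_var_def lookup_single when_def) (metis lookup_single_eq lookup_single_not_eq zero_neq_one One_nat_def)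
  finally show ?thesis
    using linear_coeff_subst[OF G finite_V F_zero_exp, where v = w'] by simp
qed

lemma A_weight: "A v w \<noteq> 0 \<Longrightarrow> v \<in> V \<Longrightarrow> u \<in> tri_weights W L' \<Longrightarrow> \<kappa> u v = u w"
  using F_hom[of v "single w 1" u] by (simp add: in_keys_iff)

lemma B_weight: "B w v \<noteq> 0 \<Longrightarrow> w \<in> W \<Longrightarrow> u \<in> tri_weights W L' \<Longrightarrow> \<kappa> u v = u w"
  using G_hom[of w "single v 1" u] by (simp add: in_keys_iff)

text \<open>The blocks of \<open>A\<close> and \<open>B\<close> of equal weight are mutually inverse, so the traces of their
  two products, which are the numbers of variables of this weight, agree.\<close>

lemma weight_bijection:
  "\<exists>\<sigma>. bij_betw \<sigma> V W \<and> (\<forall>v\<in>V. \<forall>u\<in>tri_weights W L'. \<kappa> u v = u (\<sigma> v))"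
proof -
  \<comment> \<open>\<open>p v\<close> and \<open>q w\<close> record all weights of a variable at
    once; they are set to 0 off the torus weights so that they can be compared as functions.\<close>
  define p where "p v = (\<lambda>u. if u \<in> tri_weights W L' then \<kappa> u v else 0)" for v
  define q where "q w = (\<lambda>u. if u \<in> tri_weights W L' then u w else 0)" for w
  have pq: "p v = q w" if "A v w * B w v' \<noteq> 0" "v \<in> V" "w \<in> W" for v v' w
    unfolding p_def q_def using A_weight[of v w] that by (intro ext) simp
  have qp: "p v = q w" if "B w v * A v w' \<noteq> 0" "v \<in> V" "w \<in> W" for v w w'
    unfolding p_def q_def using B_weight[of w v] that by (intro ext) simp
  have "card {v\<in>V. p v = t} = card {w\<in>W. q w = t}" for t
  proof -
    let ?V = "{v\<in>V. p v = t}" and ?W = "{w\<in>W. q w = t}"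
    have "(of_nat (card ?V) :: 'a) = (\<Sum>v\<in>?V. \<Sum>w\<in>W. A v w * B w v)"
      using AB by simp
    also have "\<dots> = (\<Sum>v\<in>?V. \<Sum>w\<in>?W. A v w * B w v)"
      using pq finite_W by (intro sum.cong refl sum.mono_neutral_right) auto
    also have "\<dots> = (\<Sum>w\<in>?W. \<Sum>v\<in>?V. B w v * A v w)"
      by (subst sum.swap) (simp add: mult.commute)
    also have "\<dots> = (\<Sum>w\<in>?W. \<Sum>v\<in>V. B w v * A v w)"
      using qp finite_V by (intro sum.cong refl sum.mono_neutral_left) auto
    also have "\<dots> = of_nat (card ?W)"
      using BA by simp
    \<comment> \<open>In characteristic zero the traces determine the numbers of variables.\<close>
    finally show ?thesis by (simp only: of_nat_eq_iff)
  qed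
  then obtain \<sigma> where \<sigma>: "bij_betw \<sigma> V W" "\<And>v. v \<in> V \<Longrightarrow> q (\<sigma> v) = p v"
    using bij_betw_fibres[OF finite_V finite_W, of p q] by blast
  have "\<kappa> u v = u (\<sigma> v)" if "v \<in> V" "u \<in> tri_weights W L'" for v u
    using fun_cong[OF \<sigma>(2)[OF that(1)], of u] that by (simp add: p_def q_def)
  then show ?thesis using \<sigma>(1) by blast
qed

end

section \<open>Blocks and exponents under the bijection of variables\<close>

locale matched_trinomial_iso = graded_trinomial_iso +
  fixes \<sigma>
  assumes \<sigma>: "bij_betw \<sigma> V W"
    and \<kappa>_\<sigma>: "v \<in> V \<Longrightarrow> u \<in> tri_weights W L' \<Longrightarrow> \<kappa> u v = u (\<sigma> v)"
begin

definition \<rho> where "\<rho> = inv_into V \<sigma>"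

lemma \<rho>: "w \<in> W \<Longrightarrow> \<rho> w \<in> V" "w \<in> W \<Longrightarrow> \<sigma> (\<rho> w) = w" "v \<in> V \<Longrightarrow> \<rho> (\<sigma> v) = v"
  "v \<in> V \<Longrightarrow> \<sigma> v \<in> W"
  using \<sigma> by (auto simp: \<rho>_def bij_betw_def inv_into_into f_inv_into_f)

lemma transversal_block:
  assumes xyz: "x \<in> W" "y \<in> W" "z \<in> W" "fst x \<noteq> fst y" "fst x \<noteq> fst z" "fst y \<noteq> fst z"
    and m: "keys m \<subseteq> V"
  shows "weight (\<kappa> (target.transversal_weight x y z)) m =
    L' y * L' z * lookup m (\<rho> x) + (L' x * L' z * lookup m (\<rho> y) + L' x * L' y * lookup m (\<rho> z))"
proof -
  have eq: "\<sigma> v = w \<longleftrightarrow> v = \<rho> w" if "v \<in> V" "w \<in> W" for v w using \<rho> that by metis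
  have "weight (\<kappa> (target.transversal_weight x y z)) m = weight (\<lambda>v. (if v = \<rho> x then L' y * L' z else 0) +
      ((if v = \<rho> y then L' x * L' z else 0) + (if v = \<rho> z then L' x * L' y else 0))) m"
  proof (rule weight_cong)
    fix v assume "v \<in> keys m"
    then have "v \<in> V" using m by blast
    then show "\<kappa> (target.transversal_weight x y z) v = (if v = \<rho> x then L' y * L' z else 0) +
      ((if v = \<rho> y then L' x * L' z else 0) + (if v = \<rho> z then L' x * L' y else 0))"
      using eq xyz \<kappa>_\<sigma>[OF _ target.transversal_weight_in[OF xyz(1-6)]]
      by (simp add: target.transversal_weight_def)
  qed
  then show ?thesis by (simp only: weight_field_add weight_indicator_const of_nat_id)
qed

text \<open>The pulled back weight is supported on three variables and gives the three monomials of
  \<open>V\<close> the same positive weight. So every block of \<open>V\<close> contains exactly one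
  of these variables, and comparing two blocks yields the proportion.\<close>

lemma transversal_image:
  assumes xyz: "x \<in> W" "y \<in> W" "z \<in> W" "fst x \<noteq> fst y" "fst x \<noteq> fst z" "fst y \<noteq> fst z"
  shows "fst (\<rho> x) \<noteq> fst (\<rho> y)" "L (\<rho> x) * L' y = L (\<rho> y) * L' x"
proof -
  let ?u = "target.transversal_weight x y z"
  have "\<kappa> ?u \<in> tri_weights V L" by (intro \<kappa> target.transversal_weight_in xyz)
  then obtain d where d: "\<And>i. i < 3 \<Longrightarrow> weight (\<kappa> ?u) (block_exp V L i) = d"
    by (auto simp: tri_weights_def)
  have in_V: "\<rho> x \<in> V" "\<rho> y \<in> V" "\<rho> z \<in> V" using \<rho> xyz by auto
  let ?a = "L' y * L' z * L (\<rho> x)" and ?b = "L' x * L' z * L (\<rho> y)" and ?c = "L' x * L' y * L (\<rho> z)"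
  have sum: "(if fst (\<rho> x) = i then ?a else 0) + ((if fst (\<rho> y) = i then ?b else 0) +
      (if fst (\<rho> z) = i then ?c else 0)) = d" if "i < 3" for i
    using transversal_block[OF xyz, of "block_exp V L i"] d[OF that] in_V
    by (auto simp: source.keys_block_exp source.lookup_block_exp)
  have pos: "?a > 0" "?b > 0" "?c > 0"
    using xyz in_V target.L_pos source.L_pos by auto
  have lt: "fst (\<rho> x) < 3" "fst (\<rho> y) < 3" "fst (\<rho> z) < 3" using source.fst_less in_V by auto
  have "d > 0" using sum[OF lt(1)] pos by auto
  have hit: "i = fst (\<rho> x) \<or> i = fst (\<rho> y) \<or> i = fst (\<rho> z)" if "i < 3" for i
    using sum[OF that] \<open>d > 0\<close> by (auto split: if_splits)
  have ne: "fst (\<rho> x) \<noteq> fst (\<rho> y)" "fst (\<rho> x) \<noteq> fst (\<rho> z)" "fst (\<rho> y) \<noteq> fst (\<rho> z)"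
    using hit[of 0] hit[of 1] hit[of 2] by auto
  show "fst (\<rho> x) \<noteq> fst (\<rho> y)" by (fact ne(1))
  have "?a = ?b" using sum[OF lt(1)] sum[OF lt(2)] ne by auto
  then have "L' z * (L (\<rho> x) * L' y) = L' z * (L (\<rho> y) * L' x)" by (simp add: mult_ac)
  then show "L (\<rho> x) * L' y = L (\<rho> y) * L' x"
    using target.L_pos[OF xyz(3)] by (simp only: nat_mult_eq_cancel1)
qed

lemma different_block:
  assumes "x \<in> W" "y \<in> W" "fst x \<noteq> fst y"
  shows "fst (\<rho> x) \<noteq> fst (\<rho> y)" "L (\<rho> x) * L' y = L (\<rho> y) * L' x"
proof -
  obtain a b where "a \<in> W" "b \<in> W" "fst a \<noteq> fst x" "fst b \<noteq> fst x" "fst a \<noteq> fst b"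
    using target.other_blocks[OF assms(1)] by metis
  then obtain z where "z \<in> W" "fst x \<noteq> fst z" "fst y \<noteq> fst z" by metis
  then show "fst (\<rho> x) \<noteq> fst (\<rho> y)" "L (\<rho> x) * L' y = L (\<rho> y) * L' x"
    using transversal_image[of x y z] assms by auto
qed

text \<open>Both images avoid the blocks of two variables from the other blocks, and only one block
  remains.\<close>

lemma same_block:
  assumes "x \<in> W" "x' \<in> W" "fst x = fst x'"
  shows "fst (\<rho> x) = fst (\<rho> x')" "L (\<rho> x) * L' x' = L (\<rho> x') * L' x"
proof -
  obtain y z where yz: "y \<in> W" "z \<in> W" "fst y \<noteq> fst x" "fst z \<noteq> fst x" "fst y \<noteq> fst z"
    using target.other_blocks[OF assms(1)] by metis
  have "fst (\<rho> x) \<noteq> fst (\<rho> y)" "fst (\<rho> x) \<noteq> fst (\<rho> z)" "fst (\<rho> x') \<noteq> fst (\<rho> y)"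
    "fst (\<rho> x') \<noteq> fst (\<rho> z)" "fst (\<rho> y) \<noteq> fst (\<rho> z)"
    using yz assms different_block(1) by metis+
  moreover have "fst (\<rho> w) < 3" if "w \<in> W" for w using source.fst_less \<rho>(1) that by blast
  then have "fst (\<rho> x) < 3" "fst (\<rho> x') < 3" "fst (\<rho> y) < 3" "fst (\<rho> z) < 3"
    using assms yz by auto
  ultimately show "fst (\<rho> x) = fst (\<rho> x')" by linarith
  have "L (\<rho> x) * L' y = L (\<rho> y) * L' x" "L (\<rho> x') * L' y = L (\<rho> y) * L' x'"
    using different_block(2) assms yz by metis+
  then have "L' y * (L (\<rho> x) * L' x') = L' y * (L (\<rho> x') * L' x)"
    by (metis mult.assoc mult.commute)
  then show "L (\<rho> x) * L' x' = L (\<rho> x') * L' x"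
    using target.L_pos[OF yz(1)] by (simp only: nat_mult_eq_cancel1)
qed

lemma block_iff: "x \<in> W \<Longrightarrow> y \<in> W \<Longrightarrow> fst (\<rho> x) = fst (\<rho> y) \<longleftrightarrow> fst x = fst y"
  using different_block(1) same_block(1) by metis

lemma proportional: "x \<in> W \<Longrightarrow> y \<in> W \<Longrightarrow> L (\<rho> x) * L' y = L (\<rho> y) * L' x"
  using different_block(2) same_block(2) by metis

lemma block_iff_\<sigma>: "v \<in> V \<Longrightarrow> v' \<in> V \<Longrightarrow> fst (\<sigma> v) = fst (\<sigma> v') \<longleftrightarrow> fst v = fst v'"
  using block_iff[of "\<sigma> v" "\<sigma> v'"] \<rho> by simp

lemma weight_block_exp_target:
  assumes "i < 3"
  shows "\<exists>j<3. \<forall>w. weight (\<lambda>y. if y \<in> W then w (\<rho> y) else 0) (block_exp W L' i)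
    = (\<Sum>v\<in>{v\<in>V. fst v = j}. w v * L' (\<sigma> v))"
proof -
  obtain y where y: "y \<in> W" "fst y = i" using target.block_nonempty[OF assms] by blast
  have "{v\<in>V. fst v = fst (\<rho> y)} = \<rho> ` {x\<in>W. fst x = i}"
  proof (intro equalityI subsetI)
    fix v assume "v \<in> {v\<in>V. fst v = fst (\<rho> y)}"
    then show "v \<in> \<rho> ` {x\<in>W. fst x = i}"
      using block_iff[of "\<sigma> v" y] y \<rho> by (intro image_eqI[of _ _ "\<sigma> v"]) auto
  next
    fix v assume "v \<in> \<rho> ` {x\<in>W. fst x = i}"
    then obtain x where "x \<in> W" "fst x = i" "v = \<rho> x" by blast
    then show "v \<in> {v\<in>V. fst v = fst (\<rho> y)}" using block_iff[of x y] y \<rho>(1) by simp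
  qed
  moreover have "inj_on \<rho> {x\<in>W. fst x = i}" using \<rho>(2) by (metis (mono_tags, lifting) inj_on_inverseI mem_Collect_eq)
  ultimately have reindex: "(\<Sum>v\<in>{v\<in>V. fst v = fst (\<rho> y)}. w v * L' (\<sigma> v)) =
      (\<Sum>x\<in>{x\<in>W. fst x = i}. w (\<rho> x) * L' (\<sigma> (\<rho> x)))" for w
    by (simp add: sum.reindex)
  have "weight (\<lambda>y. if y \<in> W then w (\<rho> y) else 0) (block_exp W L' i) =
      (\<Sum>v\<in>{v\<in>V. fst v = fst (\<rho> y)}. w v * L' (\<sigma> v))" for w
    unfolding weight_def target.keys_block_exp reindex
    using \<rho> by (intro sum.cong) (auto simp: target.lookup_block_exp)
  then show ?thesis using source.fst_less[OF \<rho>(1)[OF y(1)]] by blast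
qed

text \<open>As the exponents are proportional, \<open>w\<close> composed with \<open>\<rho>\<close>
  gives equal weight to the three monomials of \<open>W\<close>. Its image under
  \<open>\<kappa>\<close> is \<open>w\<close>.\<close>

lemma \<kappa>_surj:
  assumes w: "w \<in> tri_weights V L"
  obtains u where "u \<in> tri_weights W L'" "\<And>v. v \<in> V \<Longrightarrow> \<kappa> u v = w v"
proof -
  define u where "u y = (if y \<in> W then w (\<rho> y) else 0)" for y
  obtain v0 where v0: "v0 \<in> V" using source.block_nonempty[of 0] by auto
  obtain d where d: "\<And>i. i < 3 \<Longrightarrow> weight w (block_exp V L i) = d"
    using w by (auto simp: tri_weights_def)
  \<comment> \<open>The factors \<open>L v0\<close> and \<open>L' (\<sigma> v0)\<close> express the
    common ratio of the exponents without division.\<close>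
  have *: "L v0 * weight u (block_exp W L' i) = L' (\<sigma> v0) * d" if i: "i < 3" for i
  proof -
    obtain j where j: "j < 3" "\<forall>w. weight (\<lambda>y. if y \<in> W then w (\<rho> y) else 0) (block_exp W L' i)
        = (\<Sum>v\<in>{v\<in>V. fst v = j}. w v * L' (\<sigma> v))"
      using weight_block_exp_target[OF i] by blast
    have "L v0 * weight u (block_exp W L' i) = (\<Sum>v\<in>{v\<in>V. fst v = j}. L v0 * (w v * L' (\<sigma> v)))"
      unfolding u_def j(2)[rule_format] by (rule sum_distrib_left)
    also have "\<dots> = (\<Sum>v\<in>{v\<in>V. fst v = j}. L' (\<sigma> v0) * (w v * L v))"
    proof (intro sum.cong refl)
      fix v assume "v \<in> {v\<in>V. fst v = j}"
      then have "L v0 * L' (\<sigma> v) = L v * L' (\<sigma> v0)"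
        using proportional[of "\<sigma> v0" "\<sigma> v"] \<rho> v0 by auto
      then show "L v0 * (w v * L' (\<sigma> v)) = L' (\<sigma> v0) * (w v * L v)"
        by (metis mult.assoc mult.commute)
    qed
    also have "\<dots> = L' (\<sigma> v0) * weight w (block_exp V L j)"
      unfolding weight_def source.keys_block_exp sum_distrib_left
      by (intro sum.cong) (auto simp: source.lookup_block_exp)
    finally show ?thesis using d[OF j(1)] by simp
  qed
  have "weight u (block_exp W L' i) = weight u (block_exp W L' 0)" if "i < 3" for i
  proof -
    have "L v0 * weight u (block_exp W L' i) = L v0 * weight u (block_exp W L' 0)"
      using *[OF that] *[of 0] by simp
    then show ?thesis using source.L_pos[OF v0] by (simp only: nat_mult_eq_cancel1)
  qed
  moreover have "\<forall>y. y \<notin> W \<longrightarrow> u y = 0" by (simp add: u_def)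
  ultimately have "u \<in> tri_weights W L'" unfolding tri_weights_def by blast
  moreover from this have "\<kappa> u v = w v" if "v \<in> V" for v
    using \<kappa>_\<sigma>[OF that] that \<rho> by (simp add: u_def)
  ultimately show ?thesis by (rule that)
qed

text \<open>The difference vanishes on \<open>X\<close> and has the weights of \<open>v\<close> for
  the whole torus of \<open>V\<close>, all of whose weights come from \<open>W\<close>; so it is
  zero. A mere congruence would be useless for the trinomials, which vanish themselves.\<close>

lemma GF_exact: "mpoly_subst G (F v) = mpoly_var v" if v: "v \<in> V"
proof -
  have F: "F v \<in> mpolys_over W" by (rule F_over[OF v])
  have o: "mpoly_subst G (F v) - mpoly_var v \<in> mpolys_over V"
    using v F by (intro over_minus over_subst[OF F G_over]) auto
  have "mpoly_subst G (F v) - mpoly_var v = 0"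
  proof (rule source.vanishes_variable_weight[OF o _ v])
    show "vanishes (tri_locus V L) (mpoly_subst G (F v) - mpoly_var v)"
      using GF[of "mpoly_var v"] v by (simp add: X)
    fix a w assume a: "a \<in> keys (mpoly_subst G (F v) - mpoly_var v)" and "w \<in> tri_weights V L"
    then obtain u where u: "u \<in> tri_weights W L'" "\<And>v. v \<in> V \<Longrightarrow> \<kappa> u v = w v"
      using \<kappa>_surj by metis
    have "keys a \<subseteq> V" using o a by (auto simp: mpolys_over_def)
    then have wa: "weight w a = weight (\<kappa> u) a" using u(2) by (intro weight_cong) auto
    have "a \<in> keys (mpoly_subst G (F v)) \<or> a \<in> keys (mpoly_var v :: (nat \<times> nat, 'a) mpoly)"
      using a by (auto simp: in_keys_iff lookup_minus)
    then show "weight w a = w v"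
    proof
      assume "a \<in> keys (mpoly_subst G (F v))"
      then obtain m where "m \<in> keys (F v)" "weight (\<kappa> u) a = weight u m"
        using weight_keys_subst[of "F v" W G "\<kappa> u" u a, OF F G_hom[OF _ _ u(1)]] by blast
      then show ?thesis using F_hom[OF v _ u(1)] u(2)[OF v] wa by metis
    next
      assume "a \<in> keys (mpoly_var v :: (nat \<times> nat, 'a) mpoly)"
      then show ?thesis by (auto simp: mpoly_var_def split: if_splits)
    qed
  qed
  then show ?thesis by simp
qed

lemma FG_exact: "mpoly_subst F (G w) = mpoly_var w" if w: "w \<in> W"
proof -
  have G: "G w \<in> mpolys_over V" by (rule G_over[OF w])
  have o: "mpoly_subst F (G w) - mpoly_var w \<in> mpolys_over W"
    using w G by (intro over_minus over_subst[OF G F_over]) auto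
  have "mpoly_subst F (G w) - mpoly_var w = 0"
  proof (rule target.vanishes_variable_weight[OF o _ w])
    show "vanishes (tri_locus W L') (mpoly_subst F (G w) - mpoly_var w)"
      using FG[of "mpoly_var w"] w by (simp add: Y)
    fix b u assume b: "b \<in> keys (mpoly_subst F (G w) - mpoly_var w)" and u: "u \<in> tri_weights W L'"
    have "b \<in> keys (mpoly_subst F (G w)) \<or> b \<in> keys (mpoly_var w :: (nat \<times> nat, 'a) mpoly)"
      using b by (auto simp: in_keys_iff lookup_minus)
    then show "weight u b = u w"
    proof
      assume "b \<in> keys (mpoly_subst F (G w))"
      then obtain m where "m \<in> keys (G w)" "weight u b = weight (\<kappa> u) m"
        using weight_keys_subst[of "G w" V F u "\<kappa> u" b, OF G F_hom[OF _ _ u]] by blast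
      then show ?thesis using G_hom[OF w _ u] by metis
    next
      assume "b \<in> keys (mpoly_var w :: (nat \<times> nat, 'a) mpoly)"
      then show ?thesis by (auto simp: mpoly_var_def split: if_splits)
    qed
  qed
  then show ?thesis by simp
qed

lemma tri_nonzero: "tri V L \<noteq> (0 :: (nat \<times> nat, 'a) mpoly)" "tri W L' \<noteq> (0 :: (nat \<times> nat, 'a) mpoly)"
proof -
  have "\<exists>i<3. block_exp V L 0 = block_exp V L i" "\<exists>i<3. block_exp W L' 0 = block_exp W L' i"
    by (rule exI[of _ 0]; simp)+
  then have "lookup (tri V L) (block_exp V L 0) = (1::'a)" "lookup (tri W L') (block_exp W L' 0) = (1::'a)"
    by (simp_all only: source.lookup_tri target.lookup_tri if_True)
  then show "tri V L \<noteq> (0 :: (nat \<times> nat, 'a) mpoly)" "tri W L' \<noteq> (0 :: (nat \<times> nat, 'a) mpoly)"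
    by auto
qed

text \<open>If the exponents of \<open>W\<close> were larger, then \<open>tri V L\<close> would be mapped to a form of weight
  too small to be a nonzero multiple of \<open>tri W L'\<close>, and likewise in the other direction.\<close>

lemma exponent_le: "L' w \<le> L (\<rho> w)" if w: "w \<in> W"
proof (rule ccontr)
  assume less: "\<not> L' w \<le> L (\<rho> w)"
  obtain y z where yz: "y \<in> W" "z \<in> W" "fst y \<noteq> fst w" "fst z \<noteq> fst w" "fst y \<noteq> fst z"
    using target.other_blocks[OF w] by metis
  let ?u = "target.transversal_weight w y z"
  have u: "?u \<in> tri_weights W L'" using yz w by (intro target.transversal_weight_in) auto
  have d: "weight (\<kappa> ?u) (block_exp V L i) = L' y * L' z * L (\<rho> w)" if "i < 3" for i
  proof -
    have "weight (\<kappa> ?u) (block_exp V L i) = weight (\<kappa> ?u) (block_exp V L (fst (\<rho> w)))"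
      using \<kappa>[OF u] that source.fst_less[OF \<rho>(1)[OF w]] unfolding tri_weights_def by force
    also have "\<dots> = L' y * L' z * L (\<rho> w)"
      using yz w \<rho>(1) block_iff[of w y] block_iff[of w z]
      by (subst transversal_block) (auto simp: source.keys_block_exp source.lookup_block_exp)
    finally show ?thesis .
  qed
  have "mpoly_subst F (tri V L) = 0"
  proof (rule target.vanishes_low_degree[OF _ _ w])
    show "mpoly_subst F (tri V L) \<in> mpolys_over W"
      by (rule over_subst[OF source.tri_over F_over])
    show "vanishes (tri_locus W L') (mpoly_subst F (tri V L))"
      using F_pull[OF source.tri_over] source.vanishes_tri unfolding X Y by blast
    fix b assume "b \<in> keys (mpoly_subst F (tri V L))"
    then obtain m where "m \<in> keys (tri V L :: (nat \<times> nat, 'a) mpoly)" "weight ?u b = weight (\<kappa> ?u) m"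
      using weight_keys_subst[of "tri V L" V F ?u "\<kappa> ?u" b, OF source.tri_over F_hom[OF _ _ u]] by blast
    then have "weight ?u b = L' y * L' z * L (\<rho> w)" using source.keys_tri d by metis
    \<comment> \<open>The occurrences of \<open>w\<close> account for only part of the weight of
      \<open>b\<close>, which bounds the degree in \<open>w\<close>.\<close>
    then have "(L' y * L' z) * lookup b w \<le> (L' y * L' z) * L (\<rho> w)"
      unfolding target.weight_transversal by linarith
    then have "lookup b w \<le> L (\<rho> w)" using target.L_pos yz by simp
    then show "lookup b w < L' w" using less by simp
  qed
  then have "mpoly_subst G (mpoly_subst F (tri V L)) = 0" by (simp add: subst.hom_zero)
  also have "mpoly_subst G (mpoly_subst F (tri V L)) = mpoly_subst mpoly_var (tri V L)"
    unfolding subst_subst using GF_exact by (intro subst_cong[OF source.tri_over])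
  finally show False using tri_nonzero by (simp add: subst_mpoly_var)
qed

lemma exponent_ge: "L (\<rho> w) \<le> L' w" if w: "w \<in> W"
proof (rule ccontr)
  assume less: "\<not> L (\<rho> w) \<le> L' w"
  obtain y z where yz: "y \<in> W" "z \<in> W" "fst y \<noteq> fst w" "fst z \<noteq> fst w" "fst y \<noteq> fst z"
    using target.other_blocks[OF w] by metis
  let ?u = "target.transversal_weight w y z"
  have u: "?u \<in> tri_weights W L'" using yz w by (intro target.transversal_weight_in) auto
  have d: "weight ?u (block_exp W L' i) = L' y * L' z * L' w" if "i < 3" for i
  proof -
    have "weight ?u (block_exp W L' i) = weight ?u (block_exp W L' (fst w))"
      using u that target.fst_less[OF w] unfolding tri_weights_def by force
    also have "\<dots> = L' y * L' z * L' w"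
      using yz w by (auto simp: target.weight_transversal target.lookup_block_exp)
    finally show ?thesis .
  qed
  have o: "mpoly_subst G (tri W L') \<in> mpolys_over V"
    by (rule over_subst[OF target.tri_over G_over])
  have "mpoly_subst G (tri W L') = 0"
  proof (rule source.vanishes_low_degree[OF o _ \<rho>(1)[OF w]])
    show "vanishes (tri_locus V L) (mpoly_subst G (tri W L'))"
      using G_pull[OF target.tri_over] target.vanishes_tri unfolding X Y by blast
    fix a assume a: "a \<in> keys (mpoly_subst G (tri W L'))"
    then obtain m where "m \<in> keys (tri W L' :: (nat \<times> nat, 'a) mpoly)" "weight (\<kappa> ?u) a = weight ?u m"
      using weight_keys_subst[of "tri W L'" W G "\<kappa> ?u" ?u a, OF target.tri_over G_hom[OF _ _ u]] by blast
    then have "weight (\<kappa> ?u) a = L' y * L' z * L' w" using target.keys_tri d by metis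
    moreover have "keys a \<subseteq> V" using o a by (auto simp: mpolys_over_def)
    then have "(L' y * L' z) * lookup a (\<rho> w) \<le> weight (\<kappa> ?u) a"
      using yz w by (subst transversal_block) auto
    ultimately have "(L' y * L' z) * lookup a (\<rho> w) \<le> (L' y * L' z) * L' w" by simp
    then have "lookup a (\<rho> w) \<le> L' w" using target.L_pos yz by simp
    then show "lookup a (\<rho> w) < L (\<rho> w)" using less by simp
  qed
  then have "mpoly_subst F (mpoly_subst G (tri W L')) = 0" by (simp add: subst.hom_zero)
  also have "mpoly_subst F (mpoly_subst G (tri W L')) = mpoly_subst mpoly_var (tri W L')"
    unfolding subst_subst using FG_exact by (intro subst_cong[OF target.tri_over])
  finally show False using tri_nonzero by (simp add: subst_mpoly_var)
qed

lemma exponents: "v \<in> V \<Longrightarrow> L v = L' (\<sigma> v)"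
  using exponent_le[of "\<sigma> v"] exponent_ge[of "\<sigma> v"] \<rho> by simp

lemma subst_tri: "mpoly_subst (\<lambda>v. mpoly_var (\<sigma> v)) (tri V L) = (tri W L' :: (nat \<times> nat, 'b::comm_ring_1) mpoly)"
proof -
  have subst_single: "mpoly_subst (\<lambda>v. mpoly_var (\<sigma> v)) (single m c)
      = single (\<Sum>v\<in>A. single (\<sigma> v) (lookup m v)) (c::'b)" if "finite A" "keys m \<subseteq> A" for A m c
    using that(2)
  proof (induction m rule: monomial_induct)
    case zero
    show ?case using subst_const[of _ c] by (simp add: mpoly_const_def)
  next
    case (plus m v)
    have "(\<Sum>x\<in>A. single (\<sigma> x) (lookup (m + single v 1) x))
        = (\<Sum>x\<in>A. single (\<sigma> x) (lookup m x) + (if x = v then single (\<sigma> v) 1 else 0))"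
      by (intro sum.cong) (auto simp: lookup_add lookup_single when_def single_add)
    also have "\<dots> = (\<Sum>x\<in>A. single (\<sigma> x) (lookup m x)) + single (\<sigma> v) 1"
      using plus \<open>finite A\<close> by (simp add: sum.distrib sum.delta)
    finally show ?case
      using plus unfolding single_plus_var subst.hom_mult subst_var by (simp only: single_plus_var)
  qed
  \<comment> \<open>The permutation of the three blocks induced by \<open>\<sigma>\<close>, read off
    from an arbitrary variable of each block.\<close>
  define \<tau> where "\<tau> i = fst (\<sigma> (SOME v. v \<in> V \<and> fst v = i))" for i
  have \<tau>: "\<tau> (fst v) = fst (\<sigma> v)" if "v \<in> V" for v
  proof -
    have "(SOME x. x \<in> V \<and> fst x = fst v) \<in> V \<and> fst (SOME x. x \<in> V \<and> fst x = fst v) = fst v"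
      by (rule someI[of _ v]) (use that in simp)
    then show ?thesis using block_iff_\<sigma> that by (metis \<tau>_def)
  qed
  have bij: "bij_betw \<tau> {..<3} {..<3}"
  proof -
    have img: "\<tau> ` {..<3} \<subseteq> {..<3}"
    proof
      fix j assume "j \<in> \<tau> ` {..<3}"
      then obtain i v where "v \<in> V" "fst v = i" "j = \<tau> i" using source.block_nonempty by force
      then show "j \<in> {..<3}" using \<tau>[of v] target.fst_less[of "\<sigma> v"] \<rho>(4)[of v] by simp
    qed
    moreover have "inj_on \<tau> {..<3}"
    proof (rule inj_onI)
      fix i j assume "i \<in> {..<3::nat}" "j \<in> {..<3::nat}" "\<tau> i = \<tau> j"
      moreover from this obtain v v' where "v \<in> V" "fst v = i" "v' \<in> V" "fst v' = j"
        using source.block_nonempty by (metis lessThan_iff)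
      ultimately show "i = j" using \<tau> block_iff_\<sigma> by metis
    qed
    ultimately show ?thesis by (simp add: bij_betw_def endo_inj_surj)
  qed
  have "mpoly_subst (\<lambda>v. mpoly_var (\<sigma> v)) (single (block_exp V L i) (1::'b)) = single (block_exp W L' (\<tau> i)) 1"
    if i: "i < 3" for i
  proof -
    let ?A = "{v\<in>V. fst v = i}"
    have "mpoly_subst (\<lambda>v. mpoly_var (\<sigma> v)) (single (block_exp V L i) (1::'b))
        = single (\<Sum>v\<in>?A. single (\<sigma> v) (lookup (block_exp V L i) v)) 1"
      using finite_V by (intro subst_single) (auto simp: source.keys_block_exp)
    also have "(\<Sum>v\<in>?A. single (\<sigma> v) (lookup (block_exp V L i) v)) = (\<Sum>v\<in>?A. single (\<sigma> v) (L' (\<sigma> v)))"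
      by (intro sum.cong) (auto simp: source.lookup_block_exp exponents)
    also have "\<dots> = (\<Sum>w\<in>\<sigma> ` ?A. single w (L' w))"
      using \<sigma> by (subst sum.reindex) (auto simp: bij_betw_def intro: inj_on_subset)
    also have "\<sigma> ` ?A = {w\<in>W. fst w = \<tau> i}"
    proof (intro equalityI subsetI)
      fix w assume "w \<in> \<sigma> ` ?A"
      then show "w \<in> {w\<in>W. fst w = \<tau> i}" using \<tau> \<rho>(4) by auto
    next
      fix w assume w: "w \<in> {w\<in>W. fst w = \<tau> i}"
      obtain v where v: "v \<in> V" "fst v = i" using source.block_nonempty[OF i] by blast
      then have "fst (\<rho> w) = i"
        using w \<tau>[OF v(1)] \<rho> block_iff_\<sigma>[of "\<rho> w" v] by auto
      then show "w \<in> \<sigma> ` ?A" using w \<rho> by (intro image_eqI[of _ _ "\<rho> w"]) auto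
    qed
    finally show ?thesis by (simp add: block_exp_def)
  qed
  then have "mpoly_subst (\<lambda>v. mpoly_var (\<sigma> v)) (tri V L) =
      (\<Sum>i<3. single (block_exp W L' (\<tau> i)) (1::'b))"
    by (simp add: tri_def subst.hom_sum)
  also have "\<dots> = tri W L'"
    unfolding tri_def using sum.reindex_bij_betw[OF bij] .
  finally show ?thesis .
qed

end

lemma (in graded_trinomial_iso) permutation:
  obtains \<sigma> where "bij_betw \<sigma> V W"
    and "mpoly_subst (\<lambda>v. mpoly_var (\<sigma> v)) (tri V L) = (tri W L' :: (nat \<times> nat, 'a) mpoly)"
proof -
  obtain \<sigma> where \<sigma>: "bij_betw \<sigma> V W" "\<forall>v\<in>V. \<forall>u\<in>tri_weights W L'. \<kappa> u v = u (\<sigma> v)"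
    using weight_bijection by blast
  interpret matched_trinomial_iso V X W Y F G L L' \<kappa> \<sigma>
    by unfold_locales (use \<sigma> in auto)
  show ?thesis using that[OF \<sigma>(1) subst_tri] .
qed

section \<open>Regular maps and polynomial substitutions\<close>

lemma mpoly_iso_of_isomorphic_varieties:
  assumes "finite V" "finite W"
    and "isomorphic_varieties V X W (Y :: ('w \<Rightarrow> 'a::field_char_0) set)"
    and X: "X \<subseteq> affine_space V" and Y: "Y \<subseteq> affine_space W"
  obtains F G where "mpoly_iso V X W Y F G"
proof -
  obtain \<phi> \<psi> where \<phi>: "regular_map V X W Y \<phi>" and \<psi>: "regular_map W Y V X \<psi>"
    and inv: "\<And>x. x \<in> X \<Longrightarrow> \<psi> (\<phi> x) = x" "\<And>y. y \<in> Y \<Longrightarrow> \<phi> (\<psi> y) = y"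
    using assms(3) unfolding isomorphic_varieties_def by blast
  obtain G where G: "\<And>w. w \<in> W \<Longrightarrow> G w \<in> mpolys_over V"
    "\<And>w x. w \<in> W \<Longrightarrow> x \<in> X \<Longrightarrow> \<phi> x w = mpoly_eval (G w) x"
    using \<phi> unfolding regular_map_def by metis
  obtain F where F: "\<And>v. v \<in> V \<Longrightarrow> F v \<in> mpolys_over W"
    "\<And>v y. v \<in> V \<Longrightarrow> y \<in> Y \<Longrightarrow> \<psi> y v = mpoly_eval (F v) y"
    using \<psi> unfolding regular_map_def by metis
  have in_XY: "\<And>x. x \<in> X \<Longrightarrow> \<phi> x \<in> Y" "\<And>y. y \<in> Y \<Longrightarrow> \<psi> y \<in> X"
    using \<phi> \<psi> by (auto simp: regular_map_def)
  have evF: "mpoly_eval (mpoly_subst F p) y = mpoly_eval p (\<psi> y)" if "p \<in> mpolys_over V" "y \<in> Y" for p y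
    unfolding eval_subst using F(2) that by (intro eval_cong[OF that(1)]) simp
  have evG: "mpoly_eval (mpoly_subst G q) x = mpoly_eval q (\<phi> x)" if "q \<in> mpolys_over W" "x \<in> X" for q x
    unfolding eval_subst using G(2) that by (intro eval_cong[OF that(1)]) simp
  have "mpoly_iso V X W Y F G"
  proof
    show "vanishes Y (mpoly_subst F p)" if "p \<in> mpolys_over V" "vanishes X p" for p
      using that in_XY by (auto simp: vanishes_def evF)
    show "vanishes X (mpoly_subst G q)" if "q \<in> mpolys_over W" "vanishes Y q" for q
      using that in_XY by (auto simp: vanishes_def evG)
    show "vanishes X (mpoly_subst G (mpoly_subst F p) - p)" if "p \<in> mpolys_over V" for p
      using that in_XY inv over_subst[OF that F(1)] by (auto simp: vanishes_def eval.hom_minus evF evG)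
    show "vanishes Y (mpoly_subst F (mpoly_subst G q) - q)" if "q \<in> mpolys_over W" for q
      using that in_XY inv over_subst[OF that G(1)] by (auto simp: vanishes_def eval.hom_minus evF evG)
  qed (fact assms(1,2) F(1) G(1))+
  then show ?thesis by (rule that)
qed

lemma isomorphic_varieties_permutation:
  fixes f :: "('v, 'a::field) mpoly"
  assumes \<sigma>: "bij_betw \<sigma> V W" and f: "f \<in> mpolys_over V"
  shows "isomorphic_varieties V (zero_locus V f) W (zero_locus W (mpoly_rename \<sigma> f))"
proof -
  define \<rho> where "\<rho> = inv_into V \<sigma>"
  have \<rho>: "w \<in> W \<Longrightarrow> \<rho> w \<in> V" "w \<in> W \<Longrightarrow> \<sigma> (\<rho> w) = w" "v \<in> V \<Longrightarrow> \<rho> (\<sigma> v) = v" "v \<in> V \<Longrightarrow> \<sigma> v \<in> W" for v w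
    using \<sigma> by (auto simp: \<rho>_def bij_betw_def inv_into_into f_inv_into_f)
  \<comment> \<open>Restricting to \<open>W\<close>, and to \<open>V\<close> below, keeps points
    \<open>undefined\<close> off the coordinates, as membership in the affine spaces
    demands.\<close>
  define \<phi> where "\<phi> x = (\<lambda>w\<in>W. x (\<rho> w))" for x :: "'v \<Rightarrow> 'a"
  define \<psi> where "\<psi> y = (\<lambda>v\<in>V. y (\<sigma> v))" for y :: "_ \<Rightarrow> 'a"
  have rename: "mpoly_rename \<sigma> f = mpoly_subst (\<lambda>v. mpoly_var (\<sigma> v)) f"
    by (simp add: mpoly_rename_def mpoly_subst_def)
  have ev: "mpoly_eval (mpoly_rename \<sigma> f) y = mpoly_eval f (\<psi> y)" for y
    unfolding rename eval_subst by (intro eval_cong[OF f]) (simp add: \<psi>_def)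
  have \<psi>\<phi>: "\<psi> (\<phi> x) = x" if "x \<in> affine_space V" for x
    using that \<rho> by (auto simp: \<psi>_def \<phi>_def affine_space_def fun_eq_iff PiE_def extensional_def)
  have \<phi>\<psi>: "\<phi> (\<psi> y) = y" if "y \<in> affine_space W" for y
    using that \<rho> by (auto simp: \<psi>_def \<phi>_def affine_space_def fun_eq_iff PiE_def extensional_def)
  have "regular_map V (zero_locus V f) W (zero_locus W (mpoly_rename \<sigma> f)) \<phi>"
    unfolding regular_map_def
  proof (intro conjI ballI)
    fix x assume "x \<in> zero_locus V f"
    then show "\<phi> x \<in> zero_locus W (mpoly_rename \<sigma> f)"
      using \<psi>\<phi> by (auto simp: zero_locus_def ev) (simp add: \<phi>_def affine_space_def)
  next
    fix w assume "w \<in> W"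
    then show "\<exists>p\<in>mpolys_over V. \<forall>x\<in>zero_locus V f. \<phi> x w = mpoly_eval p x"
      using \<rho> by (intro bexI[of _ "mpoly_var (\<rho> w)"]) (auto simp: \<phi>_def)
  qed
  moreover have "regular_map W (zero_locus W (mpoly_rename \<sigma> f)) V (zero_locus V f) \<psi>"
    unfolding regular_map_def
  proof (intro conjI ballI)
    fix y assume "y \<in> zero_locus W (mpoly_rename \<sigma> f)"
    then show "\<psi> y \<in> zero_locus V f"
      by (auto simp: zero_locus_def ev) (simp add: \<psi>_def affine_space_def)
  next
    fix v assume "v \<in> V"
    then show "\<exists>p\<in>mpolys_over W. \<forall>y\<in>zero_locus W (mpoly_rename \<sigma> f). \<psi> y v = mpoly_eval p y"
      using \<rho> by (intro bexI[of _ "mpoly_var (\<sigma> v)"]) (auto simp: \<psi>_def)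
  qed
  moreover have "\<forall>x\<in>zero_locus V f. \<psi> (\<phi> x) = x"
    "\<forall>y\<in>zero_locus W (mpoly_rename \<sigma> f). \<phi> (\<psi> y) = y"
    using \<psi>\<phi> \<phi>\<psi> by (auto simp: zero_locus_def)
  ultimately show ?thesis unfolding isomorphic_varieties_def by blast
qed

subsection \<open>The isomorphism theorem\<close>

lemma trinomial_setup_trinomial:
  assumes "trinomial_data n l" "no_linear_term n l"
  shows "trinomial_setup (trinomial_vars n) (\<lambda>(i, j). l i j)"
proof
  show "finite (trinomial_vars n)" by (simp add: trinomial_vars_def)
  have "(i, 1) \<in> trinomial_vars n" if "i < 3" for i
    using assms(1) that by (auto simp: trinomial_vars_def trinomial_data_def Suc_le_eq)
  then show "fst ` trinomial_vars n = {..<3}"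
    by (force simp: trinomial_vars_def image_iff)
  fix v assume v: "v \<in> trinomial_vars n"
  then show "(\<lambda>(i, j). l i j) v > 0"
    using assms(1) by (auto simp: trinomial_vars_def trinomial_data_def)
  assume uniq: "\<And>u. u \<in> trinomial_vars n \<Longrightarrow> fst u = fst v \<Longrightarrow> u = v"
  obtain i j where ij: "v = (i, j)" "i < 3" "1 \<le> j" "j \<le> n i"
    using v by (auto simp: trinomial_vars_def)
  \<comment> \<open>Uniqueness for the first and the last variable of the block forces
    \<open>n i = 1\<close>, and the condition on linear terms then bounds
    \<open>l i 1\<close>.\<close>
  have "(i, 1) = v" "(i, n i) = v"
    using uniq[of "(i, 1)"] uniq[of "(i, n i)"] ij by (auto simp: trinomial_vars_def)
  then have "n i = 1" "v = (i, 1)" using ij by auto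
  then show "(\<lambda>(i, j). l i j) v \<ge> 2"
    using assms(2) ij(2) by (auto simp: no_linear_term_def)
qed

lemma trinomial_eq_tri: "trinomial n l = tri (trinomial_vars n) (\<lambda>(i, j). l i j)"
proof -
  have prod: "(\<Prod>v\<in>A. single (g v) (1::'b::comm_ring_1)) = single (\<Sum>v\<in>A. g v) 1"
    if "finite A" for A and g :: "'c \<Rightarrow> 'd \<Rightarrow>\<^sub>0 nat"
    using that by (induction A rule: finite_induct) (auto simp: mult_single)
  have "(\<Prod>j=1..n i. mpoly_var (i, j) ^ l i j) =
      (single (block_exp (trinomial_vars n) (\<lambda>(i, j). l i j) i) 1 :: (nat \<times> nat, 'b::comm_ring_1) mpoly)"
    if "i < 3" for i
  proof -
    have "(\<Prod>j=1..n i. mpoly_var (i, j) ^ l i j) =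
        (single (\<Sum>j=1..n i. single (i, j) (l i j)) 1 :: (nat \<times> nat, 'b) mpoly)"
      by (subst prod[symmetric]) (auto simp: single_var_power)
    also have "(\<Sum>j=1..n i. single (i, j) (l i j)) = block_exp (trinomial_vars n) (\<lambda>(i, j). l i j) i"
    proof -
      have "{v \<in> trinomial_vars n. fst v = i} = Pair i ` {1..n i}"
        using that by (auto simp: trinomial_vars_def)
      then show ?thesis by (simp add: block_exp_def sum.reindex inj_on_def)
    qed
    finally show ?thesis .
  qed
  then show ?thesis unfolding trinomial_def tri_def by (intro sum.cong refl) simp
qed

theorem theorem5:
  fixes f g :: "(nat \<times> nat, 'a::{alg_closed_field, field_char_0}) mpoly"
    and n n' :: "nat \<Rightarrow> nat" and l l' :: "nat \<Rightarrow> nat \<Rightarrow> nat"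
  defines "V \<equiv> trinomial_vars n" and "W \<equiv> trinomial_vars n'"
  assumes "trinomial_data n l" and "no_linear_term n l" and "f = trinomial n l"
    and "trinomial_data n' l'" and "no_linear_term n' l'" and "g = trinomial n' l'"
    and "rigid V (zero_locus V f)"
  shows "isomorphic_varieties V (zero_locus V f) W (zero_locus W g) \<longleftrightarrow>
    (\<exists>\<sigma>. bij_betw \<sigma> V W \<and> mpoly_rename \<sigma> f = g)"
proof
  let ?L = "\<lambda>(i, j). l i j" and ?L' = "\<lambda>(i, j). l' i j"
  interpret source: trinomial_setup V ?L
    unfolding V_def by (rule trinomial_setup_trinomial) fact+
  interpret target: trinomial_setup W ?L'
    unfolding W_def by (rule trinomial_setup_trinomial) fact+
  have f: "f = tri V ?L" and g: "g = tri W ?L'"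
    using assms by (simp_all add: trinomial_eq_tri)
  {
    assume "isomorphic_varieties V (zero_locus V f) W (zero_locus W g)"
    then obtain F G where FG: "mpoly_iso V (zero_locus V f) W (zero_locus W g) F G"
      using mpoly_iso_of_isomorphic_varieties[OF source.finite_V target.finite_V]
      by (metis (no_types, lifting) zero_locus_def mem_Collect_eq subsetI)
    interpret mpoly_iso V "zero_locus V f" W "zero_locus W g" F G by (fact FG)
    interpret trinomial_iso V "zero_locus V f" W "zero_locus W g" F G ?L ?L'
      by unfold_locales (simp_all add: tri_locus_def f g)
    obtain F' G' \<kappa> where "graded_trinomial_iso V (zero_locus V f) W (zero_locus W g) F' G' ?L ?L' \<kappa>"
      using graded assms by metis
    then obtain \<sigma> where "bij_betw \<sigma> V W" "mpoly_subst (\<lambda>v. mpoly_var (\<sigma> v)) f = g"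
      unfolding f g by (rule graded_trinomial_iso.permutation)
    then show "\<exists>\<sigma>. bij_betw \<sigma> V W \<and> mpoly_rename \<sigma> f = g"
      by (auto simp: mpoly_rename_def mpoly_subst_def)
  next
    assume "\<exists>\<sigma>. bij_betw \<sigma> V W \<and> mpoly_rename \<sigma> f = g"
    then show "isomorphic_varieties V (zero_locus V f) W (zero_locus W g)"
      using isomorphic_varieties_permutation source.tri_over unfolding f by blast
  }
qed

end
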